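(* Let $$\Lambda=\sum_{\substack{xh,\,yh'\in\bigcup_{i=1}^r\Gamma_i^\times,\\ \tau(xh)\ne\tau(yh')}}\nu(yh')\cdot\frac{\xi(\tau(xh))}{\xi(\tau(yh'))}\cdot\frac{\partial}{\partial z}\biggl[\sum_{w\in\Gamma_{\tau(x)}^\times}p(yh',yh'w)\cdot z\cdot\overline{G}(h'w,xh|z)\biggr]\Biggl|_{z=1}$$ and $$\Delta=\sum_{\substack{xh,\,yh'\in\bigcup_{i=1}^r\Gamma_i^\times,\\ \tau(xh)\ne\tau(yh')}}\nu(yh')\cdot\frac{\xi(\tau(xh))}{\xi(\tau(yh'))}\cdot l(x)\cdot\sum_{w\in\Gamma_{\tau(x)}^\times}p(yh',yh'w)\cdot\overline{G}(h'w,xh|1),$$ where elements of $\bigcup_i\Gamma_i^\times$ are written as $xh$, $yh'$ with $x,y\in\bigcup_iR_i$ and $h,h'\in H$. Then $$\lim_{n\to\infty}\frac{l(X_n)}{n}=\frac{\Delta}{\Lambda}\quad\text{almost surely}.$$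
   Context: Setting. Let $2\le r\in\mathbb{N}$, and let $\Gamma_1,\dots,\Gamma_r$ be finite groups with identities $e_1,\dots,e_r$ and subgroups $H_1\subset\Gamma_1,\dots,H_r\subset\Gamma_r$, all isomorphic to one finite group $H$; via fixed isomorphisms each $H_i$ is identified with $H$. For each $i$ fix representatives $x_{i,1}=e_i,x_{i,2},\dots,x_{i,n_i}$ of the left cosets $yH$ in $\Gamma_i$, $n_i=[\Gamma_i:H]$; put $R_i=\{x_{i,2},\dots,x_{i,n_i}\}$ and $\Gamma_i^\times=\Gamma_i\setminus H$. For $x\in\bigcup_i\Gamma_i$ let $\tau(x)=i$ if $x\in\Gamma_i^\times$ and $\tau(x)=0$ if $x\in H$. $\Gamma=\Gamma_1\ast_H\cdots\ast_H\Gamma_r$ is the free product by amalgamation with respect to $H$; its elements are written as $x_1x_2\dots x_nh$ with $n\in\mathbb{N}_0$, $h\in H$, $x_j\in\bigcup_iR_i$, $\tau(x_j)\ne\tau(x_{j+1})$. The case $r=2=[\Gamma_1:H]=[\Gamma_2:H]$ is excluded. The natural word length is $\Vert x_1\dots x_nh\Vert=n$. A function $l:\bigcup_iR_i\to[0,\infty)$ is given and extended to $\Gamma$ by $l(x_1\dots x_nh)=\sum_{j=1}^nl(x_j)$. Random walk. $\mu_i$ is a probability measure on $\Gamma_i$; $\alpha_1,\dots,\alpha_r>0$ with $\sum_i\alpha_i=1$; $\mu(x)=\alpha_{\tau(x)}\mu_{\tau(x)}(x)$ for $x\in\bigcup_i\Gamma_i^\times$, $\mu(x)=\sum_i\alpha_i\mu_i(x)$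 for $x\in H$, and $\mu(x)=0$ otherwise. $(X_n)_{n\ge0}$ is the random walk on $\Gamma$ with transition probabilities $p(w_1,w_2)=\mu(w_1^{-1}w_2)$ and $X_0=e$ (the identity); it is transient. $\mathbb{P}_w$ denotes its law when started at $w$. Notation. For $i\in\{1,\dots,r\}$, $x,y\in R_i$, $h,h'\in H$, real $z>0$: $$H(xh,h'|z)=\sum_{n\ge1}\mathbb{P}_{xh}[X_n=h',\ \forall m<n:\Vert X_m\Vert\ge1]\,z^n,$$ $$\xi(i)=\sum_{gh_1\in\bigcup_{j\ne i}\Gamma_j^\times}\mu(gh_1)\Bigl(1-\sum_{h_2\in H}H(gh_1,h_2|1)\Bigr)>0,$$ $$\overline{G}(xh,yh'|z)=\sum_{n\ge0}\mathbb{P}_{xh}[X_n=yh',\ \forall m\le n:\Vert X_m\Vert\ge1]\,z^n.$$ Let $\mathbf{e}_k=\sup\{m\in\mathbb{N}_0:\Vert X_m\Vert=k\}$, $\mathbf{W}_k=X_{\mathbf{e}_k}$ and $[x_1\dots x_nh]=x_nh$ for $n\ge1$. Then $([\mathbf{W}_k])_{k\in\mathbb{N}}$ is an irreducible Markov chain on a finite state space (consisting of elements $xh$ with $x\in\bigcup_iR_i$, $h\in H$), and $\nu$ denotes its invariant probability measure. *)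

theory Defs
  imports "HOL-Probability.Probability" "HOL-Algebra.Coset"
begin

text \<open>
  Elements of the free product by amalgamation are classes of words; a letter \<open>(i, g)\<close> stands for
  the element \<open>g\<close> of the \<open>i\<close>-th factor.
\<close>

type_synonym 'a amalg = "(nat \<times> 'a) list set"

locale amalgam =
  fixes r :: nat
    and \<Gamma> :: "nat \<Rightarrow> 'a monoid"
    and Hs :: "nat \<Rightarrow> 'a set"
    and H :: "'h monoid"
    and \<phi> :: "nat \<Rightarrow> 'h \<Rightarrow> 'a"
    and T :: "nat \<Rightarrow> 'a set"
  assumes r_ge_2: "2 \<le> r"
    and group_factor: "i \<in> {1..r} \<Longrightarrow> group (\<Gamma> i)"
    and finite_factor: "i \<in> {1..r} \<Longrightarrow> finite (carrier (\<Gamma> i))"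
    and subgroup_factor: "i \<in> {1..r} \<Longrightarrow> subgroup (Hs i) (\<Gamma> i)"
    and group_H: "group H"
    and finite_H: "finite (carrier H)"
    and iso_H: "i \<in> {1..r} \<Longrightarrow> \<phi> i \<in> iso H ((\<Gamma> i)\<lparr>carrier := Hs i\<rparr>)"
    and reps_carrier: "i \<in> {1..r} \<Longrightarrow> T i \<subseteq> carrier (\<Gamma> i)"
    and reps_one: "i \<in> {1..r} \<Longrightarrow> \<one>\<^bsub>\<Gamma> i\<^esub> \<in> T i"
    and reps_coset: "\<lbrakk>i \<in> {1..r}; y \<in> carrier (\<Gamma> i)\<rbrakk> \<Longrightarrow> \<exists>!x. x \<in> T i \<and> x \<in> y <#\<^bsub>\<Gamma> i\<^esub> Hs i"
    and not_dihedral: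
      "\<not> (r = 2 \<and> card (rcosets\<^bsub>\<Gamma> 1\<^esub> (Hs 1)) = 2 \<and> card (rcosets\<^bsub>\<Gamma> 2\<^esub> (Hs 2)) = 2)"
begin

definition letters :: "(nat \<times> 'a) set" where
  "letters = (SIGMA i:{1..r}. carrier (\<Gamma> i))"

inductive eqv :: "(nat \<times> 'a) list \<Rightarrow> (nat \<times> 'a) list \<Rightarrow> bool" where
  refl: "u \<in> lists letters \<Longrightarrow> eqv u u"
| sym: "eqv u v \<Longrightarrow> eqv v u"
| trans: "eqv u v \<Longrightarrow> eqv v w \<Longrightarrow> eqv u w"
| mult: "\<lbrakk>u \<in> lists letters; v \<in> lists letters; i \<in> {1..r}; a \<in> carrier (\<Gamma> i); b \<in> carrier (\<Gamma> i)\<rbrakk>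
    \<Longrightarrow> eqv (u @ [(i, a), (i, b)] @ v) (u @ [(i, a \<otimes>\<^bsub>\<Gamma> i\<^esub> b)] @ v)"
| one: "\<lbrakk>u \<in> lists letters; v \<in> lists letters; i \<in> {1..r}\<rbrakk>
    \<Longrightarrow> eqv (u @ [(i, \<one>\<^bsub>\<Gamma> i\<^esub>)] @ v) (u @ v)"
| amalg: "\<lbrakk>u \<in> lists letters; v \<in> lists letters; i \<in> {1..r}; j \<in> {1..r}; h \<in> carrier H\<rbrakk>
    \<Longrightarrow> eqv (u @ [(i, \<phi> i h)] @ v) (u @ [(j, \<phi> j h)] @ v)"

definition cls :: "(nat \<times> 'a) list \<Rightarrow> 'a amalg" where
  "cls u = {v. eqv u v}"

definition G :: "'a amalg monoid" where
  "G = \<lparr>carrier = cls ` lists letters,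
        mult = (\<lambda>A B. \<Union>u\<in>A. \<Union>v\<in>B. cls (u @ v)),
        one = cls []\<rparr>"

definition \<iota> :: "nat \<Rightarrow> 'a \<Rightarrow> 'a amalg" where
  "\<iota> i g = cls [(i, g)]"

text \<open>
  From here on the factors, the amalgamated subgroup and the coset representatives are regarded as
  subsets of the amalgam.
\<close>

definition Fac :: "nat \<Rightarrow> 'a amalg set" where
  "Fac i = \<iota> i ` carrier (\<Gamma> i)"

definition HH :: "'a amalg set" where
  "HH = (\<lambda>h. \<iota> 1 (\<phi> 1 h)) ` carrier H"

definition FacX :: "nat \<Rightarrow> 'a amalg set" where
  "FacX i = Fac i - HH"

definition R :: "nat \<Rightarrow> 'a amalg set" where
  "R i = \<iota> i ` (T i - {\<one>\<^bsub>\<Gamma> i\<^esub>})"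

definition RR :: "'a amalg set" where
  "RR = (\<Union>i\<in>{1..r}. R i)"

definition \<tau> :: "'a amalg \<Rightarrow> nat" where
  "\<tau> x = (if x \<in> HH then 0 else THE i. i \<in> {1..r} \<and> x \<in> FacX i)"

definition normal :: "'a amalg list \<Rightarrow> 'a amalg \<Rightarrow> bool" where
  "normal xs h \<longleftrightarrow> set xs \<subseteq> RR \<and> h \<in> HH \<and>
     (\<forall>j. Suc j < length xs \<longrightarrow> \<tau> (xs ! j) \<noteq> \<tau> (xs ! Suc j))"

text \<open>
  The pair \<open>([x\<^sub>1, \<dots>, x\<^sub>n], h)\<close> with \<open>w = x\<^sub>1 \<dots> x\<^sub>n h\<close>; it is unique by the normal form
  theorem for free products by amalgamation.
\<close>

definition nf :: "'a amalg \<Rightarrow> 'a amalg list \<times> 'a amalg" where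
  "nf w = (THE p. normal (fst p) (snd p) \<and> w = foldr (\<lambda>x y. x \<otimes>\<^bsub>G\<^esub> y) (fst p) (snd p))"

definition wlen :: "'a amalg \<Rightarrow> nat" where
  "wlen w = length (fst (nf w))"

text \<open>The bracket \<open>[x\<^sub>1 \<dots> x\<^sub>n h] = x\<^sub>n h\<close>, meaningful for \<open>n \<ge> 1\<close> only.\<close>

definition bracket :: "'a amalg \<Rightarrow> 'a amalg" where
  "bracket w = last (fst (nf w)) \<otimes>\<^bsub>G\<^esub> snd (nf w)"

definition lext :: "('a amalg \<Rightarrow> real) \<Rightarrow> 'a amalg \<Rightarrow> real" where
  "lext l w = (\<Sum>x\<leftarrow>fst (nf w). l x)"

definition mu :: "(nat \<Rightarrow> real) \<Rightarrow> (nat \<Rightarrow> 'a pmf) \<Rightarrow> 'a amalg \<Rightarrow> real" where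
  "mu \<alpha> \<mu> x =
    (if x \<in> (\<Union>i\<in>{1..r}. FacX i) then \<alpha> (\<tau> x) * pmf (map_pmf (\<iota> (\<tau> x)) (\<mu> (\<tau> x))) x
     else if x \<in> HH then \<Sum>i\<in>{1..r}. \<alpha> i * pmf (map_pmf (\<iota> i) (\<mu> i)) x
     else 0)"

definition p :: "(nat \<Rightarrow> real) \<Rightarrow> (nat \<Rightarrow> 'a pmf) \<Rightarrow> 'a amalg \<Rightarrow> 'a amalg \<Rightarrow> real" where
  "p \<alpha> \<mu> w1 w2 = mu \<alpha> \<mu> (inv\<^bsub>G\<^esub> w1 \<otimes>\<^bsub>G\<^esub> w2)"

lemma eqv_words: "eqv u v \<Longrightarrow> u \<in> lists letters \<and> v \<in> lists letters"
proof (induction rule: eqv.induct)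
  case (mult u v i a b)
  then show ?case
    using monoid.m_closed[OF group.is_monoid[OF group_factor]] by (auto simp: letters_def)
next
  case (one u v i)
  then show ?case
    using monoid.one_closed[OF group.is_monoid[OF group_factor]] by (auto simp: letters_def)
next
  case (amalg u v i j h)
  have "\<phi> k h \<in> carrier (\<Gamma> k)" if "k \<in> {1..r}" for k
  proof -
    have "\<phi> k h \<in> Hs k"
      using iso_H[OF that] amalg by (auto simp: iso_def hom_def)
    then show ?thesis
      using subgroup.subset[OF subgroup_factor[OF that]] by auto
  qed
  then show ?case using amalg by (auto simp: letters_def)
qed auto

lemma eqv_append:
  assumes "eqv u v" "x \<in> lists letters" "y \<in> lists letters"
  shows "eqv (x @ u @ y) (x @ v @ y)"
  using assms
proof (induction rule: eqv.induct)
  case (refl u)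
  then show ?case by (intro eqv.refl) auto
next
  case (sym u v)
  then show ?case by (blast intro: eqv.sym)
next
  case (trans u v w)
  then show ?case by (blast intro: eqv.trans)
next
  case (mult u v i a b)
  then show ?case using eqv.mult[of "x @ u" "v @ y" i a b] by simp
next
  case (one u v i)
  then show ?case using eqv.one[of "x @ u" "v @ y" i] by simp
next
  case (amalg u v i j h)
  then show ?case using eqv.amalg[of "x @ u" "v @ y" i j h] by simp
qed

lemma cls_eq_iff:
  assumes "u \<in> lists letters"
  shows "cls u = cls v \<longleftrightarrow> eqv u v"
proof
  assume "cls u = cls v"
  moreover have "u \<in> cls u" using assms by (simp add: cls_def eqv.refl)
  ultimately have "eqv v u" by (simp add: cls_def)
  then show "eqv u v" by (rule eqv.sym)
next
  assume *: "eqv u v"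
  have "eqv u w \<longleftrightarrow> eqv v w" for w
    using eqv.trans[OF *, of w] eqv.trans[OF eqv.sym[OF *], of w] by (rule iffI[rotated])
  then show "cls u = cls v" by (simp add: cls_def)
qed

lemma mult_cls:
  assumes "u \<in> lists letters" "v \<in> lists letters"
  shows "cls u \<otimes>\<^bsub>G\<^esub> cls v = cls (u @ v)"
proof -
  have "cls (u' @ v') = cls (u @ v)" if "eqv u u'" "eqv v v'" for u' v'
  proof -
    have "eqv (u @ v) (u' @ v)" using eqv_append[OF that(1), of "[]" v] assms by simp
    moreover have "eqv (u' @ v) (u' @ v')"
      using eqv_append[OF that(2), of u' "[]"] eqv_words[OF that(1)] by simp
    ultimately have "eqv (u @ v) (u' @ v')" by (rule eqv.trans)
    moreover have "u @ v \<in> lists letters" using assms by simp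
    ultimately show ?thesis using cls_eq_iff by metis
  qed
  then have *: "cls (u' @ v') = cls (u @ v)" if "u' \<in> cls u" "v' \<in> cls v" for u' v'
    using that by (simp add: cls_def)
  have "u \<in> cls u" "v \<in> cls v"
    using assms by (simp_all add: cls_def eqv.refl)
  then have "(\<Union>u'\<in>cls u. \<Union>v'\<in>cls v. cls (u' @ v')) = cls (u @ v)"
    using * by blast
  then show ?thesis by (simp add: G_def)
qed

lemma mult_\<iota>:
  assumes "i \<in> {1..r}" "a \<in> carrier (\<Gamma> i)" "b \<in> carrier (\<Gamma> i)"
  shows "\<iota> i a \<otimes>\<^bsub>G\<^esub> \<iota> i b = \<iota> i (a \<otimes>\<^bsub>\<Gamma> i\<^esub> b)"
  using assms eqv.mult[of "[]" "[]" i a b] mult_cls[of "[(i, a)]" "[(i, b)]"]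
  by (simp add: \<iota>_def letters_def cls_eq_iff)

lemma inverse_word: "u \<in> lists letters \<Longrightarrow> \<exists>v\<in>lists letters. eqv (v @ u) []"
proof (induction u)
  case Nil
  have "eqv ([] @ []) []" by (simp add: eqv.refl)
  then show ?case by blast
next
  case (Cons l u)
  obtain i a where l: "l = (i, a)" "i \<in> {1..r}" "a \<in> carrier (\<Gamma> i)"
    using Cons.prems by (cases l) (auto simp: letters_def)
  obtain v where v: "v \<in> lists letters" "eqv (v @ u) []" using Cons by auto
  interpret g: group "\<Gamma> i" using group_factor l by blast
  have u: "u \<in> lists letters" using Cons.prems by simp
  let ?b = "inv\<^bsub>\<Gamma> i\<^esub> a"
  have "eqv (v @ [(i, ?b), (i, a)] @ u) (v @ [(i, ?b \<otimes>\<^bsub>\<Gamma> i\<^esub> a)] @ u)"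
    using l v u by (intro eqv.mult) auto
  also have "?b \<otimes>\<^bsub>\<Gamma> i\<^esub> a = \<one>\<^bsub>\<Gamma> i\<^esub>" using l by simp
  finally have "eqv (v @ [(i, ?b), (i, a)] @ u) (v @ u)"
    using eqv.one[OF v(1) u l(2)] eqv.trans by blast
  then have "eqv ((v @ [(i, ?b)]) @ l # u) []" using v(2) eqv.trans l by auto
  moreover have "v @ [(i, ?b)] \<in> lists letters" using v l by (auto simp: letters_def)
  ultimately show ?case by blast
qed

lemma group_G: "group G"
proof (rule groupI)
  show "\<exists>y\<in>carrier G. y \<otimes>\<^bsub>G\<^esub> x = \<one>\<^bsub>G\<^esub>" if "x \<in> carrier G" for x
  proof -
    obtain u where u: "x = cls u" "u \<in> lists letters" using \<open>x \<in> carrier G\<close> by (auto simp: G_def)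
    then obtain v where v: "v \<in> lists letters" "eqv (v @ u) []" using inverse_word by blast
    then have "cls v \<otimes>\<^bsub>G\<^esub> x = cls []"
      using u mult_cls cls_eq_iff by (metis append_in_lists_conv)
    then show ?thesis using v by (auto simp: G_def)
  qed
next
  fix x y assume "x \<in> carrier G" "y \<in> carrier G"
  then obtain u v where *: "x = cls u" "y = cls v" "u \<in> lists letters" "v \<in> lists letters"
    by (auto simp: G_def)
  show "x \<otimes>\<^bsub>G\<^esub> y \<in> carrier G"
    unfolding *(1,2) mult_cls[OF *(3,4)] using * by (auto simp: G_def)
next
  fix x y z assume "x \<in> carrier G" "y \<in> carrier G" "z \<in> carrier G"
  then obtain u v w where *: "x = cls u" "y = cls v" "z = cls w"
      "u \<in> lists letters" "v \<in> lists letters" "w \<in> lists letters"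
    by (auto simp: G_def)
  then show "x \<otimes>\<^bsub>G\<^esub> y \<otimes>\<^bsub>G\<^esub> z = x \<otimes>\<^bsub>G\<^esub> (y \<otimes>\<^bsub>G\<^esub> z)" by (simp add: mult_cls)
next
  show "\<one>\<^bsub>G\<^esub> \<in> carrier G" by (auto simp: G_def)
next
  fix x assume "x \<in> carrier G"
  then obtain u where *: "x = cls u" "u \<in> lists letters" by (auto simp: G_def)
  have "\<one>\<^bsub>G\<^esub> = cls []" by (simp add: G_def)
  then show "\<one>\<^bsub>G\<^esub> \<otimes>\<^bsub>G\<^esub> x = x" using * by (simp add: mult_cls)
qed

end

text \<open>
  \<open>P w\<close> is the law of the walk started at \<open>w\<close>; all these laws live on one path space with one
  coordinate process \<open>X\<close>.
\<close>

locale amalgam_walk = amalgam r \<Gamma> Hs H \<phi> T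
  for r :: nat
    and \<Gamma> :: "nat \<Rightarrow> 'a monoid"
    and Hs :: "nat \<Rightarrow> 'a set"
    and H :: "'h monoid"
    and \<phi> :: "nat \<Rightarrow> 'h \<Rightarrow> 'a"
    and T :: "nat \<Rightarrow> 'a set" +
  fixes l :: "'a amalg \<Rightarrow> real"
    and \<alpha> :: "nat \<Rightarrow> real"
    and \<mu> :: "nat \<Rightarrow> 'a pmf"
    and P :: "'a amalg \<Rightarrow> 'w measure"
    and X :: "nat \<Rightarrow> 'w \<Rightarrow> 'a amalg"
  assumes l_nonneg: "x \<in> RR \<Longrightarrow> 0 \<le> l x"
    and \<alpha>_pos: "i \<in> {1..r} \<Longrightarrow> 0 < \<alpha> i"
    and \<alpha>_sum: "(\<Sum>i\<in>{1..r}. \<alpha> i) = 1"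
    and \<mu>_factor: "i \<in> {1..r} \<Longrightarrow> set_pmf (\<mu> i) \<subseteq> carrier (\<Gamma> i)"
    and prob_P: "w \<in> carrier G \<Longrightarrow> prob_space (P w)"
    and measurable_X: "w \<in> carrier G \<Longrightarrow> X n \<in> P w \<rightarrow>\<^sub>M count_space (carrier G)"
    and law_X: "\<lbrakk>w \<in> carrier G; \<And>m. m \<le> n \<Longrightarrow> ws m \<in> carrier G\<rbrakk> \<Longrightarrow>
      \<P>(\<omega> in P w. \<forall>m\<le>n. X m \<omega> = ws m) =
        (if ws 0 = w then \<Prod>m<n. p \<alpha> \<mu> (ws m) (ws (Suc m)) else 0)"
begin

definition transient :: bool where
  "transient \<longleftrightarrow> (\<forall>w\<in>carrier G. \<P>(\<omega> in P w. \<exists>n\<ge>1. X n \<omega> = w) < 1)"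

definition Hgen :: "'a amalg \<Rightarrow> 'a amalg \<Rightarrow> real \<Rightarrow> real" where
  "Hgen g h z =
    (\<Sum>n. \<P>(\<omega> in P g. X (Suc n) \<omega> = h \<and> (\<forall>m<Suc n. 1 \<le> wlen (X m \<omega>))) * z ^ Suc n)"

definition \<xi> :: "nat \<Rightarrow> real" where
  "\<xi> i = (\<Sum>g\<in>(\<Union>j\<in>{1..r} - {i}. FacX j). mu \<alpha> \<mu> g * (1 - (\<Sum>h\<in>HH. Hgen g h 1)))"

definition Gbar :: "'a amalg \<Rightarrow> 'a amalg \<Rightarrow> real \<Rightarrow> real" where
  "Gbar a b z =
    (\<Sum>n. \<P>(\<omega> in P a. X n \<omega> = b \<and> (\<forall>m\<le>n. 1 \<le> wlen (X m \<omega>))) * z ^ n)"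

text \<open>Almost surely the set is nonempty and finite, so the supremum is its maximum.\<close>

definition exit_time :: "nat \<Rightarrow> 'w \<Rightarrow> nat" where
  "exit_time k \<omega> = Sup {m. wlen (X m \<omega>) = k}"

definition W :: "nat \<Rightarrow> 'w \<Rightarrow> 'a amalg" where
  "W k \<omega> = X (exit_time k \<omega>) \<omega>"

text \<open>
  The chain \<open>[W\<^sub>k]\<close>, for \<open>k \<ge> 1\<close> under \<open>P \<one>\<close>, with state space the set of all attained states.
  The chain is time-homogeneous, so its transition probabilities may be read off at any
  \<open>k\<close> for which the conditioning event has positive probability; the least one is used.
\<close>

definition S :: "'a amalg set" where
  "S = {s. \<exists>k\<ge>1. 0 < \<P>(\<omega> in P \<one>\<^bsub>G\<^esub>. bracket (W k \<omega>) = s)}"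

definition Q :: "'a amalg \<Rightarrow> 'a amalg \<Rightarrow> real" where
  "Q s t =
    (let k = (LEAST k. 1 \<le> k \<and> 0 < \<P>(\<omega> in P \<one>\<^bsub>G\<^esub>. bracket (W k \<omega>) = s))
     in \<P>(\<omega> in P \<one>\<^bsub>G\<^esub>. bracket (W (Suc k) \<omega>) = t \<bar> bracket (W k \<omega>) = s))"

definition irreducible_chain :: bool where
  "irreducible_chain \<longleftrightarrow> (\<forall>s\<in>S. \<forall>t\<in>S. (s, t) \<in> {(a, b). a \<in> S \<and> b \<in> S \<and> 0 < Q a b}\<^sup>*)"

definition invariant :: "'a amalg pmf \<Rightarrow> bool" where
  "invariant \<nu> \<longleftrightarrow> set_pmf \<nu> \<subseteq> S \<and> (\<forall>t\<in>S. pmf \<nu> t = (\<Sum>s\<in>S. pmf \<nu> s * Q s t))"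

text \<open>
  Each element of a factor outside the amalgamated subgroup is \<open>x h\<close> for exactly one pair of a
  representative \<open>x \<in> RR\<close> and \<open>h \<in> HH\<close>, so the double sums range over quadruples
  \<open>(x, h, y, h')\<close>.
\<close>

definition pairs :: "('a amalg \<times> 'a amalg \<times> 'a amalg \<times> 'a amalg) set" where
  "pairs = {(x, h, y, h'). x \<in> RR \<and> h \<in> HH \<and> y \<in> RR \<and> h' \<in> HH \<and>
     \<tau> (x \<otimes>\<^bsub>G\<^esub> h) \<noteq> \<tau> (y \<otimes>\<^bsub>G\<^esub> h')}"

definition \<Lambda> :: "'a amalg pmf \<Rightarrow> real" where
  "\<Lambda> \<nu> = (\<Sum>(x, h, y, h')\<in>pairs.
     pmf \<nu> (y \<otimes>\<^bsub>G\<^esub> h') * (\<xi> (\<tau> (x \<otimes>\<^bsub>G\<^esub> h)) / \<xi> (\<tau> (y \<otimes>\<^bsub>G\<^esub> h'))) *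
     deriv (\<lambda>z. \<Sum>w\<in>FacX (\<tau> x).
       p \<alpha> \<mu> (y \<otimes>\<^bsub>G\<^esub> h') (y \<otimes>\<^bsub>G\<^esub> h' \<otimes>\<^bsub>G\<^esub> w) * z * Gbar (h' \<otimes>\<^bsub>G\<^esub> w) (x \<otimes>\<^bsub>G\<^esub> h) z) 1)"

definition \<Delta> :: "'a amalg pmf \<Rightarrow> real" where
  "\<Delta> \<nu> = (\<Sum>(x, h, y, h')\<in>pairs.
     pmf \<nu> (y \<otimes>\<^bsub>G\<^esub> h') * (\<xi> (\<tau> (x \<otimes>\<^bsub>G\<^esub> h)) / \<xi> (\<tau> (y \<otimes>\<^bsub>G\<^esub> h'))) * l x *
     (\<Sum>w\<in>FacX (\<tau> x).
       p \<alpha> \<mu> (y \<otimes>\<^bsub>G\<^esub> h') (y \<otimes>\<^bsub>G\<^esub> h' \<otimes>\<^bsub>G\<^esub> w) * Gbar (h' \<otimes>\<^bsub>G\<^esub> w) (x \<otimes>\<^bsub>G\<^esub> h) 1))"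

end

end

(*
  Each step of the walk moves within a coset of a finite factor, so its path decomposes at the last
  visits to the spheres of the word length.  Write u(w) for the Green function
  G(w, e).  By transience u is finite, and its square root f is superharmonic; a step with positive
  escape probability prevents f from being almost constant on large balls, whence P^N f <= (1 - d) f
  and the transition probabilities decay exponentially.  All generating functions involved
  therefore converge beyond z = 1.

  Decomposing paths at last exits shows that the matrix K(z) of the last exit chain, twisted by
  z^(time) exp(c l), governs sum_n z^n E exp(c l(X_n)).  At z = 1, c = 0 it is conjugate to the
  stochastic matrix Q, and its first-order variation in the direction (c, log z) = t (a, b) averages
  to t (a Delta + b Lambda) under nu.  If a Delta + b Lambda < 0, the twisted matrix is
  contracting for small t > 0 and sum_n E exp(t (a l(X_n) + b n)) is finite.  The choices
  (a, b) = (1, -(c0 + eps)) and (-1, c0 - eps) with c0 = Delta / Lambda, together with the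
  Borel-Cantelli lemma, give the almost sure limit; no ergodic theorem is needed.
*)

theory Submission
  imports Defs
begin

section \<open>Integer paths and finite Markov chains\<close>

text \<open>The step measures may be non-symmetric and need not generate the group. So the decay
  cannot rest on a self-adjoint operator, and positivity arguments are confined to points that the
  walk reaches: \<open>RH\<close> in the decay estimate, \<open>visited\<close> (equal to the state
  space \<open>S\<close>) in the twisted one. The square root enters because the Green function is
  harmonic away from the identity and loses nothing there. Under Jensen's inequality the square root
  loses a variance, so a small loss over \<open>N\<close> steps means that it is nearly constant at
  the points reached with sizeable probability. The conjugation at z = 1 is by \<open>\<xi>\<close>,
  the probability of leaving a coset at once and for good into deeper cones. That the conjugated
  matrix is stochastic is not computed; it is read off the process of exit points. Perturbation of
  eigenvalues is avoided: contraction is certified by the explicit positive vector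
  \<open>\<xi> (ltype t) * (1 + \<theta> * g t)\<close>, with \<open>g\<close> from a drift
  inequality, and only derivatives of finitely many row sums at \<open>\<theta> = 0\<close> are
  used. The estimates along spheres truncate time at \<open>M\<close> on both sides, so convergence
  of the twisted series is a conclusion and not a premise.\<close>

lemma finite_positive_lower_bound:
  assumes "finite A" "\<And>x. x \<in> A \<Longrightarrow> 0 < (x::real)"
  obtains c where "0 < c" "c \<le> 1" "\<And>x. x \<in> A \<Longrightarrow> c \<le> x"
  using Min_in[of "insert 1 A"] Min_le[of "insert 1 A"] assms by (metis finite_insert insertCI insert_iff insert_not_empty zero_less_one)

text \<open>A discrete intermediate value theorem. Only upward steps are bounded, so a level can be
  jumped over on the way down but not on the way up.\<close>

lemma unit_step_crossing:
  fixes L :: "nat \<Rightarrow> nat"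
  assumes step: "\<And>m. L (Suc m) \<le> Suc (L m)"
  shows "i \<le> j \<Longrightarrow> L i \<le> k \<Longrightarrow> k \<le> L j \<Longrightarrow> \<exists>m\<in>{i..j}. L m = k"
proof (induction j rule: dec_induct)
  case (step n)
  show ?case
  proof (cases "k \<le> L n")
    case True
    then show ?thesis using step by auto
  next
    case False
    then have "L (Suc n) = k" using assms[of n] step.prems by simp
    then show ?thesis using step by auto
  qed
qed auto

text \<open>Finite level sets force \<open>L\<close> to infinity, so a value at most
  \<open>k\<close> after the last visit to \<open>k\<close> would have to cross \<open>k\<close>
  again on the way up. This turns the supremum in \<open>exit_time\<close> into a condition on the
  future of the path, to which the Markov property applies. The supremum of a set of naturals is its
  \<open>Max\<close>, which is informative only for finite sets.\<close>

lemma exit_seq: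
  fixes L :: "nat \<Rightarrow> nat"
  assumes L0: "L 0 = 0" and step: "\<And>m. L (Suc m) \<le> Suc (L m)" and fin: "\<And>k. finite {m. L m = k}"
  shows "Sup {m. L m = k} = m \<longleftrightarrow> L m = k \<and> (\<forall>j>m. k < L j)"
proof -
  have ev: "\<exists>j\<ge>N. k < L j" for N
  proof (rule ccontr)
    assume "\<not> ?thesis"
    then have "{N..} \<subseteq> (\<Union>i\<le>k. {m. L m = i})" by (auto simp: not_less)
    moreover have "finite (\<Union>i\<le>k. {m. L m = i})" using fin by blast
    ultimately show False using infinite_Ici finite_subset by blast
  qed
  have ne: "{m. L m = k} \<noteq> {}"
  proof -
    obtain j where "k < L j" using ev[of 0] by blast
    then obtain m where "L m = k" using unit_step_crossing[of L 0 j k, OF step] L0 by auto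
    then show ?thesis by blast
  qed
  let ?M = "Max {m. L m = k}"
  have M: "L ?M = k" "\<And>j. L j = k \<Longrightarrow> j \<le> ?M" using Max_in[OF fin ne] Max_ge[OF fin] by auto
  have after: "k < L j" if "?M < j" for j
  proof (rule ccontr)
    assume "\<not> k < L j"
    moreover obtain j' where "j \<le> j'" "k < L j'" using ev by blast
    ultimately obtain i where "j \<le> i" "L i = k" using unit_step_crossing[of L j j' k, OF step] by auto
    then show False using M(2)[of i] that by simp
  qed
  have "Sup {m. L m = k} = ?M" using ne by (simp only: Sup_nat_def if_False)
  moreover have "?M = m" if "L m = k" "\<forall>j>m. k < L j"
    using M that by (metis less_irrefl nat_less_le)
  ultimately show ?thesis using M after by auto
qed

section \<open>Harmonic functions and drift on a finite irreducible chain\<close>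

lemma bounded_finite_convergent_subsequence:
  fixes A :: "nat \<Rightarrow> 'b \<Rightarrow> real"
  assumes "finite I" "\<And>n s. s \<in> I \<Longrightarrow> \<bar>A n s\<bar> \<le> K"
  shows "\<exists>r L. strict_mono (r :: nat \<Rightarrow> nat) \<and> (\<forall>s\<in>I. (\<lambda>n. A (r n) s) \<longlonglongrightarrow> L s)"
  using assms
proof (induction I)
  case empty
  then show ?case using strict_mono_id by blast
next
  case (insert x I)
  have "\<exists>r L. strict_mono (r :: nat \<Rightarrow> nat) \<and> (\<forall>s\<in>I. (\<lambda>n. A (r n) s) \<longlonglongrightarrow> L s)"
    by (rule insert.IH) (use insert.prems in auto)
  then obtain r L where r: "strict_mono (r :: nat \<Rightarrow> nat)" "\<And>s. s \<in> I \<Longrightarrow> (\<lambda>n. A (r n) s)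
      \<longlonglongrightarrow> L s"
    by blast
  have "bounded (range (\<lambda>n. A (r n) x))"
    unfolding bounded_iff using insert.prems[of x] by auto
  then obtain a q where q: "strict_mono (q :: nat \<Rightarrow> nat)" "((\<lambda>n. A (r n) x) \<circ> q) \<longlonglongrightarrow> a"
    using bounded_imp_convergent_subsequence by blast
  have "(\<lambda>n. A ((r \<circ> q) n) s) \<longlonglongrightarrow> (L(x := a)) s" if "s \<in> insert x I" for s
  proof (cases "s = x")
    case True
    then show ?thesis using q(2) by (simp add: comp_def)
  next
    case False
    then have "s \<in> I" using that by simp
    from LIMSEQ_subseq_LIMSEQ[OF r(2)[OF this] q(1)] show ?thesis using False by (simp add: comp_def)
  qed
  moreover have "strict_mono (r \<circ> q)" using r q by (simp add: strict_mono_o)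
  ultimately show ?case by blast
qed

text \<open>Maximum principle: a state where \<open>f\<close> is maximal passes this on to every
  state reached from it with positive probability, and irreducibility spreads it over
  \<open>I\<close>.\<close>

lemma harmonic_constant:
  fixes P :: "'b \<Rightarrow> 'b \<Rightarrow> real"
  assumes fin: "finite I" and P0: "\<And>s t. s \<in> I \<Longrightarrow> 0 \<le> P s t" and P1: "\<And>s. s \<in> I
      \<Longrightarrow> (\<Sum>t\<in>I. P s t) = 1"
    and irr: "\<And>s t. s \<in> I \<Longrightarrow> t \<in> I \<Longrightarrow> (s, t) \<in> {(a, b). a \<in> I \<and> b \<in> I
        \<and> 0 < P a b}\<^sup>*"
    and harm: "\<And>s. s \<in> I \<Longrightarrow> (\<Sum>t\<in>I. P s t * f t) = f s" and st: "s \<in> I" "t \<in> I"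
  shows "f s = f t"
proof -
  define M where "M = Max (f ` I)"
  have M: "f x \<le> M" if "x \<in> I" for x unfolding M_def using fin that by auto
  have "M \<in> f ` I" unfolding M_def using fin st by (intro Max_in) auto
  then obtain x where x: "x \<in> I" "f x = M" by auto
  have step: "f b = M" if ab: "a \<in> I" "b \<in> I" "0 < P a b" "f a = M" for a b
  proof (rule ccontr)
    assume "f b \<noteq> M"
    then have "P a b * f b < P a b * M" using M[OF ab(2)] ab(3) by simp
    then have "(\<Sum>t\<in>I. P a t * f t) < (\<Sum>t\<in>I. P a t * M)"
      using fin ab M P0[OF ab(1)] by (intro sum_strict_mono_ex1 bexI[of _ b]) (auto intro: mult_left_mono)
    then show False using harm[OF ab(1)] P1[OF ab(1)] ab(4) by (simp add: sum_distrib_right[symmetric])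
  qed
  have "f y = M" if y: "y \<in> I" for y
    using irr[OF x(1) y]
  proof (induction rule: rtrancl_induct)
    case (step a b)
    then show ?case using \<open>\<And>a b. a \<in> I \<Longrightarrow> b \<in> I \<Longrightarrow> 0 < P a b \<Longrightarrow> f a
        = M \<Longrightarrow> f b = M\<close> by blast
  qed (rule x)
  then show ?thesis using st by simp
qed

text \<open>An inequality version of the Poisson equation, with a Cesaro mean in place of its solution.\<close>

lemma negative_drift:
  fixes P :: "'b \<Rightarrow> 'b \<Rightarrow> real"
  assumes fin: "finite I" and P0: "\<And>s t. s \<in> I \<Longrightarrow> 0 \<le> P s t" and P1: "\<And>s. s \<in> I
      \<Longrightarrow> (\<Sum>t\<in>I. P s t) = 1"
    and irr: "\<And>s t. s \<in> I \<Longrightarrow> t \<in> I \<Longrightarrow> (s, t) \<in> {(a, b). a \<in> I \<and> b \<in> I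
        \<and> 0 < P a b}\<^sup>*"
    and inv: "\<And>t. t \<in> I \<Longrightarrow> (\<Sum>s\<in>I. \<pi> s * P s t) = \<pi> t" and pi1: "(\<Sum>s\<in>I. \<pi> s) = 1"
    and neg: "(\<Sum>s\<in>I. \<pi> s * D s) < 0"
  obtains g where "\<And>s. s \<in> I \<Longrightarrow> D s + (\<Sum>t\<in>I. P s t * g t) < g s"
proof -
  define Dn where "Dn n = ((\<lambda>f s. \<Sum>t\<in>I. P s t * f t) ^^ n) D" for n
  have Dn0: "Dn 0 = D" and DnS: "Dn (Suc n) s = (\<Sum>t\<in>I. P s t * Dn n t)" for n s by (simp_all add: Dn_def)
  define K where "K = Max (insert 0 ((\<lambda>s. \<bar>D s\<bar>) ` I))"
  have K0: "0 \<le> K" unfolding K_def using fin by (intro Max_ge) auto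
  have DK: "\<bar>Dn n s\<bar> \<le> K" if "s \<in> I" for n s
    using that
  proof (induction n arbitrary: s)
    case 0
    then show ?case unfolding Dn0 K_def using fin by (intro Max_ge) auto
  next
    case (Suc n)
    have "\<bar>Dn (Suc n) s\<bar> \<le> (\<Sum>t\<in>I. \<bar>P s t * Dn n t\<bar>)" unfolding DnS by (rule sum_abs)
    also have "\<dots> \<le> (\<Sum>t\<in>I. P s t * K)"
      using Suc P0[OF Suc.prems] by (intro sum_mono) (auto simp: abs_mult intro: mult_left_mono)
    finally show ?case using P1[OF Suc.prems] by (simp add: sum_distrib_right[symmetric])
  qed
  \<comment> \<open>Partial sums of \<open>D + P D + P P D + ...\<close>, formally a solution of
    \<open>g - P g = D\<close>. They need not converge, but their growth rates \<open>A n\<close>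
    have a limit along a subsequence.\<close>
  define B where "B n s = (\<Sum>j<n. Dn j s)" for n s
  have PB: "(\<Sum>t\<in>I. P s t * B n t) = B (Suc n) s - D s" for n s
  proof -
    have "(\<Sum>t\<in>I. P s t * B n t) = (\<Sum>j<n. Dn (Suc j) s)"
      unfolding B_def DnS sum_distrib_left by (rule sum.swap)
    also have "\<dots> = B (Suc n) s - Dn 0 s" unfolding B_def by (subst sum.lessThan_Suc_shift) simp
    finally show ?thesis by (simp add: Dn0)
  qed
  define A where "A n s = B (Suc n) s / real (Suc n)" for n s
  have BK: "\<bar>B n s\<bar> \<le> real n * K" if "s \<in> I" for n s
  proof -
    have "\<bar>B n s\<bar> \<le> (\<Sum>j<n. \<bar>Dn j s\<bar>)" unfolding B_def by (rule sum_abs)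
    also have "\<dots> \<le> (\<Sum>j<n. K)" by (intro sum_mono DK that)
    finally show ?thesis by simp
  qed
  have AK: "\<bar>A n s\<bar> \<le> K" if "s \<in> I" for n s
  proof -
    have "\<bar>A n s\<bar> = \<bar>B (Suc n) s\<bar> / real (Suc n)" by (simp only: A_def abs_divide abs_of_nat)
    also have "\<dots> \<le> K"
      by (rule iffD2[OF pos_divide_le_eq])
        (use BK[OF that, of "Suc n"] in \<open>simp_all only: mult.commute of_nat_0_less_iff zero_less_Suc\<close>)
    finally show ?thesis .
  qed
  obtain r L where r: "strict_mono (r :: nat \<Rightarrow> nat)" "\<And>s. s \<in> I \<Longrightarrow> (\<lambda>n. A (r n) s)
      \<longlonglongrightarrow> L s"
    using bounded_finite_convergent_subsequence[of I A K, OF fin AK] by blast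
  \<comment> \<open>\<open>P A - A\<close> is a boundary term of order \<open>1 / n\<close>, so the
    limit of the Cesaro means is harmonic, hence constant. Invariance of \<open>\<pi>\<close> keeps
    its mean equal to that of \<open>D\<close>, which makes the constant negative.\<close>
  have harm: "(\<Sum>t\<in>I. P s t * L t) = L s" if s: "s \<in> I" for s
  proof -
    have "(\<lambda>n. (\<Sum>t\<in>I. P s t * A (r n) t) - A (r n) s) \<longlonglongrightarrow> (\<Sum>t\<in>I. P s t * L t) - L s"
      by (intro tendsto_diff tendsto_sum tendsto_mult_left r s)
    moreover have "(\<lambda>n. (\<Sum>t\<in>I. P s t * A (r n) t) - A (r n) s) \<longlonglongrightarrow> 0"
    proof (rule Lim_null_comparison)
      have "norm ((\<Sum>t\<in>I. P s t * A n t) - A n s) \<le> 2 * K * inverse (real (Suc n))" for n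
      proof -
        have "(\<Sum>t\<in>I. P s t * A n t) - A n s = (Dn (Suc n) s - D s) / real (Suc n)"
        proof -
          have "(\<Sum>t\<in>I. P s t * A n t) = (B (Suc (Suc n)) s - D s) / real (Suc n)"
            unfolding PB[symmetric] A_def by (simp add: sum_divide_distrib)
          moreover have "B (Suc (Suc n)) s = B (Suc n) s + Dn (Suc n) s" by (simp add: B_def)
          ultimately show ?thesis by (simp add: A_def diff_divide_distrib add_divide_distrib)
        qed
        moreover have "\<bar>Dn (Suc n) s - D s\<bar> \<le> 2 * K" using DK[OF s, of "Suc n"] DK[OF s, of 0] Dn0 by simp
        ultimately have "norm ((\<Sum>t\<in>I. P s t * A n t) - A n s) = \<bar>Dn (Suc n) s - D s\<bar> / real (Suc n)"
          and d: "\<bar>Dn (Suc n) s - D s\<bar> \<le> 2 * K" by (simp_all only: real_norm_def abs_divide abs_of_nat)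
        then show ?thesis unfolding divide_inverse using mult_right_mono[OF d, of "inverse (real (Suc n))"] by simp
      qed
      then show "\<forall>\<^sub>F n in sequentially. norm ((\<Sum>t\<in>I. P s t * A (r n) t) - A (r n) s) \<le> 2 * K * inverse (real (Suc (r n)))"
        by simp
      have "(\<lambda>n. 2 * K * inverse (real (Suc n))) \<longlonglongrightarrow> 2 * K * 0"
        by (intro tendsto_mult_left LIMSEQ_inverse_real_of_nat)
      from LIMSEQ_subseq_LIMSEQ[OF this r(1)] show "(\<lambda>n. 2 * K * inverse (real (Suc (r n)))) \<longlonglongrightarrow> 0"
        by (simp add: comp_def)
    qed
    ultimately have "(\<Sum>t\<in>I. P s t * L t) - L s = 0" by (rule LIMSEQ_unique)
    then show ?thesis by simp
  qed
  have piD: "(\<Sum>s\<in>I. \<pi> s * Dn n s) = (\<Sum>s\<in>I. \<pi> s * D s)" for n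
  proof (induction n)
    case (Suc n)
    have "(\<Sum>s\<in>I. \<pi> s * Dn (Suc n) s) = (\<Sum>t\<in>I. (\<Sum>s\<in>I. \<pi> s * P s t) * Dn n t)"
      unfolding DnS sum_distrib_left sum_distrib_right mult.assoc[symmetric] by (rule sum.swap)
    then show ?case using inv Suc by simp
  qed (simp add: Dn0)
  have piA: "(\<Sum>s\<in>I. \<pi> s * A n s) = (\<Sum>s\<in>I. \<pi> s * D s)" for n
  proof -
    have "(\<Sum>s\<in>I. \<pi> s * B (Suc n) s) = (\<Sum>j<Suc n. \<Sum>s\<in>I. \<pi> s * Dn j s)"
      unfolding B_def sum_distrib_left by (rule sum.swap)
    also have "\<dots> = real (Suc n) * (\<Sum>s\<in>I. \<pi> s * D s)" unfolding piD by simp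
    finally show ?thesis unfolding A_def by (simp add: sum_divide_distrib[symmetric] field_simps)
  qed
  have "(\<lambda>n. \<Sum>s\<in>I. \<pi> s * A (r n) s) \<longlonglongrightarrow> (\<Sum>s\<in>I. \<pi> s * L s)"
    by (intro tendsto_sum tendsto_mult_left r)
  then have piL: "(\<Sum>s\<in>I. \<pi> s * L s) = (\<Sum>s\<in>I. \<pi> s * D s)" unfolding piA by (simp add: LIMSEQ_const_iff)
  have Lneg: "L s < 0" if s: "s \<in> I" for s
  proof -
    have "(\<Sum>t\<in>I. \<pi> t * L t) = (\<Sum>t\<in>I. \<pi> t * L s)"
      by (rule sum.cong) (use harmonic_constant[OF fin P0 P1 irr harm _ s] in auto)
    then show ?thesis using piL neg pi1 by (simp add: sum_distrib_right[symmetric])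
  qed
  have "\<forall>\<^sub>F n in sequentially. \<forall>s\<in>I. A (r n) s < 0"
    using fin by (subst eventually_ball_finite_distrib) (auto intro: order_tendstoD(2)[OF r(2) Lneg])
  then obtain n where n: "\<And>s. s \<in> I \<Longrightarrow> A (r n) s < 0" by (auto simp: eventually_sequentially)
  define N where "N = Suc (r n)"
  \<comment> \<open>Averaging \<open>P (B m) = B (Suc m) - D\<close> over \<open>m < N\<close>
    telescopes to \<open>D + P g = g + B N / N\<close>, and \<open>B N / N\<close> is the Cesaro
    mean \<open>A (r n)\<close>, which is negative at every state by the choice of
    \<open>n\<close>.\<close>
  define g where "g s = (\<Sum>m<N. B m s) / real N" for s
  show ?thesis
  proof
    fix s assume s: "s \<in> I"
    have "(\<Sum>t\<in>I. P s t * g t) = (\<Sum>m<N. \<Sum>t\<in>I. P s t * B m t) / real N"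
      unfolding g_def by (subst sum.swap) (simp add: sum_divide_distrib sum_distrib_left)
    also have "\<dots> = ((\<Sum>m<N. B (Suc m) s) - real N * D s) / real N" unfolding PB by (simp add: sum_subtractf)
    also have "(\<Sum>m<N. B (Suc m) s) = (\<Sum>m<N. B m s) + B N s"
      by (simp add: B_def sum.distrib)
    finally have e: "(\<Sum>t\<in>I. P s t * g t) = ((\<Sum>m<N. B m s) + B N s - real N * D s) / real N" .
    have "real N \<noteq> 0" by (simp add: N_def)
    then have "D s + (\<Sum>t\<in>I. P s t * g t) = g s + B N s / real N"
      unfolding e g_def[of s] by (simp add: add_divide_distrib diff_divide_distrib)
    then show "D s + (\<Sum>t\<in>I. P s t * g t) < g s" using n[OF s] by (simp add: A_def N_def)
  qed
qed

context amalgam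
begin

abbreviation gmult :: "'a amalg \<Rightarrow> 'a amalg \<Rightarrow> 'a amalg" (infixl "\<diamond>" 70) where
  "x \<diamond> y \<equiv> x \<otimes>\<^bsub>G\<^esub> y"

section \<open>Normal forms in the amalgam\<close>

text \<open>
  The normal form theorem is proved by letting words act from the right on pairs of a reduced word of
  representatives and an element of \<open>H\<close>: right multiplication only affects the last letter.  The map
  \<open>enc i\<close> absorbs that letter into the factor \<open>i\<close> if possible, and \<open>dec i\<close> undoes this.
\<close>

definition reduced :: "(nat \<times> 'a) list \<Rightarrow> bool" where
  "reduced xs \<longleftrightarrow> set xs \<subseteq> (SIGMA i:{1..r}. T i - {\<one>\<^bsub>\<Gamma> i\<^esub>}) \<and>
      successively (\<lambda>a b. fst a \<noteq> fst b) xs"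

definition NF :: "((nat \<times> 'a) list \<times> 'h) set" where
  "NF = {xs. reduced xs} \<times> carrier H"

definition NFE :: "nat \<Rightarrow> ((nat \<times> 'a) list \<times> 'a) set" where
  "NFE i = {xs. reduced xs \<and> (xs \<noteq> [] \<longrightarrow> fst (last xs) \<noteq> i)} \<times> carrier (\<Gamma> i)"

definition rep :: "nat \<Rightarrow> 'a \<Rightarrow> 'a" where
  "rep i a = (THE x. x \<in> T i \<and> x \<in> a <#\<^bsub>\<Gamma> i\<^esub> Hs i)"

definition res :: "nat \<Rightarrow> 'a \<Rightarrow> 'h" where
  "res i a = the_inv_into (carrier H) (\<phi> i) (inv\<^bsub>\<Gamma> i\<^esub> (rep i a) \<otimes>\<^bsub>\<Gamma> i\<^esub> a)"

definition dec :: "nat \<Rightarrow> (nat \<times> 'a) list \<times> 'a \<Rightarrow> (nat \<times> 'a) list \<times> 'h" where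
  "dec i q = (if rep i (snd q) = \<one>\<^bsub>\<Gamma> i\<^esub> then fst q else fst q @ [(i, rep i (snd q))], res i (snd q))"

definition enc :: "nat \<Rightarrow> (nat \<times> 'a) list \<times> 'h \<Rightarrow> (nat \<times> 'a) list \<times> 'a" where
  "enc i q = (if fst q \<noteq> [] \<and> fst (last (fst q)) = i
     then (butlast (fst q), snd (last (fst q)) \<otimes>\<^bsub>\<Gamma> i\<^esub> \<phi> i (snd q))
     else (fst q, \<phi> i (snd q)))"

definition act :: "nat \<times> 'a \<Rightarrow> (nat \<times> 'a) list \<times> 'h \<Rightarrow> (nat \<times> 'a) list \<times> 'h" where
  "act l q = dec (fst l) (fst (enc (fst l) q), snd (enc (fst l) q) \<otimes>\<^bsub>\<Gamma> (fst l)\<^esub> snd l)"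

lemma \<phi>_Hs: "i \<in> {1..r} \<Longrightarrow> h \<in> carrier H \<Longrightarrow> \<phi> i h \<in> Hs i"
  using iso_H[of i] by (auto simp: iso_def hom_def)

lemma Hs_carrier: "i \<in> {1..r} \<Longrightarrow> a \<in> Hs i \<Longrightarrow> a \<in> carrier (\<Gamma> i)"
  using subgroup.subset[OF subgroup_factor] by blast

lemma \<phi>_carrier: "i \<in> {1..r} \<Longrightarrow> h \<in> carrier H \<Longrightarrow> \<phi> i h \<in> carrier (\<Gamma> i)"
  using \<phi>_Hs Hs_carrier by blast

lemma \<phi>_mult: "i \<in> {1..r} \<Longrightarrow> h \<in> carrier H \<Longrightarrow> k \<in> carrier H \<Longrightarrow>
  \<phi> i (h \<otimes>\<^bsub>H\<^esub> k) = \<phi> i h \<otimes>\<^bsub>\<Gamma> i\<^esub> \<phi> i k"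
  using iso_H[of i] by (auto simp: iso_def hom_def)

lemma \<phi>_bij: "i \<in> {1..r} \<Longrightarrow> bij_betw (\<phi> i) (carrier H) (Hs i)"
  using iso_H[of i] by (auto simp: iso_def)

lemma \<phi>_one:
  assumes "i \<in> {1..r}"
  shows "\<phi> i \<one>\<^bsub>H\<^esub> = \<one>\<^bsub>\<Gamma> i\<^esub>"
proof -
  interpret g: group "\<Gamma> i" using group_factor assms .
  interpret h: group H by (rule group_H)
  have "\<phi> i \<one>\<^bsub>H\<^esub> \<otimes>\<^bsub>\<Gamma> i\<^esub> \<phi> i \<one>\<^bsub>H\<^esub> = \<phi> i \<one>\<^bsub>H\<^esub>"
    using \<phi>_mult[OF assms, of "\<one>\<^bsub>H\<^esub>" "\<one>\<^bsub>H\<^esub>"] by simp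
  then show ?thesis using \<phi>_carrier[OF assms, of "\<one>\<^bsub>H\<^esub>"] by simp
qed

lemma T_carrier: "i \<in> {1..r} \<Longrightarrow> t \<in> T i \<Longrightarrow> t \<in> carrier (\<Gamma> i)"
  using reps_carrier by blast

lemma rep_ex:
  assumes "i \<in> {1..r}" "a \<in> carrier (\<Gamma> i)"
  shows "rep i a \<in> T i" "rep i a \<in> a <#\<^bsub>\<Gamma> i\<^esub> Hs i"
  using theI'[OF reps_coset[OF assms]] unfolding rep_def by auto

lemma res_props:
  assumes i: "i \<in> {1..r}" and a: "a \<in> carrier (\<Gamma> i)"
  shows "res i a \<in> carrier H" "rep i a \<otimes>\<^bsub>\<Gamma> i\<^esub> \<phi> i (res i a) = a"
proof -
  interpret g: group "\<Gamma> i" using group_factor i .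
  interpret s: subgroup "Hs i" "\<Gamma> i" using subgroup_factor i .
  have t: "rep i a \<in> carrier (\<Gamma> i)" using rep_ex[OF i a] T_carrier i by blast
  obtain k where k: "k \<in> Hs i" "rep i a = a \<otimes>\<^bsub>\<Gamma> i\<^esub> k"
    using rep_ex(2)[OF i a] by (auto simp: l_coset_def)
  have kc: "k \<in> carrier (\<Gamma> i)" using k by simp
  have "inv\<^bsub>\<Gamma> i\<^esub> (rep i a) \<otimes>\<^bsub>\<Gamma> i\<^esub> a = inv\<^bsub>\<Gamma> i\<^esub> k"
    unfolding k(2) using a kc by (simp add: g.inv_mult_group g.m_assoc)
  then have in_H: "inv\<^bsub>\<Gamma> i\<^esub> (rep i a) \<otimes>\<^bsub>\<Gamma> i\<^esub> a \<in> Hs i" using k by simp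
  have inj: "inj_on (\<phi> i) (carrier H)" and im: "\<phi> i ` carrier H = Hs i"
    using \<phi>_bij[OF i] by (auto simp: bij_betw_def)
  show "res i a \<in> carrier H"
    unfolding res_def by (rule the_inv_into_into[OF inj]) (use in_H im in auto)
  have "\<phi> i (res i a) = inv\<^bsub>\<Gamma> i\<^esub> (rep i a) \<otimes>\<^bsub>\<Gamma> i\<^esub> a"
    unfolding res_def by (rule f_the_inv_into_f[OF inj]) (use in_H im in auto)
  then show "rep i a \<otimes>\<^bsub>\<Gamma> i\<^esub> \<phi> i (res i a) = a"
    using a t by (simp add: g.m_assoc[symmetric])
qed

lemma rep_res_eq:
  assumes i: "i \<in> {1..r}" and t: "t \<in> T i" and h: "h \<in> carrier H"
  shows "rep i (t \<otimes>\<^bsub>\<Gamma> i\<^esub> \<phi> i h) = t" "res i (t \<otimes>\<^bsub>\<Gamma> i\<^esub> \<phi> i h) = h"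
proof -
  interpret g: group "\<Gamma> i" using group_factor i .
  interpret s: subgroup "Hs i" "\<Gamma> i" using subgroup_factor i .
  have tc: "t \<in> carrier (\<Gamma> i)" and hc: "\<phi> i h \<in> carrier (\<Gamma> i)"
    using T_carrier \<phi>_carrier assms by auto
  have ac: "t \<otimes>\<^bsub>\<Gamma> i\<^esub> \<phi> i h \<in> carrier (\<Gamma> i)" using tc hc by simp
  have "t = t \<otimes>\<^bsub>\<Gamma> i\<^esub> \<phi> i h \<otimes>\<^bsub>\<Gamma> i\<^esub> inv\<^bsub>\<Gamma> i\<^esub>
      (\<phi> i h)" using tc hc by (simp add: g.m_assoc)
  moreover have "inv\<^bsub>\<Gamma> i\<^esub> (\<phi> i h) \<in> Hs i" using \<phi>_Hs[OF i h] by simp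
  ultimately have "t \<in> (t \<otimes>\<^bsub>\<Gamma> i\<^esub> \<phi> i h) <#\<^bsub>\<Gamma> i\<^esub> Hs i" unfolding l_coset_def by blast
  then show rep: "rep i (t \<otimes>\<^bsub>\<Gamma> i\<^esub> \<phi> i h) = t"
    using reps_coset[OF i ac] rep_ex[OF i ac] t by blast
  let ?k = "res i (t \<otimes>\<^bsub>\<Gamma> i\<^esub> \<phi> i h)"
  have "t \<otimes>\<^bsub>\<Gamma> i\<^esub> \<phi> i ?k = t \<otimes>\<^bsub>\<Gamma> i\<^esub> \<phi> i h" and k: "?k \<in> carrier H"
    using res_props[OF i ac] rep by auto
  then have "\<phi> i ?k = \<phi> i h" using tc hc \<phi>_carrier[OF i k] by (simp add: g.Units_eq)
  then show "?k = h" using \<phi>_bij[OF i] h k by (auto simp: bij_betw_def inj_on_def)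
qed

lemma rep_res_\<phi>:
  assumes "i \<in> {1..r}" "h \<in> carrier H"
  shows "rep i (\<phi> i h) = \<one>\<^bsub>\<Gamma> i\<^esub>" "res i (\<phi> i h) = h"
proof -
  interpret g: group "\<Gamma> i" using group_factor assms by blast
  show "rep i (\<phi> i h) = \<one>\<^bsub>\<Gamma> i\<^esub>" "res i (\<phi> i h) = h"
    using rep_res_eq[OF assms(1) reps_one[OF assms(1)] assms(2)] \<phi>_carrier[OF assms] by simp_all
qed

lemma reduced_append_single:
  "reduced (xs @ [(i, t)]) \<longleftrightarrow>
    reduced xs \<and> i \<in> {1..r} \<and> t \<in> T i \<and> t \<noteq> \<one>\<^bsub>\<Gamma> i\<^esub> \<and> (xs \<noteq> []
        \<longrightarrow> fst (last xs) \<noteq> i)"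
  by (auto simp: reduced_def successively_append_iff)

lemma dec_NF:
  assumes "i \<in> {1..r}" "q \<in> NFE i"
  shows "dec i q \<in> NF"
  using assms rep_ex[of i "snd q"] res_props[of i "snd q"]
  by (auto simp: dec_def NF_def NFE_def reduced_append_single)

lemma enc_NFE:
  assumes "i \<in> {1..r}" "q \<in> NF"
  shows "enc i q \<in> NFE i"
proof (cases "fst q \<noteq> [] \<and> fst (last (fst q)) = i")
  case True
  interpret g: group "\<Gamma> i" using group_factor assms by blast
  obtain xs t where xs: "fst q = xs @ [(i, t)]" using True by (metis append_butlast_last_id prod.collapse)
  then show ?thesis using assms \<phi>_carrier[OF assms(1)] T_carrier[OF assms(1)]
    by (auto simp: enc_def NF_def NFE_def reduced_append_single)
next
  case False
  then show ?thesis using assms \<phi>_carrier[OF assms(1)]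
    by (auto simp: enc_def NF_def NFE_def)
qed

text \<open>With \<open>enc_dec\<close> this makes \<open>enc i\<close> a bijection from
  \<open>NF\<close> onto \<open>NFE i\<close>. Both rest on the unique factorisation of an element
  of the factor into a representative and an element of \<open>H\<close>.\<close>

lemma dec_enc:
  assumes "i \<in> {1..r}" "q \<in> NF"
  shows "dec i (enc i q) = q"
proof (cases "fst q \<noteq> [] \<and> fst (last (fst q)) = i")
  case True
  obtain xs t where xs: "fst q = xs @ [(i, t)]" using True by (metis append_butlast_last_id prod.collapse)
  then have "t \<in> T i" "t \<noteq> \<one>\<^bsub>\<Gamma> i\<^esub>" "snd q \<in> carrier H"
    using assms by (auto simp: NF_def reduced_append_single)
  then show ?thesis using xs rep_res_eq[OF assms(1)] by (auto simp: dec_def enc_def prod_eq_iff)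
next
  case False
  have "snd q \<in> carrier H" using assms by (auto simp: NF_def)
  then show ?thesis using False rep_res_\<phi>[OF assms(1)] by (auto simp: dec_def enc_def prod_eq_iff)
qed

lemma enc_dec:
  assumes "i \<in> {1..r}" "q \<in> NFE i"
  shows "enc i (dec i q) = q"
proof -
  interpret g: group "\<Gamma> i" using group_factor assms by blast
  have "snd q \<in> carrier (\<Gamma> i)" using assms by (auto simp: NFE_def)
  note * = res_props[OF assms(1) this] \<phi>_carrier[OF assms(1) res_props(1)[OF assms(1) this]]
  show ?thesis using * assms by (auto simp: enc_def dec_def NFE_def prod_eq_iff)
qed

lemma act_NF:
  assumes "l \<in> letters" "q \<in> NF"
  shows "act l q \<in> NF"
proof -
  have i: "fst l \<in> {1..r}" and a: "snd l \<in> carrier (\<Gamma> (fst l))" using assms by (auto simp: letters_def)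
  interpret g: group "\<Gamma> (fst l)" using group_factor i .
  show ?thesis unfolding act_def
    by (rule dec_NF[OF i]) (use enc_NFE[OF i assms(2)] a in \<open>auto simp: NFE_def\<close>)
qed

text \<open>Between two letters of the same factor \<open>enc i\<close> cancels the preceding
  \<open>dec i\<close>, so both letters multiply the same factor coordinate.\<close>

lemma act_mult:
  assumes i: "i \<in> {1..r}" and a: "a \<in> carrier (\<Gamma> i)" and b: "b \<in> carrier (\<Gamma> i)" and q: "q \<in> NF"
  shows "act (i, b) (act (i, a) q) = act (i, a \<otimes>\<^bsub>\<Gamma> i\<^esub> b) q"
proof -
  interpret g: group "\<Gamma> i" using group_factor i .
  have e: "enc i q \<in> NFE i" by (rule enc_NFE[OF i q])
  then have e2: "(fst (enc i q), snd (enc i q) \<otimes>\<^bsub>\<Gamma> i\<^esub> a) \<in> NFE i" using a by (auto simp: NFE_def)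
  have "snd (enc i q) \<in> carrier (\<Gamma> i)" using e by (auto simp: NFE_def)
  then show ?thesis using a b enc_dec[OF i e2] by (simp add: act_def g.m_assoc)
qed

text \<open>The right side does not mention \<open>i\<close>: this is the amalgamation relation for
  the action. For the identity of \<open>H\<close> it also yields the relation that deletes identity
  letters.\<close>

lemma act_\<phi>:
  assumes i: "i \<in> {1..r}" and h: "h \<in> carrier H" and q: "q \<in> NF"
  shows "act (i, \<phi> i h) q = (fst q, snd q \<otimes>\<^bsub>H\<^esub> h)"
proof -
  interpret g: group "\<Gamma> i" using group_factor i .
  interpret Hpart: group H by (rule group_H)
  have k: "snd q \<in> carrier H" using q by (auto simp: NF_def)
  have m: "(fst q, snd q \<otimes>\<^bsub>H\<^esub> h) \<in> NF" using q h by (auto simp: NF_def)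
  have "last (fst q) \<in> set (fst q)" if "fst q \<noteq> []" using that by simp
  then have "fst q \<noteq> [] \<Longrightarrow> last (fst q) \<in> (SIGMA i:{1..r}. T i - {\<one>\<^bsub>\<Gamma> i\<^esub>})"
    using q by (auto simp: NF_def reduced_def)
  then have "fst q \<noteq> [] \<Longrightarrow> fst (last (fst q)) = i \<Longrightarrow> snd (last (fst q)) \<in> carrier (\<Gamma> i)"
    using T_carrier[OF i] by auto
  then have "(fst (enc i q), snd (enc i q) \<otimes>\<^bsub>\<Gamma> i\<^esub> \<phi> i h) = enc i (fst q, snd q \<otimes>\<^bsub>H\<^esub> h)"
    using k h \<phi>_mult[OF i k h] \<phi>_carrier[OF i] by (auto simp: enc_def g.m_assoc)
  then show ?thesis using dec_enc[OF i m] by (simp add: act_def)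
qed

abbreviation acts :: "(nat \<times> 'a) list \<Rightarrow> (nat \<times> 'a) list \<times> 'h \<Rightarrow> (nat \<times> 'a) list \<times> 'h" where
  "acts \<equiv> fold act"

lemma acts_NF: "u \<in> lists letters \<Longrightarrow> q \<in> NF \<Longrightarrow> acts u q \<in> NF"
proof (induction u arbitrary: q)
  case (Cons x u)
  then show ?case using act_NF[of x q] by simp
qed simp

text \<open>The action respects every defining relation and so descends to classes of words; this is
  what keeps distinct normal forms apart.\<close>

lemma eqv_acts: "eqv u v \<Longrightarrow> q \<in> NF \<Longrightarrow> acts u q = acts v q"
proof (induction arbitrary: q rule: eqv.induct)
  case (mult u v i a b)
  then show ?case using act_mult[of i a b "acts u q"] acts_NF by simp
next
  case (one u v i)
  have "act (i, \<one>\<^bsub>\<Gamma> i\<^esub>) (acts u q) = acts u q"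
    using act_\<phi>[OF one(3), of "\<one>\<^bsub>H\<^esub>" "acts u q"] acts_NF[OF one(1) one(4)] \<phi>_one[OF one(3)] group_H
    by (auto simp: NF_def prod_eq_iff group.is_monoid)
  then show ?case by simp
next
  case (amalg u v i j h)
  then show ?case using act_\<phi> acts_NF[OF amalg(1)] by simp
qed auto

section \<open>Existence and uniqueness of normal forms\<close>

definition wd :: "(nat \<times> 'a) list \<times> 'h \<Rightarrow> (nat \<times> 'a) list" where
  "wd q = fst q @ [(1, \<phi> 1 (snd q))]"

definition base :: "(nat \<times> 'a) list \<times> 'h" where
  "base = ([], \<one>\<^bsub>H\<^esub>)"

lemma base_NF: "base \<in> NF"
  using group.is_monoid[OF group_H] by (auto simp: base_def NF_def reduced_def monoid.one_closed)

lemma one_idx: "1 \<in> {1..r}"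
  using r_ge_2 by simp

lemma reduced_letters: "reduced xs \<Longrightarrow> xs \<in> lists letters"
  using T_carrier by (fastforce simp: reduced_def letters_def)

lemma wd_letters:
  assumes "q \<in> NF"
  shows "wd q \<in> lists letters"
proof -
  have "fst q \<in> lists letters" "snd q \<in> carrier H" using assms reduced_letters[of "fst q"] by (auto simp: NF_def)
  then show ?thesis using \<phi>_carrier[OF one_idx] one_idx by (auto simp: wd_def letters_def)
qed

lemma acts_reduced: "reduced xs \<Longrightarrow> acts xs base = (xs, \<one>\<^bsub>H\<^esub>)"
proof (induction xs rule: rev_induct)
  case Nil
  then show ?case by (simp add: base_def)
next
  case (snoc x xs)
  obtain i t where x: "x = (i, t)" by (cases x)
  have i: "reduced xs" "i \<in> {1..r}" "t \<in> T i" "t \<noteq> \<one>\<^bsub>\<Gamma> i\<^esub>" "xs \<noteq> []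
      \<Longrightarrow> fst (last xs) \<noteq> i"
    using snoc.prems by (auto simp: x reduced_append_single)
  interpret g: group "\<Gamma> i" using group_factor i by blast
  have one: "\<one>\<^bsub>H\<^esub> \<in> carrier H" using group_H by (simp add: group.is_monoid monoid.one_closed)
  have "rep i t = t" "res i t = \<one>\<^bsub>H\<^esub>"
    using rep_res_eq[OF i(2,3) one] \<phi>_one[OF i(2)] T_carrier[OF i(2,3)] by simp_all
  then show ?case using snoc.IH[OF i(1)] i \<phi>_one[OF i(2)] T_carrier[OF i(2,3)]
    by (auto simp: x act_def enc_def dec_def)
qed

lemma acts_wd: "q \<in> NF \<Longrightarrow> acts (wd q) base = q"
proof -
  assume q: "q \<in> NF"
  interpret Hpart: group H by (rule group_H)
  have *: "(fst q, \<one>\<^bsub>H\<^esub>) \<in> NF" using q by (auto simp: NF_def)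
  show ?thesis using q acts_reduced act_\<phi>[OF one_idx _ *, of "snd q"]
    by (auto simp: wd_def NF_def)
qed

lemma eqv_wd_enc:
  assumes i: "i \<in> {1..r}" and q: "q \<in> NF"
  shows "eqv (wd q) (fst (enc i q) @ [(i, snd (enc i q))])"
proof -
  have f: "fst q \<in> lists letters" and h: "snd q \<in> carrier H" using q reduced_letters[of "fst q"] by (auto simp: NF_def)
  have 1: "eqv (wd q) (fst q @ [(i, \<phi> i (snd q))])"
    using eqv.amalg[OF f _ one_idx i h, of "[]"] by (simp add: wd_def)
  show ?thesis
  proof (cases "fst q \<noteq> [] \<and> fst (last (fst q)) = i")
    case True
    obtain xs t where xs: "fst q = xs @ [(i, t)]" using True by (metis append_butlast_last_id prod.collapse)
    have t: "t \<in> carrier (\<Gamma> i)" "xs \<in> lists letters" using f xs by (auto simp: letters_def)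
    have "eqv (xs @ [(i, t), (i, \<phi> i (snd q))]) (xs @ [(i, t \<otimes>\<^bsub>\<Gamma> i\<^esub> \<phi> i (snd q))])"
      using eqv.mult[OF t(2) _ i t(1) \<phi>_carrier[OF i h], of "[]"] by simp
    then show ?thesis using 1 eqv.trans by (auto simp: enc_def xs)
  next
    case False
    then show ?thesis using 1 by (auto simp: enc_def)
  qed
qed

lemma eqv_wd_act:
  assumes l: "l \<in> letters" and q: "q \<in> NF"
  shows "eqv (wd q @ [l]) (wd (act l q))"
proof -
  obtain i g where ig: "l = (i, g)" "i \<in> {1..r}" "g \<in> carrier (\<Gamma> i)" using l by (auto simp: letters_def)
  interpret g: group "\<Gamma> i" using group_factor ig by blast
  let ?xs = "fst (enc i q)" and ?a = "snd (enc i q)"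
  have xs: "?xs \<in> lists letters" and a: "?a \<in> carrier (\<Gamma> i)"
    using enc_NFE[OF ig(2) q] reduced_letters[of ?xs] by (auto simp: NFE_def)
  have "eqv (wd q @ [l]) (?xs @ [(i, ?a)] @ [l])"
    using eqv_append[OF eqv_wd_enc[OF ig(2) q], of "[]" "[l]"] l by simp
  moreover have "eqv (?xs @ [(i, ?a)] @ [l]) (?xs @ [(i, ?a \<otimes>\<^bsub>\<Gamma> i\<^esub> g)])"
    using eqv.mult[OF xs _ ig(2) a ig(3), of "[]"] ig by simp
  ultimately have "eqv (wd q @ [l]) (?xs @ [(i, ?a \<otimes>\<^bsub>\<Gamma> i\<^esub> g)])" by (rule eqv.trans)
  moreover have "act l q \<in> NF" by (rule act_NF[OF l q])
  moreover have "(?xs, ?a \<otimes>\<^bsub>\<Gamma> i\<^esub> g) = enc i (act l q)"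
    using enc_dec[OF ig(2), of "(?xs, ?a \<otimes>\<^bsub>\<Gamma> i\<^esub> g)"] enc_NFE[OF ig(2) q] a ig(3)
    by (auto simp: act_def ig(1) NFE_def)
  ultimately show ?thesis using eqv_wd_enc[OF ig(2), of "act l q"]
    by (metis eqv.sym eqv.trans fst_conv snd_conv)
qed

text \<open>Existence of normal forms: reading \<open>u\<close> from the left, each further letter
  moves the normal form by one action step, and \<open>eqv_wd_act\<close> realises that step by
  relations of the group.\<close>

lemma eqv_wd: "u \<in> lists letters \<Longrightarrow> eqv u (wd (acts u base))"
proof (induction u rule: rev_induct)
  case Nil
  have "eqv ([] @ [(1, \<one>\<^bsub>\<Gamma> 1\<^esub>)] @ []) ([] @ [])" by (rule eqv.one) (use one_idx in auto)
  then show ?case using \<phi>_one[OF one_idx] by (auto simp: base_def wd_def intro: eqv.sym)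
next
  case (snoc x xs)
  then have "eqv (xs @ [x]) (wd (acts xs base) @ [x])"
    using eqv_append[of xs "wd (acts xs base)" "[]" "[x]"] by auto
  moreover have "eqv (wd (acts xs base) @ [x]) (wd (act x (acts xs base)))"
    using snoc.prems by (intro eqv_wd_act acts_NF base_NF) auto
  ultimately show ?case using eqv.trans by auto
qed

text \<open>The chosen word is immaterial: by \<open>eqv_acts\<close> all words of a class act alike
  on \<open>base\<close>.\<close>

definition nfc :: "'a amalg \<Rightarrow> (nat \<times> 'a) list \<times> 'h" where
  "nfc w = acts (SOME u. u \<in> w) base"

lemma nfc_cls:
  assumes "u \<in> lists letters"
  shows "nfc (cls u) = acts u base"
proof -
  have "u \<in> cls u" using assms by (simp add: cls_def eqv.refl)
  then have "(SOME v. v \<in> cls u) \<in> cls u" by (rule someI)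
  then have "eqv u (SOME v. v \<in> cls u)" by (simp add: cls_def)
  then show ?thesis unfolding nfc_def using eqv_acts[OF _ base_NF] by metis
qed

lemma G_cases:
  assumes "w \<in> carrier G"
  obtains u where "u \<in> lists letters" "w = cls u"
  using assms by (auto simp: G_def)

lemma cls_carrier: "u \<in> lists letters \<Longrightarrow> cls u \<in> carrier G"
  by (auto simp: G_def)

lemma nfc_NF: "w \<in> carrier G \<Longrightarrow> nfc w \<in> NF"
  by (metis G_cases nfc_cls acts_NF base_NF)

lemma cls_wd_nfc: "w \<in> carrier G \<Longrightarrow> cls (wd (nfc w)) = w"
  by (metis G_cases nfc_cls eqv_wd cls_eq_iff)

lemma nfc_cls_wd: "q \<in> NF \<Longrightarrow> nfc (cls (wd q)) = q"
  using nfc_cls[OF wd_letters] acts_wd by simp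

lemma nfc_inject: "v \<in> carrier G \<Longrightarrow> w \<in> carrier G \<Longrightarrow> nfc v = nfc w \<Longrightarrow> v = w"
  by (metis cls_wd_nfc)

lemma \<iota>_carrier: "i \<in> {1..r} \<Longrightarrow> a \<in> carrier (\<Gamma> i) \<Longrightarrow> \<iota> i a \<in> carrier G"
  unfolding \<iota>_def by (rule cls_carrier) (auto simp: letters_def)

lemma nfc_mult_\<iota>:
  assumes "w \<in> carrier G" "i \<in> {1..r}" "a \<in> carrier (\<Gamma> i)"
  shows "nfc (w \<diamond> \<iota> i a) = act (i, a) (nfc w)"
proof -
  obtain u where u: "u \<in> lists letters" "w = cls u" using assms G_cases by blast
  have l: "[(i, a)] \<in> lists letters" using assms by (auto simp: letters_def)
  then have "w \<diamond> \<iota> i a = cls (u @ [(i, a)])" unfolding u \<iota>_def by (rule mult_cls[OF u(1)])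
  then show ?thesis using nfc_cls[of "u @ [(i,a)]"] nfc_cls[of u] u l by simp
qed

lemma nfc_one: "nfc \<one>\<^bsub>G\<^esub> = base"
  using nfc_cls[of "[]"] by (simp add: G_def)

lemma nfc_\<iota>:
  assumes "i \<in> {1..r}" "a \<in> carrier (\<Gamma> i)"
  shows "nfc (\<iota> i a) = (if rep i a = \<one>\<^bsub>\<Gamma> i\<^esub> then [] else [(i, rep i a)], res i a)"
proof -
  interpret g: group "\<Gamma> i" using group_factor assms by blast
  have "[(i, a)] \<in> lists letters" using assms by (auto simp: letters_def)
  then have "nfc (\<iota> i a) = act (i, a) base" unfolding \<iota>_def using nfc_cls by simp
  then show ?thesis using assms \<phi>_one[OF assms(1)] by (simp add: act_def enc_def base_def dec_def)
qed

definition word :: "'a amalg \<Rightarrow> (nat \<times> 'a) list" where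
  "word w = fst (nfc w)"

definition tail :: "'a amalg \<Rightarrow> 'h" where
  "tail w = snd (nfc w)"

lemma reduced_word: "w \<in> carrier G \<Longrightarrow> reduced (word w)"
  using nfc_NF[of w] by (auto simp: NF_def word_def)

lemma tail_carrier: "w \<in> carrier G \<Longrightarrow> tail w \<in> carrier H"
  using nfc_NF[of w] by (auto simp: NF_def tail_def)

lemma HH_eq: "HH = {w \<in> carrier G. word w = []}"
proof (intro equalityI subsetI)
  fix w assume "w \<in> HH"
  then obtain h where h: "h \<in> carrier H" "w = \<iota> 1 (\<phi> 1 h)" by (auto simp: HH_def)
  then show "w \<in> {w \<in> carrier G. word w = []}"
    using \<iota>_carrier[OF one_idx \<phi>_carrier[OF one_idx h(1)]] nfc_\<iota>[OF one_idx \<phi>_carrier[OF one_idx h(1)]]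
      rep_res_\<phi>[OF one_idx h(1)] by (simp add: word_def)
next
  fix w assume w: "w \<in> {w \<in> carrier G. word w = []}"
  then have "w = \<iota> 1 (\<phi> 1 (tail w))" using cls_wd_nfc[of w] by (simp add: wd_def word_def tail_def \<iota>_def)
  then show "w \<in> HH" using tail_carrier w by (auto simp: HH_def)
qed

text \<open>For the inclusion from right to left, \<open>enc i\<close> absorbs the only letter, if
  there is one, and what remains of the normal form is a single element of the factor.\<close>

lemma Fac_eq:
  assumes i: "i \<in> {1..r}"
  shows "Fac i = {w \<in> carrier G. word w = [] \<or> (\<exists>t. word w = [(i, t)])}"
proof (intro equalityI subsetI)
  fix w assume "w \<in> Fac i"
  then show "w \<in> {w \<in> carrier G. word w = [] \<or> (\<exists>t. word w = [(i, t)])}"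
    using \<iota>_carrier[OF i] nfc_\<iota>[OF i] by (auto simp: word_def Fac_def split: if_splits)
next
  fix w assume w: "w \<in> {w \<in> carrier G. word w = [] \<or> (\<exists>t. word w = [(i, t)])}"
  then have e: "eqv (wd (nfc w)) (fst (enc i (nfc w)) @ [(i, snd (enc i (nfc w)))])" and
    f: "enc i (nfc w) \<in> NFE i" using nfc_NF i eqv_wd_enc enc_NFE by auto
  consider "word w = []" | t where "word w = [(i, t)]" using w by auto
  then have "fst (enc i (nfc w)) = []" by cases (simp_all add: enc_def word_def)
  then have "cls (wd (nfc w)) = \<iota> i (snd (enc i (nfc w)))"
    using e w cls_eq_iff[OF wd_letters[OF nfc_NF[of w]]] by (simp add: \<iota>_def)
  then have "w = \<iota> i (snd (enc i (nfc w)))" using w cls_wd_nfc[of w] by simp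
  then show "w \<in> Fac i" using f by (auto simp: Fac_def NFE_def)
qed

lemma FacX_eq:
  assumes i: "i \<in> {1..r}"
  shows "FacX i = {w \<in> carrier G. \<exists>t. word w = [(i, t)]}"
  unfolding FacX_def Fac_eq[OF i] HH_eq by auto

lemma \<tau>_FacX:
  assumes "i \<in> {1..r}" "w \<in> FacX i"
  shows "\<tau> w = i"
proof -
  have "w \<notin> HH" using assms by (simp add: FacX_def)
  moreover have "(THE j. j \<in> {1..r} \<and> w \<in> FacX j) = i"
    by (rule the_equality) (use assms FacX_eq in auto)
  ultimately show ?thesis by (simp add: \<tau>_def)
qed

definition emb :: "nat \<times> 'a \<Rightarrow> 'a amalg" where
  "emb x = \<iota> (fst x) (snd x)"

definition embh :: "'h \<Rightarrow> 'a amalg" where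
  "embh h = \<iota> 1 (\<phi> 1 h)"

lemma nfc_emb:
  assumes "reduced [x]"
  shows "nfc (emb x) = ([x], \<one>\<^bsub>H\<^esub>)" "emb x \<in> carrier G"
proof -
  have l: "[x] \<in> lists letters" by (rule reduced_letters[OF assms])
  have e: "emb x = cls [x]" by (simp add: emb_def \<iota>_def)
  show "emb x \<in> carrier G" unfolding e by (rule cls_carrier[OF l])
  show "nfc (emb x) = ([x], \<one>\<^bsub>H\<^esub>)" unfolding e using nfc_cls[OF l] acts_reduced[OF assms] by simp
qed

lemma reduced_single: "reduced [x] \<longleftrightarrow> fst x \<in> {1..r} \<and> snd x \<in> T (fst x) - {\<one>\<^bsub>\<Gamma> (fst x)\<^esub>}"
  by (cases x) (auto simp: reduced_def)

lemma RR_eq: "RR = emb ` {x. reduced [x]}"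
proof (intro equalityI subsetI)
  fix w assume "w \<in> RR"
  then obtain i t where *: "i \<in> {1..r}" "t \<in> T i - {\<one>\<^bsub>\<Gamma> i\<^esub>}" "w = \<iota> i t"
    unfolding RR_def R_def by blast
  then have "w = emb (i, t)" "reduced [(i, t)]" by (simp_all add: emb_def reduced_single)
  then show "w \<in> emb ` {x. reduced [x]}" by blast
next
  fix w assume "w \<in> emb ` {x. reduced [x]}"
  then obtain x where "w = emb x" "fst x \<in> {1..r}" "snd x \<in> T (fst x) - {\<one>\<^bsub>\<Gamma> (fst x)\<^esub>}"
    by (auto simp: reduced_single)
  then show "w \<in> RR" unfolding RR_def R_def emb_def by blast
qed

lemma emb_FacX: "reduced [x] \<Longrightarrow> emb x \<in> FacX (fst x)"
  using FacX_eq nfc_emb by (auto simp: reduced_single word_def intro: exI[of _ "snd x"])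

lemma \<tau>_emb: "reduced [x] \<Longrightarrow> \<tau> (emb x) = fst x"
  using \<tau>_FacX emb_FacX by (simp add: reduced_single)

lemma foldr_emb:
  "xs \<in> lists letters \<Longrightarrow> v \<in> lists letters \<Longrightarrow>
    foldr (\<lambda>x y. x \<diamond> y) (map emb xs) (cls v) = cls (xs @ v)"
proof (induction xs)
  case (Cons x xs)
  have "emb x = cls [x]" by (simp add: emb_def \<iota>_def)
  then show ?case using Cons mult_cls[of "[x]" "xs @ v"] by auto
qed simp

lemma reduced_in_single: "reduced xs \<Longrightarrow> x \<in> set xs \<Longrightarrow> reduced [x]"
  by (auto simp: reduced_def)

lemma normal_map_emb:
  assumes "set xs \<subseteq> {x. reduced [x]}"
  shows "normal (map emb xs) (embh h) \<longleftrightarrow> reduced xs \<and> embh h \<in> HH"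
proof -
  have "\<tau> (map emb xs ! j) = fst (xs ! j)" if "j < length xs" for j
    using that \<tau>_emb[of "xs ! j"] subsetD[OF assms nth_mem[OF that]] by simp
  then show ?thesis using assms
    by (auto simp: normal_def RR_eq reduced_def successively_conv_nth)
qed

text \<open>The normal form theorem, in the shape that the definite description in \<open>nf\<close>
  requires. Existence is \<open>cls_wd_nfc\<close>; for uniqueness, any normal pair comes from a
  reduced word \<open>xs\<close> and some \<open>h\<close>, and \<open>nfc_cls_wd\<close> recovers
  both from the product.\<close>

lemma nf_eq:
  assumes w: "w \<in> carrier G"
  shows "nf w = (map emb (word w), embh (tail w))"
  unfolding nf_def
proof (rule the_equality)
  have r: "reduced (word w)" by (rule reduced_word[OF w])
  have l: "[(1, \<phi> 1 h)] \<in> lists letters" if "h \<in> carrier H" for h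
    using one_idx \<phi>_carrier[OF one_idx that] by (auto simp: letters_def)
  have s: "set (word w) \<subseteq> {x. reduced [x]}" using reduced_in_single[OF r] by blast
  have "w = foldr (\<diamond>) (map emb (word w)) (embh (tail w))"
    using foldr_emb[OF reduced_letters[OF r] l[OF tail_carrier[OF w]]] cls_wd_nfc[OF w]
    by (simp add: embh_def \<iota>_def wd_def word_def tail_def)
  moreover have "embh (tail w) \<in> HH" using tail_carrier[OF w] by (auto simp: HH_def embh_def)
  ultimately show "normal (fst (map emb (word w), embh (tail w))) (snd (map emb (word w), embh (tail w))) \<and>
    w = foldr (\<diamond>) (fst (map emb (word w), embh (tail w))) (snd (map emb (word w), embh (tail w)))"
    using normal_map_emb[OF s] r by simp
  fix q assume q: "normal (fst q) (snd q) \<and> w = foldr (\<diamond>) (fst q) (snd q)"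
  have "fst q \<in> lists (emb ` {x. reduced [x]})" using q by (auto simp: normal_def RR_eq)
  then obtain xs where xs: "fst q = map emb xs" "set xs \<subseteq> {x. reduced [x]}"
    by (auto simp: lists_image)
  obtain h where h: "snd q = embh h" "h \<in> carrier H" using q by (auto simp: normal_def HH_def embh_def)
  have rx: "reduced xs" using q normal_map_emb[OF xs(2)] by (simp add: xs h)
  then have "w = cls (wd (xs, h))" using q foldr_emb[OF reduced_letters[OF rx] l[OF h(2)]]
    by (simp add: xs h embh_def \<iota>_def wd_def)
  then have "nfc w = (xs, h)" using rx h nfc_cls_wd[of "(xs, h)"] by (auto simp: NF_def)
  then show "q = (map emb (word w), embh (tail w))" using xs h by (simp add: word_def tail_def prod_eq_iff)
qed

lemma wlen_eq: "w \<in> carrier G \<Longrightarrow> wlen w = length (word w)"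
  by (simp add: wlen_def nf_eq)

lemma lext_eq: "w \<in> carrier G \<Longrightarrow> lext l w = (\<Sum>x\<leftarrow>word w. l (emb x))"
  by (simp add: lext_def nf_eq comp_def)

lemma bracket_eq:
  "w \<in> carrier G \<Longrightarrow> word w \<noteq> [] \<Longrightarrow> bracket w = emb (last (word w)) \<diamond> embh (tail w)"
  by (simp add: bracket_def nf_eq last_map)

text \<open>
  \<open>ltype w\<close> is the type of the last letter of \<open>w\<close>, and \<open>0\<close> for \<open>w\<close> in the amalgamated subgroup.  The
  elements of \<open>reps k\<close> represent the left cosets of this subgroup at distance \<open>k\<close>.  Below \<open>v \<in> reps k\<close>,
  words are extended by elements of \<open>cone (ltype v)\<close>; \<open>cone 0\<close> consists of all words of positive length.
\<close>

definition ltype :: "'a amalg \<Rightarrow> nat" where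
  "ltype w = (if word w = [] then 0 else fst (last (word w)))"

definition cone :: "nat \<Rightarrow> 'a amalg set" where
  "cone i = {w \<in> carrier G. word w \<noteq> [] \<and> fst (hd (word w)) \<noteq> i}"

definition reps :: "nat \<Rightarrow> 'a amalg set" where
  "reps k = {v \<in> carrier G. tail v = \<one>\<^bsub>H\<^esub> \<and> length (word v) = k}"

definition gens :: "'a amalg set" where
  "gens = (\<Union>i\<in>{1..r}. Fac i)"

definition FF :: "'a amalg set" where
  "FF = (\<Union>i\<in>{1..r}. FacX i)"

section \<open>Generators, subgroups, cones and spheres\<close>

sublocale GG: group G
  by (rule group_G)

lemma gens_cases:
  assumes "g \<in> gens"
  obtains i a where "i \<in> {1..r}" "a \<in> carrier (\<Gamma> i)" "g = \<iota> i a"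
  using assms by (auto simp: gens_def Fac_def)

lemma gens_carrier: "g \<in> gens \<Longrightarrow> g \<in> carrier G"
  using gens_cases \<iota>_carrier by metis

lemma finite_gens: "finite gens"
  using finite_factor by (auto simp: gens_def Fac_def)

lemma word_fst_range: "w \<in> carrier G \<Longrightarrow> x \<in> set (word w) \<Longrightarrow> fst x \<in> {1..r}"
  using reduced_word[of w] by (auto simp: reduced_def)

lemma FF_eq: "FF = {w \<in> carrier G. length (word w) = 1}"
proof (intro equalityI subsetI)
  fix w assume "w \<in> {w \<in> carrier G. length (word w) = 1}"
  then obtain x where x: "w \<in> carrier G" "word w = [x]" by (auto simp: length_Suc_conv)
  then have i: "fst x \<in> {1..r}" using word_fst_range[of w x] by simp
  then have "w \<in> FacX (fst x)" unfolding FacX_eq[OF i] using x by (auto intro: exI[of _ "snd x"])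
  then show "w \<in> FF" unfolding FF_def using i by blast
qed (auto simp: FF_def FacX_eq)

lemma FacX_ltype: "i \<in> {1..r} \<Longrightarrow> FacX i = {w \<in> FF. ltype w = i}"
  unfolding FacX_eq FF_eq by (auto simp: ltype_def length_Suc_conv)

lemma FF_carrier: "w \<in> FF \<Longrightarrow> w \<in> carrier G"
  by (simp add: FF_eq)

lemma ltype_FF: "t \<in> FF \<Longrightarrow> ltype t \<in> {1..r}"
  using word_fst_range[of t] by (auto simp: FF_eq ltype_def length_Suc_conv)

lemma \<tau>_ltype: "t \<in> FF \<Longrightarrow> \<tau> t = ltype t"
  using \<tau>_FacX FacX_ltype ltype_FF by blast

lemma gens_eq: "gens = HH \<union> FF"
  using one_idx by (auto simp: gens_def FF_def Fac_eq FacX_eq HH_eq)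

lemma HH_carrier: "h \<in> HH \<Longrightarrow> h \<in> carrier G"
  by (simp add: HH_eq)

lemma finite_HH: "finite HH" and finite_FF: "finite FF"
  using finite_gens by (auto simp: gens_eq)

lemma one_HH: "\<one>\<^bsub>G\<^esub> \<in> HH"
  by (simp add: HH_eq word_def nfc_one base_def)

lemma word_one: "word \<one>\<^bsub>G\<^esub> = []"
  by (simp add: word_def nfc_one base_def)

lemma Fac_subgroup:
  assumes i: "i \<in> {1..r}"
  shows "subgroup (Fac i) G"
proof -
  interpret g: group "\<Gamma> i" using group_factor i .
  have "\<one>\<^bsub>G\<^esub> \<diamond> \<iota> i \<one>\<^bsub>\<Gamma> i\<^esub> = \<iota> i \<one>\<^bsub>\<Gamma> i\<^esub>
      \<diamond> \<iota> i \<one>\<^bsub>\<Gamma> i\<^esub>"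
    using mult_\<iota>[OF i, of "\<one>\<^bsub>\<Gamma> i\<^esub>" "\<one>\<^bsub>\<Gamma> i\<^esub>"] \<iota>_carrier[OF i, of
        "\<one>\<^bsub>\<Gamma> i\<^esub>"] by simp
  then have one: "\<iota> i \<one>\<^bsub>\<Gamma> i\<^esub> = \<one>\<^bsub>G\<^esub>" using \<iota>_carrier[OF i, of
      "\<one>\<^bsub>\<Gamma> i\<^esub>"] by simp
  show ?thesis
  proof (rule GG.subgroupI)
    show "Fac i \<subseteq> carrier G" using \<iota>_carrier[OF i] by (auto simp: Fac_def)
    show "Fac i \<noteq> {}" using g.one_closed by (auto simp: Fac_def)
  next
    fix a assume "a \<in> Fac i"
    then obtain x where x: "x \<in> carrier (\<Gamma> i)" "a = \<iota> i x" by (auto simp: Fac_def)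
    then have "\<iota> i (inv\<^bsub>\<Gamma> i\<^esub> x) \<diamond> a = \<one>\<^bsub>G\<^esub>" using mult_\<iota>[OF i, of
        "inv\<^bsub>\<Gamma> i\<^esub> x" x] one by simp
    then have "inv\<^bsub>G\<^esub> a = \<iota> i (inv\<^bsub>\<Gamma> i\<^esub> x)"
      using x \<iota>_carrier[OF i] by (intro GG.inv_equality) auto
    then show "inv\<^bsub>G\<^esub> a \<in> Fac i" using x by (auto simp: Fac_def)
  next
    fix a b assume "a \<in> Fac i" "b \<in> Fac i"
    then show "a \<diamond> b \<in> Fac i" using mult_\<iota>[OF i] g.m_closed by (auto simp: Fac_def)
  qed
qed

lemma inv_gens: "g \<in> gens \<Longrightarrow> inv\<^bsub>G\<^esub> g \<in> gens"
  using subgroup.m_inv_closed[OF Fac_subgroup] unfolding gens_def by blast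

text \<open>Makes \<open>HH\<close> a subgroup as an intersection of two subgroups. A one-letter
  word cannot have two types, and \<open>2 \<le> r\<close> supplies the second factor.\<close>

lemma HH_Fac_inter:
  "HH = Fac 1 \<inter> Fac 2"
  using r_ge_2 by (auto simp: HH_eq Fac_eq)

lemma HH_subgroup: "subgroup HH G"
proof -
  have "2 \<in> {1..r}" using r_ge_2 by simp
  then show ?thesis unfolding HH_Fac_inter
    using GG.subgroups_Inter_pair[OF Fac_subgroup[OF one_idx] Fac_subgroup] by blast
qed

lemma HH_Fac: "i \<in> {1..r} \<Longrightarrow> HH \<subseteq> Fac i"
  by (auto simp: HH_eq Fac_eq)

lemma HH_mult_HH_iff:
  assumes "h \<in> HH" "a \<in> carrier G"
  shows "h \<diamond> a \<in> HH \<longleftrightarrow> a \<in> HH"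
proof
  assume "h \<diamond> a \<in> HH"
  then have "inv\<^bsub>G\<^esub> h \<diamond> (h \<diamond> a) \<in> HH"
    by (rule subgroup.m_closed[OF HH_subgroup subgroup.m_inv_closed[OF HH_subgroup assms(1)]])
  moreover have "inv\<^bsub>G\<^esub> h \<diamond> (h \<diamond> a) = a"
    using assms HH_carrier[of h] by (simp add: GG.m_assoc[symmetric])
  ultimately show "a \<in> HH" by simp
qed (use assms in \<open>auto intro: subgroup.m_closed[OF HH_subgroup]\<close>)

lemma HH_mult_FacX:
  assumes i: "i \<in> {1..r}" and "h \<in> HH" "a \<in> FacX i"
  shows "h \<diamond> a \<in> FacX i"
proof -
  have a: "a \<in> Fac i" "a \<notin> HH" "a \<in> carrier G" using assms by (auto simp: FacX_def Fac_eq)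
  then have "h \<diamond> a \<notin> HH" using HH_mult_HH_iff assms by simp
  moreover have "h \<diamond> a \<in> Fac i"
    using subgroup.m_closed[OF Fac_subgroup[OF i]] HH_Fac[OF i] assms a by blast
  ultimately show ?thesis by (simp add: FacX_def)
qed

lemma HH_mult_gens: "h \<in> HH \<Longrightarrow> g \<in> gens \<Longrightarrow> h \<diamond> g \<in> gens"
  using HH_mult_FacX subgroup.m_closed[OF HH_subgroup] unfolding gens_eq FF_def by blast

lemma HH_mult_ltype:
  assumes "h \<in> HH" "g \<in> gens"
  shows "ltype (h \<diamond> g) = ltype g"
proof (cases "g \<in> HH")
  case True
  then have "h \<diamond> g \<in> HH" using assms subgroup.m_closed[OF HH_subgroup] by blast
  then show ?thesis using True by (simp add: ltype_def HH_eq)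
next
  case False
  then have g: "g \<in> FacX (ltype g)" "ltype g \<in> {1..r}" using assms ltype_FF FacX_ltype by (auto simp: gens_eq)
  then show ?thesis using HH_mult_FacX[OF g(2) assms(1) g(1)] FacX_ltype[OF g(2)] by simp
qed

text \<open>Since \<open>v\<close> ends without an \<open>H\<close>-part, nothing has to be pushed
  through the letters of \<open>a\<close>, and since the types differ at the junction, the
  concatenated word is already reduced.\<close>

lemma nfc_V_mult:
  assumes v: "v \<in> carrier G" "tail v = \<one>\<^bsub>H\<^esub>" and a: "a \<in> carrier G"
    and d: "word a \<noteq> [] \<Longrightarrow> fst (hd (word a)) \<noteq> ltype v"
  shows "nfc (v \<diamond> a) = (word v @ word a, tail a)"
proof -
  have rv: "reduced (word v)" and ra: "reduced (word a)" using reduced_word v a by auto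
  have "cls (word v) = v"
  proof (rule nfc_inject)
    show "nfc (cls (word v)) = nfc v"
      using nfc_cls[OF reduced_letters[OF rv]] acts_reduced[OF rv] v by (simp add: word_def tail_def prod_eq_iff)
  qed (use v rv cls_carrier reduced_letters in auto)
  moreover have aw: "cls (wd (nfc a)) = a" using cls_wd_nfc a by simp
  ultimately have "v \<diamond> a = cls (wd (word v @ word a, tail a))"
    using mult_cls[OF reduced_letters[OF rv] wd_letters[OF nfc_NF[OF a]]]
    by (simp add: wd_def word_def tail_def)
  moreover have "reduced (word v @ word a)"
    using rv ra d by (auto simp: reduced_def successively_append_iff ltype_def)
  ultimately show ?thesis using nfc_cls_wd[of "(word v @ word a, tail a)"] tail_carrier[OF a]
    by (simp add: NF_def)
qed

text \<open>A right multiplication within one factor can only create, change or delete a last letter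
  of that type; \<open>xs\<close> is the stem common to both words.\<close>

lemma word_step:
  assumes w: "w \<in> carrier G" and i: "i \<in> {1..r}" and a: "a \<in> carrier (\<Gamma> i)"
  obtains xs where "xs = word w \<and> (word w = [] \<or> fst (last (word w)) \<noteq> i) \<or> (\<exists>t. word w = xs @ [(i, t)])"
    "word (w \<diamond> \<iota> i a) = xs \<or> (\<exists>t. word (w \<diamond> \<iota> i a) = xs @ [(i, t)])"
proof
  let ?xs = "fst (enc i (nfc w))"
  show "word (w \<diamond> \<iota> i a) = ?xs \<or> (\<exists>t. word (w \<diamond> \<iota> i a) = ?xs @ [(i, t)])"
    using nfc_mult_\<iota>[OF assms] by (auto simp: word_def act_def dec_def)
  show "?xs = word w \<and> (word w = [] \<or> fst (last (word w)) \<noteq> i) \<or> (\<exists>t. word w = ?xs @ [(i, t)])"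
  proof (cases "word w \<noteq> [] \<and> fst (last (word w)) = i")
    case True
    then have "word w = butlast (word w) @ [(i, snd (last (word w)))]"
      by (metis append_butlast_last_id prod.collapse)
    then show ?thesis using True by (auto simp: enc_def word_def)
  next
    case False
    then show ?thesis by (auto simp: enc_def word_def)
  qed
qed

lemma cone_carrier: "a \<in> cone i \<Longrightarrow> a \<in> carrier G"
  by (simp add: cone_def)

lemma cone_0: "cone 0 = carrier G - HH"
proof -
  have "fst (hd (word w)) \<noteq> 0" if "w \<in> carrier G" "word w \<noteq> []" for w
    using word_fst_range[OF that(1), of "hd (word w)"] that by auto
  then show ?thesis by (auto simp: cone_def HH_eq)
qed

text \<open>A cone can be left only through \<open>HH\<close>. A step alters at most the last
  letter, so the first letter survives in words of length at least two; a single letter can change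
  only within its own type or vanish.\<close>

lemma cone_step:
  assumes a: "a \<in> cone i" and g: "g \<in> gens"
  shows "a \<diamond> g \<in> cone i \<union> HH"
proof -
  obtain j b where g: "j \<in> {1..r}" "b \<in> carrier (\<Gamma> j)" "g = \<iota> j b" using g gens_cases by blast
  have ac: "a \<in> carrier G" "word a \<noteq> []" "fst (hd (word a)) \<noteq> i" using a by (auto simp: cone_def)
  have "a \<diamond> g \<in> carrier G" using ac \<iota>_carrier g by simp
  then show ?thesis
    using ac by (rule_tac word_step[OF ac(1) g(1,2)]) (auto simp: g(3) cone_def HH_eq hd_append split: if_splits)
qed

lemma length_step:
  assumes a: "w \<in> carrier G" and g: "g \<in> gens"
  shows "length (word (w \<diamond> g)) \<le> Suc (length (word w))" "length (word w) \<le> Suc (length (word (w \<diamond> g)))"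
proof -
  obtain j b where g: "j \<in> {1..r}" "b \<in> carrier (\<Gamma> j)" "g = \<iota> j b" using g gens_cases by blast
  obtain xs where "xs = word w \<and> (word w = [] \<or> fst (last (word w)) \<noteq> j) \<or> (\<exists>t. word w = xs @ [(j, t)])"
    "word (w \<diamond> \<iota> j b) = xs \<or> (\<exists>t. word (w \<diamond> \<iota> j b) = xs @ [(j, t)])"
    using word_step[OF a g(1,2)] by metis
  then show "length (word (w \<diamond> g)) \<le> Suc (length (word w))" "length (word w) \<le> Suc (length (word (w \<diamond> g)))"
    unfolding g(3) by auto
qed

lemma inj_nfc: "inj_on nfc (carrier G)"
  by (rule inj_onI) (rule nfc_inject)

lemma finite_sphere: "finite {w \<in> carrier G. length (word w) = k}"
proof -
  have "finite letters" unfolding letters_def using finite_factor by auto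
  then have "finite ({xs. set xs \<subseteq> letters \<and> length xs = k} \<times> carrier H)"
    using finite_lists_length_eq finite_H by blast
  moreover have "nfc ` {w \<in> carrier G. length (word w) = k} \<subseteq> {xs. set xs \<subseteq> letters \<and> length xs = k} \<times> carrier H"
  proof (rule image_subsetI)
    fix w assume w: "w \<in> {w \<in> carrier G. length (word w) = k}"
    then show "nfc w \<in> {xs. set xs \<subseteq> letters \<and> length xs = k} \<times> carrier H"
      using tail_carrier[of w] reduced_letters[OF reduced_word[of w]] by (auto simp: word_def tail_def mem_Times_iff)
  qed
  ultimately have "finite (nfc ` {w \<in> carrier G. length (word w) = k})" using finite_subset by blast
  then show ?thesis by (rule finite_imageD) (use inj_nfc in \<open>auto simp: inj_on_def\<close>)
qed

lemma finite_reps: "finite (reps k)"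
  by (rule finite_subset[OF _ finite_sphere[of k]]) (auto simp: reps_def)

lemma countable_G: "countable (carrier G)"
proof -
  have "countable (\<Union>k. {w \<in> carrier G. length (word w) = k})"
    by (rule countable_UN) (auto intro: countable_finite finite_sphere)
  also have "(\<Union>k. {w \<in> carrier G. length (word w) = k}) = carrier G" by auto
  finally show ?thesis .
qed

lemma bracket_nfc:
  assumes "w \<in> carrier G" "word w \<noteq> []"
  shows "bracket w \<in> carrier G" "nfc (bracket w) = ([last (word w)], tail w)"
proof -
  let ?x = "last (word w)"
  have r: "reduced [?x]" using reduced_in_single[OF reduced_word[OF assms(1)]] assms by simp
  have h: "embh (tail w) \<in> carrier G" "nfc (embh (tail w)) = ([], tail w)"
    unfolding embh_def using \<iota>_carrier[OF one_idx] \<phi>_carrier[OF one_idx] nfc_\<iota>[OF one_idx]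
      rep_res_\<phi>[OF one_idx] tail_carrier[OF assms(1)] by auto
  show "bracket w \<in> carrier G" using bracket_eq[OF assms] nfc_emb[OF r] h by simp
  show "nfc (bracket w) = ([?x], tail w)" unfolding bracket_eq[OF assms]
    using nfc_V_mult[of "emb ?x" "embh (tail w)"] nfc_emb[OF r] h by (simp add: tail_def word_def)
qed

lemma bracket_FF: "w \<in> carrier G \<Longrightarrow> word w \<noteq> [] \<Longrightarrow> bracket w \<in> FF"
  using bracket_nfc by (simp add: FF_eq word_def)

lemma ltype_bracket: "w \<in> carrier G \<Longrightarrow> word w \<noteq> [] \<Longrightarrow> ltype (bracket w) = ltype w"
  using bracket_nfc[of w] by (simp add: ltype_def word_def)

lemma bracket_eq_iff:
  assumes "w \<in> carrier G" "word w \<noteq> []" "t \<in> FF"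
  shows "bracket w = t \<longleftrightarrow> nfc t = ([last (word w)], tail w)"
  using bracket_nfc[OF assms(1,2)] nfc_inject[of "bracket w" t] FF_carrier[OF assms(3)] by metis

lemma V_mult_FF:
  assumes "v \<in> reps k" "t \<in> FF" "ltype t \<noteq> ltype v"
  shows "v \<diamond> t \<in> carrier G" "nfc (v \<diamond> t) = (word v @ word t, tail t)" "bracket (v \<diamond> t) = t"
    "length (word (v \<diamond> t)) = Suc k"
proof -
  have v: "v \<in> carrier G" "tail v = \<one>\<^bsub>H\<^esub>" "length (word v) = k" using assms by (auto simp: reps_def)
  have t: "t \<in> carrier G" using assms FF_carrier by blast
  obtain x where x: "word t = [x]" using assms by (auto simp: FF_eq length_Suc_conv)
  show c: "v \<diamond> t \<in> carrier G" using v t by simp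
  show n: "nfc (v \<diamond> t) = (word v @ word t, tail t)"
    using assms x by (intro nfc_V_mult v t) (auto simp: ltype_def[of t])
  then have word: "word (v \<diamond> t) = word v @ [x]" and "tail (v \<diamond> t) = tail t" using x by (auto simp: word_def tail_def)
  then show "bracket (v \<diamond> t) = t"
    using bracket_eq_iff[OF c _ assms(2)] x by (simp add: word_def tail_def prod_eq_iff)
  show "length (word (v \<diamond> t)) = Suc k" using word v by simp
qed

lemma cls_word_V:
  assumes "reduced xs"
  shows "cls xs \<in> reps (length xs)" "word (cls xs) = xs"
  using nfc_cls[OF reduced_letters[OF assms]] acts_reduced[OF assms] cls_carrier[OF reduced_letters[OF assms]]
  by (auto simp: reps_def word_def tail_def)

text \<open>Parametrises the end points \<open>v t\<close> of crossings from level \<open>k\<close>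
  to the next one: the bracket recovers \<open>t\<close>, and what is left of the word recovers
  \<open>v\<close>.\<close>

lemma sphere_decomp:
  "bij_betw (\<lambda>(v, t). v \<diamond> t) (SIGMA v:reps k. {t \<in> FF. ltype t \<noteq> ltype v}) {w \<in> carrier G. length (word w) = Suc k}"
proof (rule bij_betwI')
  fix p q assume p: "p \<in> (SIGMA v:reps k. {t \<in> FF. ltype t \<noteq> ltype v})" and q: "q \<in> (SIGMA v:reps k. {t \<in>
      FF. ltype t \<noteq> ltype v})"
  obtain v t v' t' where pq: "p = (v, t)" "q = (v', t')" by (cases p, cases q)
  have "v = v' \<and> t = t'" if e: "v \<diamond> t = v' \<diamond> t'"
  proof -
    have "t = t'" using V_mult_FF(3)[of v k t] V_mult_FF(3)[of v' k t'] p q pq e by auto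
    moreover have "word v @ word t = word v' @ word t'" using V_mult_FF(2)[of v k t] V_mult_FF(2)[of v' k t'] p q pq e by auto
    ultimately have "nfc v = nfc v'" using p q pq by (auto simp: word_def tail_def reps_def prod_eq_iff)
    then show ?thesis using \<open>t = t'\<close> nfc_inject p q pq by (auto simp: reps_def)
  qed
  then show "((case p of (v, t) \<Rightarrow> v \<diamond> t) = (case q of (v, t) \<Rightarrow> v \<diamond> t)) = (p = q)" by (auto simp: pq)
next
  fix p assume "p \<in> (SIGMA v:reps k. {t \<in> FF. ltype t \<noteq> ltype v})"
  then show "(case p of (v, t) \<Rightarrow> v \<diamond> t) \<in> {w \<in> carrier G. length (word w) = Suc k}"
    using V_mult_FF by auto
next
  fix w assume "w \<in> {w \<in> carrier G. length (word w) = Suc k}"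
  then have w: "w \<in> carrier G" "length (word w) = Suc k" "word w \<noteq> []" by auto
  have e: "word w = butlast (word w) @ [last (word w)]" using w by simp
  have rb: "reduced (butlast (word w))" and nl: "butlast (word w) \<noteq> [] \<Longrightarrow> fst (last (butlast (word w)))
      \<noteq> fst (last (word w))"
    using reduced_word[OF w(1)] reduced_append_single[of "butlast (word w)" "fst (last (word w))" "snd (last (word w))"] e by auto
  let ?v = "cls (butlast (word w))"
  have v: "?v \<in> reps k" "word ?v = butlast (word w)" using cls_word_V[OF rb] w by auto
  have t: "bracket w \<in> FF" "ltype (bracket w) = ltype w" using bracket_FF ltype_bracket w by auto
  have ne: "ltype (bracket w) \<noteq> ltype ?v"
    unfolding t(2) using nl v w word_fst_range[OF w(1), of "last (word w)"] by (auto simp: ltype_def)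
  have "?v \<diamond> bracket w = w"
    using V_mult_FF(2)[OF v(1) t(1) ne] V_mult_FF(1)[OF v(1) t(1) ne] bracket_nfc[OF w(1,3)] v w e
    by (intro nfc_inject) (auto simp: word_def tail_def prod_eq_iff)
  then show "\<exists>p\<in>(SIGMA v:reps k. {t \<in> FF. ltype t \<noteq> ltype v}). w = (case p of (v, t) \<Rightarrow> v \<diamond> t)"
    using v t ne by (intro bexI[of _ "(?v, bracket w)"]) auto
qed

lemma V_mult_HH:
  assumes "v \<in> reps k" "h \<in> HH"
  shows "v \<diamond> h \<in> carrier G" "nfc (v \<diamond> h) = (word v, tail h)" "word (v \<diamond> h) = word v"
proof -
  have v: "v \<in> carrier G" "tail v = \<one>\<^bsub>H\<^esub>" and h: "h \<in> carrier G" "word h = []" using assms by (auto simp: reps_def HH_eq)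
  show "v \<diamond> h \<in> carrier G" using v h by simp
  show "nfc (v \<diamond> h) = (word v, tail h)" using nfc_V_mult[OF v h(1)] h(2) by simp
  then show "word (v \<diamond> h) = word v" by (simp add: word_def)
qed

lemma HH_embh: "w \<in> carrier G \<Longrightarrow> embh (tail w) \<in> HH" "w \<in> carrier G \<Longrightarrow> nfc (embh (tail w)) = ([], tail w)"
  using nfc_\<iota>[OF one_idx] rep_res_\<phi>[OF one_idx] tail_carrier[of w] \<phi>_carrier[OF one_idx]
  by (auto simp: HH_def embh_def)

text \<open>The same spheres cut into cosets of \<open>HH\<close>, which parametrises the starting
  points \<open>v h\<close> of crossings. The passage from one level to the next uses
  \<open>sphere_decomp\<close> on one side and this form on the other.\<close>

lemma sphere_decomp_HH:
  "bij_betw (\<lambda>(v, h). v \<diamond> h) (reps k \<times> HH) {w \<in> carrier G. length (word w) = k}"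
proof (rule bij_betwI')
  fix p q assume p: "p \<in> reps k \<times> HH" and q: "q \<in> reps k \<times> HH"
  obtain v t v' t' where pq: "p = (v, t)" "q = (v', t')" by (cases p, cases q)
  have "v = v' \<and> t = t'" if e: "v \<diamond> t = v' \<diamond> t'"
  proof -
    have "(word v, tail t) = (word v', tail t')" using V_mult_HH(2)[of v k t] V_mult_HH(2)[of v' k t'] p q pq e by auto
    then have "nfc v = nfc v'" "nfc t = nfc t'" using p q pq by (auto simp: word_def tail_def reps_def HH_eq prod_eq_iff)
    then show ?thesis using nfc_inject p q pq by (auto simp: reps_def HH_eq)
  qed
  then show "((case p of (v, t) \<Rightarrow> v \<diamond> t) = (case q of (v, t) \<Rightarrow> v \<diamond> t)) = (p = q)" by (auto simp: pq)
next
  fix p assume "p \<in> reps k \<times> HH"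
  then show "(case p of (v, t) \<Rightarrow> v \<diamond> t) \<in> {w \<in> carrier G. length (word w) = k}"
    using V_mult_HH by (auto simp: reps_def)
next
  fix w assume "w \<in> {w \<in> carrier G. length (word w) = k}"
  then have w: "w \<in> carrier G" "length (word w) = k" by auto
  let ?v = "cls (word w)"
  have v: "?v \<in> reps k" "word ?v = word w" using cls_word_V[OF reduced_word[OF w(1)]] w by auto
  note h = HH_embh[OF w(1)]
  have "?v \<diamond> embh (tail w) = w"
    using V_mult_HH(1,2)[OF v(1) h(1)] h v w by (intro nfc_inject) (auto simp: word_def tail_def prod_eq_iff)
  then show "\<exists>p\<in>reps k \<times> HH. w = (case p of (v, t) \<Rightarrow> v \<diamond> t)"
    using v h by (intro bexI[of _ "(?v, embh (tail w))"]) auto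
qed

lemma length_V_mult:
  assumes "v \<in> reps k" "a \<in> cone (ltype v) \<union> HH"
  shows "length (word (v \<diamond> a)) = k + length (word a)"
proof -
  have "word (v \<diamond> a) = word v @ word a"
    unfolding word_def[of "v \<diamond> a"] using nfc_V_mult[of v a] assms by (auto simp: reps_def cone_def HH_eq)
  then show ?thesis using assms by (auto simp: reps_def)
qed

lemma gens_cone: "g \<in> gens \<Longrightarrow> g \<in> cone i \<longleftrightarrow> g \<in> FF \<and> ltype g \<noteq> i"
  by (auto simp: gens_eq FF_eq HH_eq cone_def ltype_def length_Suc_conv)

end

context amalgam_walk
begin

section \<open>Paths of the random walk\<close>

abbreviation stepw :: "'a amalg \<Rightarrow> real" where
  "stepw \<equiv> mu \<alpha> \<mu>"

lemma stepw_nonneg: "0 \<le> stepw g"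
proof -
  have "0 \<le> \<alpha> (\<tau> g)" if "g \<in> (\<Union>i\<in>{1..r}. FacX i)"
    using that \<tau>_FacX \<alpha>_pos by (force intro: less_imp_le)
  then show ?thesis
    using less_imp_le[OF \<alpha>_pos] by (auto simp: mu_def intro!: mult_nonneg_nonneg sum_nonneg)
qed

lemma stepw_outside: "g \<notin> gens \<Longrightarrow> stepw g = 0"
  by (simp add: mu_def gens_eq FF_def)

lemma p_mult: "w \<in> carrier G \<Longrightarrow> g \<in> carrier G \<Longrightarrow> p \<alpha> \<mu> w (w \<diamond> g) = stepw g"
  by (simp add: p_def GG.m_assoc[symmetric])

lemma measurable_X' [measurable]:
  assumes "w \<in> carrier G"
  shows "(\<lambda>\<omega>. f (X n \<omega>)) \<in> measurable (P w) (count_space UNIV)"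
  by (rule measurable_compose[OF measurable_X[OF assms]]) simp

lemma X_carrier: "w \<in> carrier G \<Longrightarrow> \<omega> \<in> space (P w) \<Longrightarrow> X n \<omega> \<in> carrier G"
  using measurable_space[OF measurable_X] by (metis space_count_space)

definition path :: "nat \<Rightarrow> 'w \<Rightarrow> 'a amalg list" where
  "path n \<omega> = map (\<lambda>m. X m \<omega>) [0..<Suc n]"

lemma length_path [simp]: "length (path n \<omega>) = Suc n"
  by (simp add: path_def)

lemma nth_path [simp]: "m \<le> n \<Longrightarrow> path n \<omega> ! m = X m \<omega>"
  unfolding path_def by (subst nth_map) (auto simp del: upt_Suc)

lemma path_eq_iff: "length ws = Suc n \<Longrightarrow> path n \<omega> = ws \<longleftrightarrow> (\<forall>m\<le>n. X m \<omega> = ws ! m)"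
  by (auto simp: list_eq_iff_nth_eq less_Suc_eq_le)

lemma measurable_path [measurable]:
  assumes w: "w \<in> carrier G"
  shows "Measurable.pred (P w) (\<lambda>\<omega>. \<psi> (path n \<omega>))"
proof -
  let ?L = "{ws \<in> lists (carrier G). length ws = Suc n \<and> \<psi> ws}"
  have c: "countable ?L" using countable_lists[OF countable_G] by (rule countable_subset[rotated]) auto
  have "Measurable.pred (P w) (\<lambda>\<omega>. \<exists>ws\<in>?L. \<forall>m\<le>n. X m \<omega> = ws ! m)"
    using w c by measurable
  also have "?this \<longleftrightarrow> ?thesis"
  proof (rule measurable_cong)
    fix \<omega> assume "\<omega> \<in> space (P w)"
    then have "path n \<omega> \<in> lists (carrier G)" using X_carrier[OF w] by (auto simp: path_def)
    then show "(\<exists>ws\<in>?L. \<forall>m\<le>n. X m \<omega> = ws ! m) \<longleftrightarrow> \<psi> (path n \<omega>)"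
      using path_eq_iff[of _ n \<omega>] by (metis (mono_tags, lifting) mem_Collect_eq length_path)
  qed
  finally show ?thesis .
qed

lemma AE_X0: "w \<in> carrier G \<Longrightarrow> AE \<omega> in P w. X 0 \<omega> = w"
proof -
  assume w: "w \<in> carrier G"
  interpret P: prob_space "P w" using prob_P w .
  have "P.prob {\<omega> \<in> space (P w). X 0 \<omega> = w} = 1"
    using law_X[OF w, of 0 "\<lambda>_. w"] w by simp
  then show ?thesis using w by (subst P.prob_Collect_eq_1[symmetric]) measurable
qed

text \<open>The total mass is read off the process instead of being resummed from the factor
  measures: \<open>X 1\<close> takes values in the countable set \<open>carrier G\<close> almost
  surely, and points outside \<open>gens\<close> have probability zero under the law of the first
  step.\<close>

lemma stepw_sum: "(\<Sum>g\<in>gens. stepw g) = 1"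
proof -
  let ?e = "\<one>\<^bsub>G\<^esub>"
  have e: "?e \<in> carrier G" by simp
  interpret P: prob_space "P ?e" using prob_P e .
  have pr: "P.prob {\<omega> \<in> space (P ?e). X 0 \<omega> = ?e \<and> X 1 \<omega> = v} = stepw v" if "v \<in> carrier G" for v
  proof -
    have "P.prob {\<omega> \<in> space (P ?e). \<forall>m\<le>1. X m \<omega> = (\<lambda>m. if m = 0 then ?e else v) m} = stepw v"
      by (subst law_X[OF e]) (use that in \<open>auto simp: p_def\<close>)
    also have "{\<omega> \<in> space (P ?e). \<forall>m\<le>1. X m \<omega> = (\<lambda>m. if m = 0 then ?e else v) m} =
      {\<omega> \<in> space (P ?e). X 0 \<omega> = ?e \<and> X 1 \<omega> = v}" by (auto simp: le_Suc_eq)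
    finally show ?thesis .
  qed
  have ms: "{\<omega> \<in> space (P ?e). X 0 \<omega> = ?e \<and> X 1 \<omega> = v} \<in> P.events" for v
    using e by measurable
  have "AE \<omega> in P ?e. \<forall>v\<in>carrier G - gens. \<not> (X 0 \<omega> = ?e \<and> X 1 \<omega> = v)"
  proof (rule AE_ball_countable[THEN iffD2], safe)
    show "countable (carrier G - gens)" using countable_G by simp
    fix v assume v: "v \<in> carrier G" "v \<notin> gens"
    have "P.prob {\<omega> \<in> space (P ?e). X 0 \<omega> = ?e \<and> X 1 \<omega> = v} = 0" using pr v stepw_outside by simp
    then show "AE \<omega> in P ?e. \<not> (X 0 \<omega> = ?e \<and> X 1 \<omega> = v)"
      using P.prob_eq_0[OF ms[of v]] by (auto elim: AE_mp intro!: AE_I2)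
  qed
  then have "AE \<omega> in P ?e. \<omega> \<in> (\<Union>v\<in>gens. {\<omega> \<in> space (P ?e). X 0 \<omega> = ?e \<and> X 1 \<omega> = v})"
    using AE_X0[OF e] AE_space
  proof eventually_elim
    case (elim \<omega>)
    then show ?case using X_carrier[OF e, of \<omega> 1] by auto
  qed
  moreover have "(\<Union>v\<in>gens. {\<omega> \<in> space (P ?e). X 0 \<omega> = ?e \<and> X 1 \<omega> = v}) \<in> P.events"
    using finite_gens ms by auto
  ultimately have "1 = P.prob (\<Union>v\<in>gens. {\<omega> \<in> space (P ?e). X 0 \<omega> = ?e \<and> X 1 \<omega> = v})"
    using P.prob_eq_1 by auto
  also have "\<dots> = (\<Sum>v\<in>gens. P.prob {\<omega> \<in> space (P ?e). X 0 \<omega> = ?e \<and> X 1 \<omega> = v})"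
    by (rule P.finite_measure_finite_Union[OF finite_gens]) (use ms in \<open>auto simp: disjoint_family_on_def\<close>)
  also have "\<dots> = (\<Sum>g\<in>gens. stepw g)" using pr gens_carrier by simp
  finally show ?thesis by simp
qed

text \<open>Expectation of a functional of the first \<open>n\<close> steps, by recursion over the
  first step. Finite-horizon computations take place in these finite sums; \<open>prob_pathE\<close>
  is the bridge to the measures \<open>P w\<close>.\<close>

primrec pathE :: "nat \<Rightarrow> 'a amalg \<Rightarrow> ('a amalg list \<Rightarrow> real) \<Rightarrow> real" where
  "pathE 0 w F = F [w]"
| "pathE (Suc n) w F = (\<Sum>g\<in>gens. stepw g * pathE n (w \<diamond> g) (\<lambda>ws. F (w # ws)))"

primrec paths :: "nat \<Rightarrow> 'a amalg \<Rightarrow> 'a amalg list set" where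
  "paths 0 w = {[w]}"
| "paths (Suc n) w = (\<Union>g\<in>gens. (#) w ` paths n (w \<diamond> g))"

lemma paths_props:
  "w \<in> carrier G \<Longrightarrow> ws \<in> paths n w \<Longrightarrow> length ws = Suc n \<and> ws ! 0 = w \<and> set ws \<subseteq> carrier G"
proof (induction n arbitrary: w ws)
  case (Suc n)
  then obtain g us where g: "g \<in> gens" "us \<in> paths n (w \<diamond> g)" "ws = w # us" by auto
  then show ?case using Suc.IH[of "w \<diamond> g" us] Suc.prems(1) gens_carrier by auto
qed auto

lemma finite_paths: "finite (paths n w)"
  by (induction n arbitrary: w) (auto simp: finite_gens)

lemma pathE_sum:
  "w \<in> carrier G \<Longrightarrow> pathE n w F = (\<Sum>ws\<in>paths n w. (\<Prod>m<n. p \<alpha> \<mu> (ws ! m) (ws ! Suc m)) * F ws)"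
proof (induction n arbitrary: w F)
  case (Suc n)
  have "(\<Sum>ws\<in>paths (Suc n) w. (\<Prod>m<Suc n. p \<alpha> \<mu> (ws ! m) (ws ! Suc m)) * F ws) =
    (\<Sum>g\<in>gens. \<Sum>ws\<in>(#) w ` paths n (w \<diamond> g). (\<Prod>m<Suc n. p \<alpha> \<mu> (ws ! m) (ws ! Suc m)) * F ws)"
    unfolding paths.simps
  proof (rule sum.UNION_disjoint[OF finite_gens])
    show "\<forall>g\<in>gens. finite ((#) w ` paths n (w \<diamond> g))" using finite_paths by blast
    show "\<forall>g\<in>gens. \<forall>g'\<in>gens. g \<noteq> g' \<longrightarrow> (#) w ` paths n (w \<diamond> g) \<inter> (#)
        w ` paths n (w \<diamond> g') = {}"
    proof (intro ballI impI equals0I)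
      fix g g' x assume g: "g \<in> gens" "g' \<in> gens" "g \<noteq> g'"
        and "x \<in> (#) w ` paths n (w \<diamond> g) \<inter> (#) w ` paths n (w \<diamond> g')"
      then obtain us where "us \<in> paths n (w \<diamond> g)" "us \<in> paths n (w \<diamond> g')" by auto
      then have "w \<diamond> g = w \<diamond> g'"
        using paths_props[of "w \<diamond> g" us n] paths_props[of "w \<diamond> g'" us n] g Suc.prems gens_carrier by auto
      then show False using g Suc.prems gens_carrier by auto
    qed
  qed
  also have "\<dots> = (\<Sum>g\<in>gens. stepw g * pathE n (w \<diamond> g) (\<lambda>ws. F (w # ws)))"
  proof (rule sum.cong[OF HOL.refl])
    fix g assume g: "g \<in> gens"
    then have gc: "g \<in> carrier G" "w \<diamond> g \<in> carrier G" using gens_carrier Suc.prems by auto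
    have "(\<Sum>ws\<in>(#) w ` paths n (w \<diamond> g). (\<Prod>m<Suc n. p \<alpha> \<mu> (ws ! m) (ws ! Suc m)) * F ws) =
      (\<Sum>us\<in>paths n (w \<diamond> g). (\<Prod>m<Suc n. p \<alpha> \<mu> ((w # us) ! m) ((w # us) ! Suc m)) * F (w # us))"
      by (subst sum.reindex) (auto simp: inj_on_def)
    also have "\<dots> = (\<Sum>us\<in>paths n (w \<diamond> g). stepw g * ((\<Prod>m<n. p \<alpha> \<mu> (us ! m) (us ! Suc m)) * F (w # us)))"
    proof (rule sum.cong[OF HOL.refl])
      fix us assume us: "us \<in> paths n (w \<diamond> g)"
      have "us ! 0 = w \<diamond> g" using paths_props[OF gc(2) us] by simp
      then show "(\<Prod>m<Suc n. p \<alpha> \<mu> ((w # us) ! m) ((w # us) ! Suc m)) * F (w # us) =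
        stepw g * ((\<Prod>m<n. p \<alpha> \<mu> (us ! m) (us ! Suc m)) * F (w # us))"
        using p_mult[OF Suc.prems gc(1)] by (subst prod.lessThan_Suc_shift) simp
    qed
    also have "\<dots> = stepw g * pathE n (w \<diamond> g) (\<lambda>ws. F (w # ws))"
      using Suc.IH[OF gc(2)] by (simp add: sum_distrib_left)
    finally show "(\<Sum>ws\<in>(#) w ` paths n (w \<diamond> g). (\<Prod>m<Suc n. p \<alpha> \<mu> (ws ! m) (ws ! Suc m)) * F ws) =
      stepw g * pathE n (w \<diamond> g) (\<lambda>ws. F (w # ws))" .
  qed
  finally show ?case by simp
qed simp

lemma pathE_add: "pathE n w (\<lambda>ws. F ws + F' ws) = pathE n w F + pathE n w F'"
  by (induction n arbitrary: w F F') (auto simp: sum.distrib distrib_left)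

lemma pathE_const: "pathE n w (\<lambda>ws. c) = c"
  by (induction n arbitrary: w) (auto simp: sum_distrib_right[symmetric] stepw_sum)

lemma pathE_cong:
  "(\<And>ws. length ws = Suc n \<Longrightarrow> ws ! 0 = w \<Longrightarrow> F ws = F' ws) \<Longrightarrow> pathE n w F = pathE n w F'"
proof (induction n arbitrary: w F F')
  case (Suc n)
  have "pathE n (w \<diamond> g) (\<lambda>ws. F (w # ws)) = pathE n (w \<diamond> g) (\<lambda>ws. F' (w # ws))" for g
    by (rule Suc.IH) (simp add: Suc.prems)
  then show ?case by simp
qed simp

lemma pathE_mult: "pathE n w (\<lambda>ws. c * F ws) = c * pathE n w F"
  by (induction n arbitrary: w F) (auto simp: sum_distrib_left mult.left_commute)

text \<open>Only an inequality, because \<open>paths\<close> lists just the paths with steps in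
  \<open>gens\<close>; other paths are simply left out of the union.\<close>

lemma pathE_le_prob:
  assumes w: "w \<in> carrier G"
  shows "pathE n w (\<lambda>ws. of_bool (\<psi> ws)) \<le> \<P>(\<omega> in P w. \<psi> (path n \<omega>))"
proof -
  interpret P: prob_space "P w" using prob_P w .
  let ?S = "{ws \<in> paths n w. \<psi> ws}"
  have ev: "{\<omega> \<in> space (P w). path n \<omega> = ws} \<in> P.events" for ws
    using measurable_path[OF w, of "\<lambda>us. us = ws" n] by simp
  have "pathE n w (\<lambda>ws. of_bool (\<psi> ws)) = (\<Sum>ws\<in>?S. \<Prod>m<n. p \<alpha> \<mu> (ws ! m) (ws ! Suc m))"
    unfolding pathE_sum[OF w] using finite_paths by (auto simp: sum.If_cases of_bool_def Int_def if_distrib cong: if_cong)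
  also have "\<dots> = (\<Sum>ws\<in>?S. P.prob {\<omega> \<in> space (P w). path n \<omega> = ws})"
  proof (rule sum.cong[OF HOL.refl])
    fix ws assume "ws \<in> ?S"
    then have ws: "length ws = Suc n" "ws ! 0 = w" "set ws \<subseteq> carrier G" using paths_props[OF w, of ws n] by auto
    then have c: "ws ! m \<in> carrier G" if "m \<le> n" for m using that by (metis le_imp_less_Suc nth_mem subsetD)
    show "(\<Prod>m<n. p \<alpha> \<mu> (ws ! m) (ws ! Suc m)) = P.prob {\<omega> \<in> space (P w). path n \<omega> = ws}"
      unfolding path_eq_iff[OF ws(1)] using law_X[OF w, of n "(!) ws"] c ws by simp
  qed
  also have "\<dots> = P.prob (\<Union>ws\<in>?S. {\<omega> \<in> space (P w). path n \<omega> = ws})"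
    by (rule P.finite_measure_finite_Union[symmetric]) (use finite_paths ev in \<open>auto simp: disjoint_family_on_def\<close>)
  also have "\<dots> \<le> \<P>(\<omega> in P w. \<psi> (path n \<omega>))"
    by (rule P.finite_measure_mono) (use measurable_path[OF w, of \<psi> n] in auto)
  finally show ?thesis .
qed

text \<open>The lower bound holds for \<open>\<psi>\<close> and for its negation. Both sides add up
  to 1, so both bounds are equalities, with no separate argument for paths that leave
  \<open>gens\<close>.\<close>

lemma prob_pathE:
  assumes w: "w \<in> carrier G"
  shows "\<P>(\<omega> in P w. \<psi> (path n \<omega>)) = pathE n w (\<lambda>ws. of_bool (\<psi> ws))"
proof -
  interpret P: prob_space "P w" using prob_P w .
  have "pathE n w (\<lambda>ws. of_bool (\<psi> ws)) + pathE n w (\<lambda>ws. of_bool (\<not> \<psi> ws)) = pathE n w (\<lambda>_. 1)"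
    unfolding pathE_add[symmetric] by (rule pathE_cong) auto
  then have "pathE n w (\<lambda>ws. of_bool (\<psi> ws)) + pathE n w (\<lambda>ws. of_bool (\<not> \<psi> ws)) = 1"
    by (simp add: pathE_const)
  moreover have "\<P>(\<omega> in P w. \<not> \<psi> (path n \<omega>)) = 1 - \<P>(\<omega> in P w. \<psi> (path n \<omega>))"
    using measurable_path[OF w, of \<psi> n] by (intro P.prob_neg) simp
  ultimately show ?thesis using pathE_le_prob[OF w, of n \<psi>] pathE_le_prob[OF w, of n "\<lambda>ws. \<not> \<psi> ws"] by linarith
qed

text \<open>
  \<open>taboo A n a b\<close> constrains the path at times \<open>1, \<dots>, n\<close> only, and \<open>stay A n a\<close> at times \<open>0, \<dots>, n\<close>.
\<close>

primrec taboo :: "'a amalg set \<Rightarrow> nat \<Rightarrow> 'a amalg \<Rightarrow> 'a amalg \<Rightarrow> real" where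
  "taboo A 0 a b = of_bool (a = b)"
| "taboo A (Suc n) a b = (\<Sum>g\<in>gens. stepw g * (of_bool (a \<diamond> g \<in> A) * taboo A n (a \<diamond> g) b))"

primrec stay :: "'a amalg set \<Rightarrow> nat \<Rightarrow> 'a amalg \<Rightarrow> real" where
  "stay A 0 a = of_bool (a \<in> A)"
| "stay A (Suc n) a = of_bool (a \<in> A) * (\<Sum>g\<in>gens. stepw g * stay A n (a \<diamond> g))"

lemma all_Icc_Suc: "(\<forall>j\<in>{1..Suc n}. B j) \<longleftrightarrow> B 1 \<and> (\<forall>j\<in>{1..n}. B (Suc j))"
proof -
  have "{1..Suc n} = insert 1 (Suc ` {1..n})" by (auto simp: image_Suc_atLeastAtMost)
  then show ?thesis unfolding \<open>{1..Suc n} = _\<close> by blast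
qed

lemma all_le_Suc: "(\<forall>j\<le>Suc n. B j) \<longleftrightarrow> B 0 \<and> (\<forall>j\<le>n. B (Suc j))"
  by (simp add: All_less_Suc2 flip: less_Suc_eq_le)

lemma all_Icc_Suc_le: "(\<forall>j\<in>{1..Suc n}. B j) \<longleftrightarrow> (\<forall>j\<le>n. B (Suc j))"
  unfolding image_Suc_atMost[symmetric] by blast

text \<open>The Markov property at the fixed time \<open>n\<close>: the past contributes a taboo
  probability, and \<open>F\<close> sees the path from time \<open>n\<close> on as a fresh path from
  \<open>b\<close>.\<close>

lemma pathE_Markov:
  "pathE (n + N) a (\<lambda>ws. of_bool (\<forall>j\<in>{1..n}. ws ! j \<in> A) * (of_bool (ws ! n = b) * F (drop n ws))) =
    taboo A n a b * pathE N b F"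
proof (induction n arbitrary: a)
  case 0
  have "pathE N a (\<lambda>ws. of_bool (ws ! 0 = b) * F ws) = pathE N a (\<lambda>ws. of_bool (a = b) * F ws)"
    by (rule pathE_cong) simp
  then show ?case by (auto simp: pathE_mult)
next
  case (Suc n)
  have "pathE (n + N) (a \<diamond> g) (\<lambda>ws. of_bool (\<forall>j\<in>{1..Suc n}. (a # ws) ! j \<in> A) *
      (of_bool ((a # ws) ! Suc n = b) * F (drop (Suc n) (a # ws)))) =
    pathE (n + N) (a \<diamond> g) (\<lambda>ws. of_bool (a \<diamond> g \<in> A) * (of_bool (\<forall>j\<in>{1..n}. ws ! j \<in> A) *
      (of_bool (ws ! n = b) * F (drop n ws))))" for g
    by (rule pathE_cong) (unfold all_Icc_Suc, simp)
  then show ?case by (simp add: pathE_mult Suc.IH sum_distrib_right mult.assoc del: One_nat_def)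
qed

lemma pathE_stay: "pathE n a (\<lambda>ws. of_bool (\<forall>j\<le>n. ws ! j \<in> A)) = stay A n a"
proof (induction n arbitrary: a)
  case (Suc n)
  have "pathE n (a \<diamond> g) (\<lambda>ws. of_bool (\<forall>j\<le>Suc n. (a # ws) ! j \<in> A)) =
    pathE n (a \<diamond> g) (\<lambda>ws. of_bool (a \<in> A) * of_bool (\<forall>j\<le>n. ws ! j \<in> A))" for g
    by (rule pathE_cong) (unfold all_le_Suc, simp)
  then show ?case by (simp add: pathE_mult Suc.IH sum_distrib_left mult.left_commute)
qed simp

lemma pathE_stay_pos: "pathE (Suc n) a (\<lambda>ws. of_bool (\<forall>j\<in>{1..Suc n}. ws ! j \<in> A)) = (\<Sum>g\<in>gens.
    stepw g * stay A n (a \<diamond> g))"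
proof -
  have "pathE n (a \<diamond> g) (\<lambda>ws. of_bool (\<forall>j\<in>{1..Suc n}. (a # ws) ! j \<in> A)) = stay A n (a \<diamond> g)" for g
    unfolding pathE_stay[symmetric]
    by (rule pathE_cong) (unfold all_Icc_Suc_le, simp)
  then show ?thesis by simp
qed

section \<open>Taboo probabilities\<close>

lemma taboo_nonneg: "0 \<le> taboo A n a b"
  by (induction n arbitrary: a) (auto intro!: sum_nonneg mult_nonneg_nonneg stepw_nonneg)

lemma stay_nonneg: "0 \<le> stay A n a"
  by (induction n arbitrary: a) (auto intro!: sum_nonneg mult_nonneg_nonneg stepw_nonneg)

lemma sum_stepw_le:
  assumes "\<And>g. g \<in> gens \<Longrightarrow> F g \<le> c"
  shows "(\<Sum>g\<in>gens. stepw g * F g) \<le> c"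
proof -
  have "(\<Sum>g\<in>gens. stepw g * F g) \<le> (\<Sum>g\<in>gens. stepw g * c)"
    using assms by (intro sum_mono mult_left_mono stepw_nonneg)
  then show ?thesis by (simp add: sum_distrib_right[symmetric] stepw_sum)
qed

lemma stay_le_1: "stay A n a \<le> 1"
  by (induction n arbitrary: a) (auto intro: sum_stepw_le)

lemma stay_Suc_le: "stay A (Suc n) a \<le> stay A n a"
proof (induction n arbitrary: a)
  case 0
  then show ?case using sum_stepw_le[of "\<lambda>g. of_bool (a \<diamond> g \<in> A)" 1] by auto
next
  case (Suc n)
  then show ?case by (auto intro!: sum_mono mult_left_mono stepw_nonneg simp del: stay.simps(2) simp: stay.simps(2)[of A "Suc n"]
      stay.simps(2)[of A n a])
qed

lemma stay_antimono: "m \<le> n \<Longrightarrow> stay A n a \<le> stay A m a"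
  using lift_Suc_antimono_le[of "\<lambda>n. stay A n a"] stay_Suc_le by blast

lemma stay_notin: "a \<notin> A \<Longrightarrow> stay A n a = 0"
  by (cases n) auto

text \<open>Left translation commutes with right steps, so only the two constraint sets have to
  correspond. They need to do so merely on \<open>D\<close>, and \<open>D\<close> has to be closed
  only under steps from points of \<open>A\<close>, since nothing is counted after \<open>A\<close>
  has been left.\<close>

lemma stay_translate:
  assumes "\<And>a. a \<in> D \<Longrightarrow> a \<in> A \<longleftrightarrow> v \<diamond> a \<in> A'"
    and "\<And>a g. a \<in> D \<Longrightarrow> a \<in> A \<Longrightarrow> g \<in> gens \<Longrightarrow> a \<diamond> g \<in> D"
    and "D \<subseteq> carrier G" "v \<in> carrier G" "a \<in> D"
  shows "stay A' n (v \<diamond> a) = stay A n a"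
  using assms(5)
proof (induction n arbitrary: a)
  case 0
  then show ?case using assms(1) by simp
next
  case (Suc n)
  show ?case
  proof (cases "a \<in> A")
    case True
    then have "stay A' n (v \<diamond> a \<diamond> g) = stay A n (a \<diamond> g)" if "g \<in> gens" for g
      using Suc.IH[OF assms(2)[OF Suc.prems True that]] Suc.prems assms(3,4) gens_carrier[OF that]
      by (auto simp: GG.m_assoc)
    then show ?thesis using True assms(1)[OF Suc.prems] by simp
  next
    case False
    then show ?thesis using assms(1)[OF Suc.prems] by simp
  qed
qed

lemma taboo_translate:
  assumes "\<And>a. a \<in> D \<Longrightarrow> a \<in> A \<longleftrightarrow> v \<diamond> a \<in> A'"
    and "\<And>a g. a \<in> D \<Longrightarrow> a \<in> A \<Longrightarrow> g \<in> gens \<Longrightarrow> a \<diamond> g \<in> D"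
    and "D \<subseteq> carrier G" "v \<in> carrier G" "b \<in> carrier G" "a \<in> D" "a \<in> A"
  shows "taboo A' n (v \<diamond> a) (v \<diamond> b) = taboo A n a b"
  using assms(6,7)
proof (induction n arbitrary: a)
  case 0
  then show ?case using assms(3,4,5) by auto
next
  case (Suc n)
  have "of_bool (v \<diamond> a \<diamond> g \<in> A') * taboo A' n (v \<diamond> a \<diamond> g) (v \<diamond> b) =
    of_bool (a \<diamond> g \<in> A) * taboo A n (a \<diamond> g) b" if "g \<in> gens" for g
  proof -
    have d: "a \<diamond> g \<in> D" using assms(2) Suc.prems that by blast
    have "v \<diamond> a \<diamond> g = v \<diamond> (a \<diamond> g)"
      using Suc.prems assms(3,4) gens_carrier[OF that] by (auto simp: GG.m_assoc)
    then show ?thesis using Suc.IH[OF d] assms(1)[OF d] by auto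
  qed
  then show ?case by simp
qed

lemma taboo_confined:
  assumes "\<And>a g. a \<in> D \<Longrightarrow> g \<in> gens \<Longrightarrow> a \<diamond> g \<in> A \<Longrightarrow> a \<diamond> g \<in> D"
    and "a \<in> D" "b \<notin> D"
  shows "taboo A n a b = 0"
  using assms(2)
proof (induction n arbitrary: a)
  case (Suc n)
  then show ?case using assms(1)[OF Suc.prems] by (auto intro!: sum.neutral)
qed (use assms(3) in auto)

abbreviation pn :: "nat \<Rightarrow> 'a amalg \<Rightarrow> 'a amalg \<Rightarrow> real" where
  "pn \<equiv> taboo UNIV"

lemma pn_translate:
  "v \<in> carrier G \<Longrightarrow> a \<in> carrier G \<Longrightarrow> b \<in> carrier G \<Longrightarrow> pn n (v \<diamond>
      a) (v \<diamond> b) = pn n a b"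
  by (rule taboo_translate[where D = "carrier G"]) (auto simp: gens_carrier)

lemma pn_to_one:
  assumes "a \<in> carrier G" "b \<in> carrier G"
  shows "pn n a b = pn n (inv\<^bsub>G\<^esub> b \<diamond> a) \<one>\<^bsub>G\<^esub>"
  using pn_translate[of "inv\<^bsub>G\<^esub> b" a b n] assms by simp

lemma prob_taboo:
  assumes "a \<in> carrier G"
  shows "\<P>(\<omega> in P a. (\<forall>j\<in>{1..n}. X j \<omega> \<in> A) \<and> X n \<omega> = b) = taboo A n a b"
proof -
  have "\<P>(\<omega> in P a. (\<forall>j\<in>{1..n}. X j \<omega> \<in> A) \<and> X n \<omega> = b) =
    \<P>(\<omega> in P a. (\<forall>j\<in>{1..n}. path n \<omega> ! j \<in> A) \<and> path n \<omega> ! n = b)"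
    by (intro arg_cong[where f = "measure (P a)"] Collect_cong) auto
  also have "\<dots> = pathE n a (\<lambda>ws. of_bool ((\<forall>j\<in>{1..n}. ws ! j \<in> A) \<and> ws ! n = b))" by (rule prob_pathE[OF assms])
  also have "\<dots> = pathE (n + 0) a (\<lambda>ws. of_bool (\<forall>j\<in>{1..n}. ws ! j \<in> A) * (of_bool (ws ! n = b) * 1))"
    by (simp add: of_bool_conj)
  also have "\<dots> = taboo A n a b" by (subst pathE_Markov) simp
  finally show ?thesis .
qed

lemma prob_pn: "a \<in> carrier G \<Longrightarrow> \<P>(\<omega> in P a. X n \<omega> = b) = pn n a b"
  using prob_taboo[of a n UNIV b] by simp

lemma prob_stay:
  assumes "a \<in> carrier G"
  shows "\<P>(\<omega> in P a. \<forall>j\<le>n. X j \<omega> \<in> A) = stay A n a"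
proof -
  have "\<P>(\<omega> in P a. \<forall>j\<le>n. X j \<omega> \<in> A) = \<P>(\<omega> in P a. \<forall>j\<le>n. path n \<omega> ! j \<in> A)"
    by (intro arg_cong[where f = "measure (P a)"] Collect_cong) auto
  then show ?thesis using prob_pathE[OF assms, of "\<lambda>ws. \<forall>j\<le>n. ws ! j \<in> A" n] by (simp add: pathE_stay)
qed

section \<open>Powers of the transition operator and truncated Green functions\<close>

primrec iter :: "nat \<Rightarrow> ('a amalg \<Rightarrow> real) \<Rightarrow> 'a amalg \<Rightarrow> real" where
  "iter 0 f a = f a"
| "iter (Suc n) f a = (\<Sum>g\<in>gens. stepw g * iter n f (a \<diamond> g))"

lemma iter_Suc': "iter (Suc n) f a = iter n (\<lambda>x. \<Sum>g\<in>gens. stepw g * f (x \<diamond> g)) a"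
  by (induction n arbitrary: a) simp_all

lemma iter_mono:
  "(\<And>x. x \<in> carrier G \<Longrightarrow> f x \<le> f' x) \<Longrightarrow> a \<in> carrier G \<Longrightarrow> iter n f a \<le> iter n f' a"
  by (induction n arbitrary: a) (auto intro!: sum_mono mult_left_mono stepw_nonneg simp: gens_carrier)

lemma iter_add: "iter n (\<lambda>x. f x + f' x) a = iter n f a + iter n f' a"
  by (induction n arbitrary: a) (auto simp: distrib_left sum.distrib)

lemma iter_cmult: "iter n (\<lambda>x. c * f x) a = c * iter n f a"
  by (induction n arbitrary: a) (auto simp: sum_distrib_left mult.left_commute)

lemma iter_const: "iter n (\<lambda>x. c) a = c"
  by (induction n arbitrary: a) (auto simp: sum_distrib_right[symmetric] stepw_sum)

lemma iter_pn: "iter n (\<lambda>x. of_bool (x = b)) a = pn n a b"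
  by (induction n arbitrary: a) auto

lemma pn_step_pos:
  assumes "0 < pn n a x" "0 < stepw g" "a \<in> carrier G" "x \<in> carrier G"
  shows "0 < pn (Suc n) a (x \<diamond> g)"
proof -
  have g: "g \<in> gens" using assms stepw_outside[of g] by auto
  have "iter n (\<lambda>y. stepw g * of_bool (y = x)) a \<le>
    iter n (\<lambda>y. \<Sum>g'\<in>gens. stepw g' * of_bool (y \<diamond> g' = x \<diamond> g)) a"
  proof (rule iter_mono)
    fix y
    show "stepw g * of_bool (y = x) \<le> (\<Sum>g'\<in>gens. stepw g' * of_bool (y \<diamond> g' = x \<diamond> g))"
      by (rule order_trans[OF _ member_le_sum[OF g]]) (auto simp: stepw_nonneg finite_gens)
  qed (use assms in auto)
  also have "\<dots> = pn (Suc n) a (x \<diamond> g)"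
    unfolding iter_pn[symmetric, of "Suc n"] by (rule iter_Suc'[symmetric])
  finally have "stepw g * pn n a x \<le> pn (Suc n) a (x \<diamond> g)" unfolding iter_cmult iter_pn .
  then show ?thesis using assms by (metis less_le_trans mult_pos_pos)
qed

text \<open>Expected number of visits to the identity up to time \<open>N\<close>. It is finite for
  every walk; transience enters only in \<open>gr_bounded\<close>.\<close>

definition gr :: "nat \<Rightarrow> 'a amalg \<Rightarrow> real" where
  "gr N a = (\<Sum>n\<le>N. pn n a \<one>\<^bsub>G\<^esub>)"

lemma gr_Suc: "gr (Suc N) a = of_bool (a = \<one>\<^bsub>G\<^esub>) + (\<Sum>g\<in>gens. stepw g * gr N (a \<diamond> g))"
proof -
  have "gr (Suc N) a = of_bool (a = \<one>\<^bsub>G\<^esub>) + (\<Sum>n\<le>N. pn (Suc n) a \<one>\<^bsub>G\<^esub>)"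
    unfolding gr_def by (subst sum.atMost_Suc_shift) simp
  also have "(\<Sum>n\<le>N. pn (Suc n) a \<one>\<^bsub>G\<^esub>) = (\<Sum>g\<in>gens. stepw g * gr N (a \<diamond> g))"
    unfolding gr_def sum_distrib_left by (simp add: sum.swap[of _ gens])
  finally show ?thesis .
qed

lemma gr_mono: "m \<le> n \<Longrightarrow> gr m a \<le> gr n a"
  unfolding gr_def by (rule sum_mono2) (auto simp: taboo_nonneg)

lemma gr_nonneg: "0 \<le> gr n a"
  unfolding gr_def by (rule sum_nonneg) (auto simp: taboo_nonneg)

text \<open>As \<open>A\<close> omits the identity, no visit is counted before \<open>A\<close> is
  left, and afterwards at most \<open>Mx\<close> visits are expected; the factor is the probability
  of leaving \<open>A\<close> within \<open>N\<close> steps. Each step uses up one unit of the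
  horizon, hence the bound on the boundary for all \<open>n \<le> N\<close>. The set
  \<open>D\<close> records which points can be met at all.\<close>

lemma gr_max_principle:
  assumes D: "\<And>a g. a \<in> D \<Longrightarrow> a \<in> A \<Longrightarrow> 0 < stepw g \<Longrightarrow> a \<diamond> g \<in> D"
    and A: "\<one>\<^bsub>G\<^esub> \<notin> A"
    and B: "\<And>b n. b \<in> D \<Longrightarrow> b \<notin> A \<Longrightarrow> n \<le> N \<Longrightarrow> gr n b \<le> Mx" "0 \<le> Mx"
    and "a \<in> D"
  shows "gr N a \<le> Mx * (1 - stay A N a)"
proof -
  have "gr n a \<le> Mx * (1 - stay A n a)" if "n \<le> N" "a \<in> D" for n
    using that
  proof (induction n arbitrary: a)
    case 0
    show ?case
    proof (cases "a \<in> A")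
      case True
      then show ?thesis using A by (auto simp: gr_def)
    next
      case False
      then show ?thesis using B(1)[of a 0] 0 by simp
    qed
  next
    case (Suc n)
    show ?case
    proof (cases "a \<in> A")
      case True
      have "stepw g * gr n (a \<diamond> g) \<le> stepw g * (Mx * (1 - stay A n (a \<diamond> g)))" for g
      proof (cases "0 < stepw g")
        case pos: True
        then show ?thesis using Suc.IH[OF _ D[OF Suc.prems(2) True pos]] Suc.prems by simp
      next
        case False
        then have "stepw g = 0" using stepw_nonneg[of g] by simp
        then show ?thesis by simp
      qed
      then have "(\<Sum>g\<in>gens. stepw g * gr n (a \<diamond> g)) \<le> (\<Sum>g\<in>gens. stepw g * (Mx * (1 - stay A n (a \<diamond> g))))"
        by (rule sum_mono)
      also have "\<dots> = Mx * ((\<Sum>g\<in>gens. stepw g) - (\<Sum>g\<in>gens. stepw g * stay A n (a \<diamond> g)))"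
        by (simp add: sum_subtractf sum_distrib_left algebra_simps)
      finally show ?thesis using True A by (auto simp: gr_Suc stepw_sum)
    next
      case False
      then show ?thesis using B Suc.prems by (simp add: stay_notin)
    qed
  qed
  then show ?thesis using assms by blast
qed

section \<open>Escape probabilities\<close>

lemma coset_cases:
  assumes "w \<in> carrier G"
  obtains v h where "v \<in> reps (length (word w))" "h \<in> HH" "w = v \<diamond> h" "ltype v = ltype w"
proof -
  have "w \<in> (\<lambda>(v, h). v \<diamond> h) ` (reps (length (word w)) \<times> HH)"
    using bij_betw_imp_surj_on[OF sphere_decomp_HH[of "length (word w)"]] assms by blast
  then obtain v h where *: "v \<in> reps (length (word w))" "h \<in> HH" "w = v \<diamond> h" by auto
  then have "ltype v = ltype w" using V_mult_HH(3)[OF *(1,2)] by (simp add: ltype_def)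
  with * show ?thesis by (rule that)
qed

lemma sum_stepw_compl: "(\<Sum>g\<in>gens. stepw g * (c * (1 - F g))) = c * (1 - (\<Sum>g\<in>gens. stepw g * F g))"
proof -
  have "(\<Sum>g\<in>gens. stepw g * (c * (1 - F g))) = (\<Sum>g\<in>gens. stepw g) * c - c * (\<Sum>g\<in>gens. stepw g * F g)"
    unfolding sum_distrib_left sum_distrib_right sum_subtractf[symmetric]
    by (rule sum.cong) (auto simp: algebra_simps)
  then show ?thesis by (simp add: stepw_sum algebra_simps)
qed

text \<open>The probability of never visiting \<open>HH\<close>, as the decreasing limit of
  finite-horizon probabilities; \<open>cone 0\<close> is the complement of
  \<open>HH\<close>.\<close>

definition esc :: "'a amalg \<Rightarrow> real" where
  "esc a = lim (\<lambda>n. stay (cone 0) n a)"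

lemma esc_lim: "(\<lambda>n. stay (cone 0) n a) \<longlonglongrightarrow> esc a"
  and esc_le: "esc a \<le> stay (cone 0) n a"
proof -
  have "decseq (\<lambda>n. stay (cone 0) n a)" using stay_antimono by (auto simp: decseq_def)
  then obtain L where L: "(\<lambda>n. stay (cone 0) n a) \<longlonglongrightarrow> L" "\<forall>i. L \<le> stay (cone 0) i a"
    using decseq_convergent[of _ 0] stay_nonneg by metis
  then have "esc a = L" unfolding esc_def by (simp add: limI)
  then show "(\<lambda>n. stay (cone 0) n a) \<longlonglongrightarrow> esc a" "esc a \<le> stay (cone 0) n a" using L by auto
qed

lemma esc_ge: "(\<And>n. c \<le> stay (cone 0) n a) \<Longrightarrow> c \<le> esc a"
  using LIMSEQ_le_const[OF esc_lim] by blast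

lemma esc_nonneg: "0 \<le> esc a"
  by (rule esc_ge) (rule stay_nonneg)

lemma esc_HH: "a \<in> HH \<Longrightarrow> esc a = 0"
  using esc_le[of a 0] esc_nonneg[of a] by (auto simp: cone_0)

lemma esc_step: "a \<in> cone 0 \<Longrightarrow> esc a = (\<Sum>g\<in>gens. stepw g * esc (a \<diamond> g))"
proof (rule LIMSEQ_unique)
  assume a: "a \<in> cone 0"
  show "(\<lambda>n. stay (cone 0) (Suc n) a) \<longlonglongrightarrow> esc a" using esc_lim by (rule LIMSEQ_Suc)
  show "(\<lambda>n. stay (cone 0) (Suc n) a) \<longlonglongrightarrow> (\<Sum>g\<in>gens. stepw g * esc (a \<diamond> g))"
    using a by (auto intro!: tendsto_sum tendsto_mult_left esc_lim)
qed

lemma stay_HH_mult: "h \<in> HH \<Longrightarrow> a \<in> carrier G \<Longrightarrow> stay (cone 0) n (h \<diamond> a) = stay (cone 0) n a"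
  by (rule stay_translate[where D = "carrier G"]) (use HH_carrier HH_mult_HH_iff gens_carrier in \<open>auto simp: cone_0\<close>)

lemma esc_HH_mult: "h \<in> HH \<Longrightarrow> a \<in> carrier G \<Longrightarrow> esc (h \<diamond> a) = esc a"
  unfolding esc_def using stay_HH_mult by simp

end

section \<open>Bounds on the Green function from transience\<close>

locale transient_walk = amalgam_walk +
  assumes trans: transient
begin

abbreviation ee :: "'a amalg" where
  "ee \<equiv> \<one>\<^bsub>G\<^esub>"

text \<open>The classical bound by \<open>1 / (1 - F)\<close> with the return probability
  \<open>F\<close>. The maximum principle off the identity reduces every starting point to the
  identity; a first step from there gives
  \<open>gr (Suc N) ee \<le> 1 + gr (Suc N) ee * F\<close>.\<close>

lemma gr_bounded:
  obtains C where "0 \<le> C" "\<And>N a. a \<in> carrier G \<Longrightarrow> gr N a \<le> C"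
proof -
  have e: "ee \<in> carrier G" by simp
  interpret P: prob_space "P ee" using prob_P e .
  define A where "A = carrier G - {ee}"
  define F where "F = \<P>(\<omega> in P ee. \<exists>n\<ge>1. X n \<omega> = ee)"
  have F: "F < 1" using trans by (simp add: transient_def F_def)
  have stay: "1 - F \<le> (\<Sum>g\<in>gens. stepw g * stay A N g)" for N
  proof -
    have "1 - F = \<P>(\<omega> in P ee. \<not> (\<exists>n\<ge>1. X n \<omega> = ee))"
      unfolding F_def using e by (intro P.prob_neg[symmetric]) measurable
    also have "\<dots> \<le> \<P>(\<omega> in P ee. \<forall>j\<in>{1..Suc N}. path (Suc N) \<omega> ! j \<in> A)"
      by (rule P.finite_measure_mono)
        (use X_carrier[OF e] measurable_path[OF e, of "\<lambda>ws. \<forall>j\<in>{1..Suc N}. ws ! j \<in> A"] in \<open>auto simp: A_def\<close>)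
    also have "\<dots> = (\<Sum>g\<in>gens. stepw g * stay A N (ee \<diamond> g))"
      unfolding prob_pathE[OF e, of "\<lambda>ws. \<forall>j\<in>{1..Suc N}. ws ! j \<in> A"] by (rule pathE_stay_pos)
    also have "\<dots> = (\<Sum>g\<in>gens. stepw g * stay A N g)" by (simp add: gens_carrier)
    finally show ?thesis .
  qed
  have le: "gr N a \<le> gr N ee * (1 - stay A N a)" if "a \<in> carrier G" for N a
  proof (rule gr_max_principle[where D = "carrier G"])
    show "a \<diamond> g \<in> carrier G" if "a \<in> carrier G" "0 < stepw g" for a g
      using that gens_carrier[of g] stepw_outside[of g] by auto
    show "gr n b \<le> gr N ee" if "b \<in> carrier G" "b \<notin> A" "n \<le> N" for b n
      using that gr_mono by (auto simp: A_def)
  qed (use that gr_nonneg in \<open>auto simp: A_def\<close>)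
  have b: "gr N ee \<le> 1 / (1 - F)" for N
  proof -
    have "gr (Suc N) ee \<le> 1 + (\<Sum>g\<in>gens. stepw g * (gr (Suc N) ee * (1 - stay A N g)))"
    proof -
      have "stepw g * gr N (ee \<diamond> g) \<le> stepw g * (gr (Suc N) ee * (1 - stay A N g))" if "g \<in> gens" for g
      proof (rule mult_left_mono[OF _ stepw_nonneg])
        have "gr N g \<le> gr N ee * (1 - stay A N g)" using le gens_carrier[OF that] by blast
        also have "\<dots> \<le> gr (Suc N) ee * (1 - stay A N g)"
          by (intro mult_right_mono gr_mono) (auto simp: stay_le_1)
        finally show "gr N (ee \<diamond> g) \<le> gr (Suc N) ee * (1 - stay A N g)" using gens_carrier[OF that] by simp
      qed
      then show ?thesis unfolding gr_Suc[of N ee] by (simp add: sum_mono)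
    qed
    also have "(\<Sum>g\<in>gens. stepw g * (gr (Suc N) ee * (1 - stay A N g))) =
        gr (Suc N) ee * (1 - (\<Sum>g\<in>gens. stepw g * stay A N g))"
      by (rule sum_stepw_compl)
    also have "\<dots> \<le> gr (Suc N) ee * F"
      using stay[of N] by (intro mult_left_mono gr_nonneg) simp
    finally have "gr (Suc N) ee * (1 - F) \<le> 1" by (simp add: algebra_simps)
    then have "gr (Suc N) ee \<le> 1 / (1 - F)" using F by (simp add: pos_le_divide_eq)
    then show ?thesis using gr_mono[of N "Suc N" ee] by simp
  qed
  show ?thesis
  proof
    show "0 \<le> 1 / (1 - F)" using F by simp
    fix N a assume "a \<in> carrier G"
    then have "gr N a \<le> gr N ee * (1 - stay A N a)" by (rule le)
    also have "\<dots> \<le> gr N ee" using stay_nonneg[of A N a] gr_nonneg[of N ee] by (simp add: mult_left_le)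
    also have "\<dots> \<le> 1 / (1 - F)" by (rule b)
    finally show "gr N a \<le> 1 / (1 - F)" .
  qed
qed

definition green :: "'a amalg \<Rightarrow> real" where
  "green a = (\<Sum>n. pn n a ee)"

lemma summable_pn: "a \<in> carrier G \<Longrightarrow> summable (\<lambda>n. pn n a ee)"
proof -
  assume a: "a \<in> carrier G"
  obtain C where C: "0 \<le> C" "\<And>N a. a \<in> carrier G \<Longrightarrow> gr N a \<le> C" using gr_bounded by blast
  show ?thesis
  proof (rule summableI_nonneg_bounded)
    show "(\<Sum>i<n. pn i a ee) \<le> C" for n
    proof -
      have "(\<Sum>i<n. pn i a ee) \<le> gr n a" unfolding gr_def by (rule sum_mono2) (auto simp: taboo_nonneg)
      then show ?thesis using C(2)[OF a, of n] by simp
    qed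
  qed (rule taboo_nonneg)
qed

lemma gr_le_green: "a \<in> carrier G \<Longrightarrow> gr n a \<le> green a"
  unfolding gr_def green_def by (rule sum_le_suminf) (auto simp: summable_pn taboo_nonneg)

lemma green_le: "a \<in> carrier G \<Longrightarrow> (\<And>n. gr n a \<le> c) \<Longrightarrow> green a \<le> c"
  unfolding green_def
proof (rule suminf_le_const)
  fix n assume "\<And>n. gr n a \<le> c"
  moreover have "(\<Sum>i<n. pn i a ee) \<le> gr n a" unfolding gr_def by (rule sum_mono2) (auto simp: taboo_nonneg)
  ultimately show "(\<Sum>i<n. pn i a ee) \<le> c" using order_trans by blast
qed (rule summable_pn)

lemma green_nonneg: "a \<in> carrier G \<Longrightarrow> 0 \<le> green a"
  using gr_le_green gr_nonneg order_trans by blast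

lemma green_step: "a \<in> carrier G \<Longrightarrow> green a = of_bool (a = ee) + (\<Sum>g\<in>gens. stepw g * green (a \<diamond> g))"
proof -
  assume a: "a \<in> carrier G"
  have "green a - pn 0 a ee = (\<Sum>n. pn (Suc n) a ee)"
    unfolding green_def by (rule suminf_split_head[OF summable_pn[OF a], symmetric])
  also have "\<dots> = (\<Sum>n. \<Sum>g\<in>gens. stepw g * pn n (a \<diamond> g) ee)" by simp
  also have "\<dots> = (\<Sum>g\<in>gens. \<Sum>n. stepw g * pn n (a \<diamond> g) ee)"
    by (rule suminf_sum) (use a gens_carrier in \<open>auto intro!: summable_mult summable_pn\<close>)
  also have "\<dots> = (\<Sum>g\<in>gens. stepw g * green (a \<diamond> g))"
    unfolding green_def by (rule sum.cong[OF HOL.refl], rule suminf_mult) (use a gens_carrier in \<open>auto intro!: summable_pn\<close>)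
  finally show ?thesis by simp
qed

lemma green_one: "1 \<le> green ee"
  using gr_le_green[of ee 0] by (simp add: gr_def)

text \<open>Otherwise the expected number of visits to the amalgamated subgroup would be infinite.\<close>

lemma ex_escape: "\<exists>g\<in>FF. 0 < stepw g \<and> 0 < esc g"
proof (rule ccontr)
  assume "\<not> ?thesis"
  then have z: "stepw g * esc g = 0" if "g \<in> gens" for g
    using that esc_nonneg[of g] stepw_nonneg[of g] esc_HH by (fastforce simp: gens_eq)
  \<comment> \<open>The expected number of visits to \<open>HH\<close> from \<open>a\<close>: a
    visit to \<open>h\<close> becomes a visit to the identity after left translation by the inverse
    of \<open>h\<close>.\<close>
  define B where "B a = (\<Sum>h\<in>HH. green (inv\<^bsub>G\<^esub> h \<diamond> a))" for a
  have hc: "inv\<^bsub>G\<^esub> h \<diamond> a \<in> carrier G" if "h \<in> HH" "a \<in> carrier G" for h a using that HH_carrier by simp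
  have B0: "0 \<le> B a" if "a \<in> carrier G" for a unfolding B_def using that hc green_nonneg by (intro sum_nonneg) auto
  have Bs: "B a = of_bool (a \<in> HH) + (\<Sum>g\<in>gens. stepw g * B (a \<diamond> g))" if a: "a \<in> carrier G" for a
  proof -
    have "B a = (\<Sum>h\<in>HH. of_bool (inv\<^bsub>G\<^esub> h \<diamond> a = ee) + (\<Sum>g\<in>gens. stepw g * green
        (inv\<^bsub>G\<^esub> h \<diamond> a \<diamond> g)))"
      unfolding B_def using green_step hc a by simp
    also have "\<dots> = (\<Sum>h\<in>HH. of_bool (h = a)) + (\<Sum>g\<in>gens. stepw g * B (a \<diamond> g))"
    proof -
      have "(inv\<^bsub>G\<^esub> h \<diamond> a = ee) = (h = a)" if "h \<in> HH" for h
        using HH_carrier[OF that] a by (metis GG.inv_solve_left' GG.r_one GG.one_closed GG.m_closed)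
      moreover have "inv\<^bsub>G\<^esub> h \<diamond> a \<diamond> g = inv\<^bsub>G\<^esub> h \<diamond> (a \<diamond> g)" if "h
          \<in> HH" "g \<in> gens" for h g
        using HH_carrier gens_carrier that a by (simp add: GG.m_assoc)
      ultimately show ?thesis
        unfolding B_def sum.distrib sum_distrib_left by (subst sum.swap[of _ gens]) simp
    qed
    also have "(\<Sum>h\<in>HH. of_bool (h = a)) = (of_bool (a \<in> HH) :: real)"
      using finite_HH by (simp add: of_bool_def)
    finally show ?thesis .
  qed
  define \<beta> where "\<beta> = Min (B ` HH)"
  have fin: "finite (B ` HH)" "B ` HH \<noteq> {}" using finite_HH one_HH by auto
  have \<beta>: "\<beta> \<le> B h" if "h \<in> HH" for h unfolding \<beta>_def using fin that by auto
  have \<beta>0: "0 \<le> \<beta>" unfolding \<beta>_def using fin B0 HH_carrier by (subst Min_ge_iff) auto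
  \<comment> \<open>A minimum principle: a path that reaches \<open>HH\<close> within
    \<open>n\<close> steps expects at least \<open>\<beta>\<close> visits from then on.\<close>
  have lower: "\<beta> * (1 - stay (cone 0) n a) \<le> B a" if "a \<in> carrier G" for n a
    using that
  proof (induction n arbitrary: a)
    case 0
    then show ?case using \<beta> B0 by (cases "a \<in> HH") (auto simp: cone_0)
  next
    case (Suc n)
    show ?case
    proof (cases "a \<in> HH")
      case True
      then show ?thesis using \<beta> by (simp add: cone_0)
    next
      case False
      have "\<beta> * (1 - (\<Sum>g\<in>gens. stepw g * stay (cone 0) n (a \<diamond> g))) =
        (\<Sum>g\<in>gens. stepw g * (\<beta> * (1 - stay (cone 0) n (a \<diamond> g))))"
        by (rule sum_stepw_compl[symmetric])
      also have "\<dots> \<le> (\<Sum>g\<in>gens. stepw g * B (a \<diamond> g))"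
        using Suc gens_carrier by (intro sum_mono mult_left_mono stepw_nonneg) auto
      finally show ?thesis using False Suc.prems Bs[of a] by (simp add: cone_0)
    qed
  qed
  have lower': "\<beta> * (1 - esc a) \<le> B a" if "a \<in> carrier G" for a
    by (rule LIMSEQ_le_const2[OF tendsto_mult_left[OF tendsto_diff[OF tendsto_const esc_lim]]])
      (use lower[OF that] in blast)
  \<comment> \<open>If no step escapes, a walk in \<open>HH\<close> returns almost surely, so
    \<open>B h\<close> counts the present visit and at least \<open>\<beta>\<close> further ones. At
    the minimum this is absurd.\<close>
  have "\<beta> + 1 \<le> B h" if h: "h \<in> HH" for h
  proof -
    have "\<beta> = (\<Sum>g\<in>gens. stepw g * (\<beta> * (1 - esc (h \<diamond> g))))"
    proof -
      have "stepw g * (\<beta> * (1 - esc (h \<diamond> g))) = stepw g * \<beta>" if "g \<in> gens" for g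
      proof -
        have "stepw g * (\<beta> * (1 - esc g)) = stepw g * \<beta> - \<beta> * (stepw g * esc g)" by (simp add: algebra_simps)
        then show ?thesis using z[OF that] esc_HH_mult[OF h gens_carrier[OF that]] by simp
      qed
      then have "(\<Sum>g\<in>gens. stepw g * (\<beta> * (1 - esc (h \<diamond> g)))) = (\<Sum>g\<in>gens. stepw g * \<beta>)"
        by (rule sum.cong[OF HOL.refl])
      also have "\<dots> = \<beta>" by (simp add: sum_distrib_right[symmetric] stepw_sum)
      finally show ?thesis by simp
    qed
    also have "\<dots> \<le> (\<Sum>g\<in>gens. stepw g * B (h \<diamond> g))"
      using HH_carrier[OF h] gens_carrier by (intro sum_mono mult_left_mono lower' stepw_nonneg) auto
    finally show ?thesis using Bs[OF HH_carrier[OF h]] h by simp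
  qed
  moreover have "\<beta> \<in> B ` HH" unfolding \<beta>_def using fin by (rule Min_in)
  ultimately show False by force
qed

text \<open>Translation by \<open>v\<close> lengthens every word of the cone by
  \<open>k \<ge> 1\<close> letters, so a path that avoids \<open>HH\<close> is carried to one that
  avoids it. The converse fails, because the translated path may pass through \<open>v HH\<close>;
  hence only an inequality.\<close>

lemma stay_V_mult:
  assumes v: "v \<in> reps k" "1 \<le> k" and a: "a \<in> cone (ltype v) \<union> HH"
  shows "stay (cone 0) n a \<le> stay (cone 0) n (v \<diamond> a)"
  using a
proof (induction n arbitrary: a)
  case (Suc n)
  show ?case
  proof (cases "a \<in> HH")
    case True
    then show ?thesis using stay_nonneg[of "cone 0" "Suc n" "v \<diamond> a"] stay_notin[of a "cone 0" "Suc n"] by (simp add: cone_0)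
  next
    case False
    then have a: "a \<in> cone (ltype v)" "a \<in> carrier G" using Suc.prems cone_carrier by auto
    have vc: "v \<in> carrier G" using v by (simp add: reps_def)
    have "stay (cone 0) n (a \<diamond> g) \<le> stay (cone 0) n (v \<diamond> a \<diamond> g)" if "g \<in> gens" for g
      using Suc.IH[OF cone_step[OF a(1) that]] vc a(2) gens_carrier[OF that] by (simp add: GG.m_assoc)
    moreover have "v \<diamond> a \<in> cone 0" using length_V_mult[OF v(1) Suc.prems] v vc a by (auto simp: cone_0 HH_eq)
    ultimately show ?thesis by (auto intro!: sum_mono mult_left_mono stepw_nonneg sum_nonneg stay_nonneg mult_nonneg_nonneg)
  qed
next
  case 0
  then show ?case using length_V_mult[OF v(1) 0] v by (auto simp: cone_0 HH_eq reps_def)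
qed

text \<open>If the known escaping step \<open>g0\<close> has the forbidden type \<open>i\<close>,
  any possible step \<open>g\<close> of another type followed by \<open>g0\<close> escapes too, so
  \<open>g\<close> itself has positive escape probability. Without such a \<open>g\<close> the walk
  would live in the finite group \<open>Fac i\<close> and could not be transient.\<close>

lemma ex_escape_type: "\<exists>g\<in>FF. 0 < stepw g \<and> 0 < esc g \<and> ltype g \<noteq> i"
proof -
  obtain g0 where g0: "g0 \<in> FF" "0 < stepw g0" "0 < esc g0" using ex_escape by blast
  show ?thesis
  proof (cases "ltype g0 = i")
    case False
    then show ?thesis using g0 by blast
  next
    case True
    show ?thesis
    proof (cases "\<exists>g\<in>FF. 0 < stepw g \<and> ltype g \<noteq> i")
      case ex: True
      then obtain g where g: "g \<in> FF" "0 < stepw g" "ltype g \<noteq> i" by blast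
      have gc: "g \<in> carrier G" "g0 \<in> carrier G" using g g0 FF_carrier by auto
      have "length (word g) = 1" using g by (simp add: FF_eq)
      then obtain v h where v: "v \<in> reps 1" "h \<in> HH" "g = v \<diamond> h" and ty: "ltype v = ltype g"
        using coset_cases[OF gc(1)] by metis
      have s0: "g0 \<in> gens" using g0 by (simp add: gens_eq)
      \<comment> \<open>Writing \<open>g = v h\<close>, the point \<open>g g0\<close> lies in the
        cone below \<open>v\<close>, where escape is at least as likely as from \<open>h g0\<close>,
        hence as from \<open>g0\<close>.\<close>
      have "h \<diamond> g0 \<in> cone (ltype v)"
      proof -
        have "g0 \<in> FacX (ltype g0)" using FacX_ltype[OF ltype_FF] g0 by blast
        then have "h \<diamond> g0 \<in> FacX (ltype g0)" by (rule HH_mult_FacX[OF ltype_FF[OF g0(1)] v(2)])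
        then have "h \<diamond> g0 \<in> FF" using ltype_FF[OF g0(1)] unfolding FF_def by blast
        then show ?thesis using gens_cone[OF HH_mult_gens[OF v(2) s0]] HH_mult_ltype[OF v(2) s0] True g ty by simp
      qed
      then have E: "stay (cone 0) n (h \<diamond> g0) \<le> stay (cone 0) n (v \<diamond> (h \<diamond> g0))" for n
        using stay_V_mult[OF v(1)] by simp
      have vh:  "v \<diamond> (h \<diamond> g0) = g \<diamond> g0"
        using v gc HH_carrier by (simp add: GG.m_assoc reps_def)
      have "esc g0 \<le> stay (cone 0) n (g \<diamond> g0)" for n
        using E[of n] esc_le[of g0 n] unfolding vh stay_HH_mult[OF v(2) gc(2)] by simp
      then have "esc g0 \<le> esc (g \<diamond> g0)" by (rule esc_ge)
      then have "0 < stepw g0 * esc (g \<diamond> g0)" using g0 by simp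
      also have "\<dots> \<le> (\<Sum>g'\<in>gens. stepw g' * esc (g \<diamond> g'))"
        by (rule member_le_sum[OF s0]) (auto simp: stepw_nonneg esc_nonneg finite_gens)
      also have "\<dots> = esc g" by (rule esc_step[symmetric]) (use g in \<open>auto simp: cone_0 FF_eq HH_eq\<close>)
      finally show ?thesis using g by blast
    next
      case False
      \<comment> \<open>Every possible step lies in this finite group. The walk makes
        \<open>N + 1\<close> visits to it up to time \<open>N\<close>, while the bound on the Green
        function allows at most \<open>card ?F * C\<close>.\<close>
      let ?F = "Fac i"
      have i: "i \<in> {1..r}" using True ltype_FF g0 by blast
      have supp: "g \<in> ?F" if "0 < stepw g" for g
        using that False stepw_outside[of g] FacX_ltype[OF i] HH_Fac[OF i] by (fastforce simp: gens_eq FacX_def)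
      have fin: "finite ?F" using finite_factor[OF i] by (simp add: Fac_def)
      have sub: "?F \<subseteq> carrier G" using subgroup.subset[OF Fac_subgroup[OF i]] .
      have one: "(\<Sum>b\<in>?F. pn n a b) = 1" if "a \<in> ?F" for n a
        using that
      proof (induction n arbitrary: a)
        case 0
        then show ?case using fin by (simp add: of_bool_def)
      next
        case (Suc n)
        have "(\<Sum>b\<in>?F. pn (Suc n) a b) = (\<Sum>g\<in>gens. stepw g * (\<Sum>b\<in>?F. pn n (a \<diamond> g) b))"
          by (simp add: sum_distrib_left sum.swap[of _ gens])
        also have "\<dots> = (\<Sum>g\<in>gens. stepw g * 1)"
        proof (rule sum.cong[OF HOL.refl])
          fix g
          show "stepw g * (\<Sum>b\<in>?F. pn n (a \<diamond> g) b) = stepw g * 1"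
            using Suc.IH[of "a \<diamond> g"] subgroup.m_closed[OF Fac_subgroup[OF i] Suc.prems supp] stepw_nonneg[of g]
            by (cases "0 < stepw g") auto
        qed
        finally show ?case by (simp add: stepw_sum)
      qed
      obtain C where C: "0 \<le> C" "\<And>N a. a \<in> carrier G \<Longrightarrow> gr N a \<le> C" using gr_bounded by blast
      have e: "ee \<in> ?F" using subgroup.one_closed[OF Fac_subgroup[OF i]] .
      have "real (Suc N) \<le> real (card ?F) * C" for N
      proof -
        have "real (Suc N) = (\<Sum>n\<le>N. \<Sum>b\<in>?F. pn n ee b)" using one[OF e] by simp
        also have "\<dots> = (\<Sum>b\<in>?F. gr N (inv\<^bsub>G\<^esub> b))"
        proof (subst sum.swap, rule sum.cong[OF HOL.refl])
          fix b assume "b \<in> ?F"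
          then have "b \<in> carrier G" using sub by blast
          then show "(\<Sum>n\<le>N. pn n ee b) = gr N (inv\<^bsub>G\<^esub> b)" unfolding gr_def using pn_to_one[of ee b] by simp
        qed
        also have "\<dots> \<le> (\<Sum>b\<in>?F. C)" using C sub by (intro sum_mono) auto
        finally show ?thesis by simp
      qed
      note le = this
      obtain N where "real (card ?F) * C < real N" using reals_Archimedean2 by blast
      then show ?thesis using le[of N] by simp
    qed
  qed
qed

section \<open>Exponential decay of transition probabilities\<close>

lemma cone_HH_iff: "b \<in> cone i \<union> HH \<Longrightarrow> b \<in> cone 0 \<longleftrightarrow> b \<in> cone i"
  unfolding cone_0 by (auto simp: cone_def HH_eq)

lemma cone_HH_carrier: "cone i \<union> HH \<subseteq> carrier G"
  by (auto simp: cone_def HH_eq)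

text \<open>By Jensen the square root of a superharmonic function is superharmonic, and its loss
  controls how much it varies over the points reached.\<close>

definition sgreen :: "'a amalg \<Rightarrow> real" where
  "sgreen a = sqrt (green a)"

lemma sgreen_sq: "a \<in> carrier G \<Longrightarrow> (sgreen a)\<^sup>2 = green a"
  by (simp add: sgreen_def green_nonneg)

lemma sgreen_nonneg: "a \<in> carrier G \<Longrightarrow> 0 \<le> sgreen a"
  by (simp add: sgreen_def green_nonneg)

lemma iter_green: "a \<in> carrier G \<Longrightarrow> iter n green a \<le> green a"
proof (induction n arbitrary: a)
  case (Suc n)
  have "iter (Suc n) green a \<le> (\<Sum>g\<in>gens. stepw g * green (a \<diamond> g))"
    using Suc by (auto intro!: sum_mono mult_left_mono stepw_nonneg simp: gens_carrier)
  also have "\<dots> \<le> green a" using green_step[OF Suc.prems] by simp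
  finally show ?case .
qed simp

text \<open>With \<open>m\<close> the mean of \<open>sgreen\<close> after one step, nonnegativity of
  the variance gives that the square of \<open>m\<close> is at most the mean of
  \<open>green\<close>, which is at most \<open>green a\<close>.\<close>

lemma sgreen_super:
  assumes a: "a \<in> carrier G"
  shows "(\<Sum>g\<in>gens. stepw g * sgreen (a \<diamond> g)) \<le> sgreen a"
proof (rule power2_le_imp_le)
  define m where "m = (\<Sum>g\<in>gens. stepw g * sgreen (a \<diamond> g))"
  have ag: "a \<diamond> g \<in> carrier G" if "g \<in> gens" for g using a gens_carrier that by simp
  have "0 \<le> (\<Sum>g\<in>gens. stepw g * (sgreen (a \<diamond> g) - m)\<^sup>2)"
    by (intro sum_nonneg mult_nonneg_nonneg stepw_nonneg) simp
  also have "\<dots> = (\<Sum>g\<in>gens. stepw g * (sgreen (a \<diamond> g))\<^sup>2) - 2 * m * (\<Sum>g\<in>gens. stepw g *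
      sgreen (a \<diamond> g)) + (\<Sum>g\<in>gens. stepw g) * m\<^sup>2"
    unfolding sum_distrib_left sum_distrib_right sum.distrib[symmetric] sum_subtractf[symmetric]
    by (rule sum.cong) (auto simp: power2_eq_square algebra_simps)
  also have "(\<Sum>g\<in>gens. stepw g * (sgreen (a \<diamond> g))\<^sup>2) = (\<Sum>g\<in>gens. stepw g * green (a \<diamond> g))"
    by (rule sum.cong) (auto simp: sgreen_sq ag)
  finally have "m\<^sup>2 \<le> (\<Sum>g\<in>gens. stepw g * green (a \<diamond> g))"
    unfolding m_def[symmetric] stepw_sum by (simp add: power2_eq_square)
  also have "\<dots> \<le> green a" using green_step[OF a] by simp
  finally show "(\<Sum>g\<in>gens. stepw g * sgreen (a \<diamond> g))\<^sup>2 \<le> (sgreen a)\<^sup>2"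
    using sgreen_sq[OF a] by (simp add: m_def)
qed (rule sgreen_nonneg[OF a])

lemma iter_sgreen_Suc: "a \<in> carrier G \<Longrightarrow> iter (Suc n) sgreen a \<le> iter n sgreen a"
  unfolding iter_Suc' by (rule iter_mono[OF sgreen_super])

lemma iter_sgreen_antimono: "a \<in> carrier G \<Longrightarrow> m \<le> n \<Longrightarrow> iter n sgreen a \<le> iter m sgreen a"
  using lift_Suc_antimono_le[of "\<lambda>n. iter n sgreen a"] iter_sgreen_Suc by blast

text \<open>One term of the mean of \<open>(sgreen y - sgreen a)\<close> squared after
  \<open>j\<close> steps, expanded and bounded through superharmonicity of \<open>green\<close>. If
  \<open>sgreen\<close> hardly decreases in \<open>j\<close> steps, it is nearly
  \<open>sgreen a\<close> at each point reached with sizeable probability.\<close>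

lemma iter_variance:
  assumes a: "a \<in> carrier G"
  shows "pn j a x * (sgreen x - sgreen a)\<^sup>2 \<le> 2 * green a - 2 * sgreen a * iter j sgreen a"
proof -
  have "(sgreen x - sgreen a)\<^sup>2 * pn j a x = iter j (\<lambda>y. (sgreen x - sgreen a)\<^sup>2 * of_bool (y = x)) a"
    unfolding iter_cmult iter_pn ..
  also have "\<dots> \<le> iter j (\<lambda>y. (green y + (- 2 * sgreen a) * sgreen y) + green a) a"
  proof (rule iter_mono[OF _ a])
    fix y assume y: "y \<in> carrier G"
    have "(sgreen x - sgreen a)\<^sup>2 * of_bool (y = x) \<le> (sgreen y - sgreen a)\<^sup>2" by auto
    also have "\<dots> = (green y + (- 2 * sgreen a) * sgreen y) + green a"
      unfolding sgreen_sq[OF a, symmetric] sgreen_sq[OF y, symmetric] by (simp add: power2_eq_square algebra_simps)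
    finally show "(sgreen x - sgreen a)\<^sup>2 * of_bool (y = x) \<le> (green y + (- 2 * sgreen a) * sgreen y) + green a" .
  qed
  also have "\<dots> = iter j green a - 2 * sgreen a * iter j sgreen a + green a"
    unfolding iter_add iter_cmult iter_const by simp
  also have "\<dots> \<le> 2 * green a - 2 * sgreen a * iter j sgreen a" using iter_green[OF a, of j] by simp
  finally show ?thesis by (simp add: mult.commute)
qed

lemma pn_one_ge: "g \<in> gens \<Longrightarrow> a \<in> carrier G \<Longrightarrow> stepw g \<le> pn 1 a (a \<diamond> g)"
  using member_le_sum[of g gens "\<lambda>g'. stepw g' * of_bool (a \<diamond> g' = a \<diamond> g)"] finite_gens stepw_nonneg by simp

text \<open>
  Where the square root of the Green function were almost constant on a large ball, it could not
  decay across the cone entered by an escaping step.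
\<close>

lemma sgreen_gap:
  obtains N \<delta> where "1 \<le> N" "0 < \<delta>" "\<delta> < 1" "\<And>a. a \<in> carrier G \<Longrightarrow> iter N sgreen a
      \<le> (1 - \<delta>) * sgreen a"
proof -
  \<comment> \<open>Only the part of \<open>HH\<close> that the walk can reach from the identity. It
    gives the boundary points in the maximum principle below, and \<open>N\<close> has to cover a
    time at which each of them is reached.\<close>
  define RH where "RH = {h \<in> HH. \<exists>j. 0 < pn j ee h}"
  have finRH: "finite RH" using finite_HH by (simp add: RH_def)
  have "\<forall>h\<in>RH. \<exists>j. 0 < pn j ee h" by (simp add: RH_def)
  then have "\<exists>J. \<forall>h\<in>RH. 0 < pn (J h) ee h" by (rule bchoice)
  then obtain J where J: "\<And>h. h \<in> RH \<Longrightarrow> 0 < pn (J h) ee h" by blast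
  define N where "N = Max (insert 1 (J ` RH))"
  have N1: "1 \<le> N" unfolding N_def using finRH by (intro Max_ge) auto
  have NJ: "J h \<le> N" if "h \<in> RH" for h unfolding N_def using finRH that by (intro Max_ge) auto
  obtain \<eta> where \<eta>: "0 < \<eta>" "\<eta> \<le> 1" "\<And>h. h \<in> RH \<Longrightarrow> \<eta> \<le> pn (J h) ee h"
      "\<And>g. 0 < stepw g \<Longrightarrow> \<eta> \<le> stepw g"
  proof -
    have fin: "finite ((\<lambda>h. pn (J h) ee h) ` RH \<union> stepw ` {g \<in> gens. 0 < stepw g})" using finRH finite_gens by simp
    obtain c where c: "0 < c" "c \<le> 1" "\<And>x. x \<in> (\<lambda>h. pn (J h) ee h) ` RH \<union> stepw ` {g \<in> gens. 0 <
        stepw g} \<Longrightarrow> c \<le> x"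
      using finite_positive_lower_bound[OF fin] J by blast
    have "c \<le> stepw g" if "0 < stepw g" for g using c(3) that stepw_outside[of g] by force
    then show ?thesis using that c by blast
  qed
  obtain \<epsilon> where \<epsilon>: "0 < \<epsilon>" "\<epsilon> \<le> 1" "\<And>g. g \<in> FF \<Longrightarrow> 0 < esc g
      \<Longrightarrow> \<epsilon> \<le> esc g"
  proof -
    have fin: "finite (esc ` {g \<in> FF. 0 < esc g})" using finite_FF by simp
    obtain c where c: "0 < c" "c \<le> 1" "\<And>x. x \<in> esc ` {g \<in> FF. 0 < esc g} \<Longrightarrow> c \<le> x"
      using finite_positive_lower_bound[OF fin] by blast
    then show ?thesis using that by blast
  qed
  \<comment> \<open>\<open>\<delta>\<close> is chosen so that the variance bound
    \<open>2 * \<delta> * green a\<close>, divided by the least probability \<open>\<eta>\<close>,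
    is the square of \<open>\<kappa> * sgreen a\<close>. With
    \<open>\<epsilon> = 8 * \<kappa>\<close> a relative error \<open>\<kappa>\<close> is too small
    to bridge the escape loss: \<open>(1 + 3 * \<kappa>) * (1 - 8 * \<kappa>)\<close> is below the
    square of \<open>1 - \<kappa>\<close>.\<close>
  define \<kappa> where "\<kappa> = \<epsilon> / 8"
  define \<delta> where "\<delta> = \<kappa>\<^sup>2 * \<eta> / 2"
  have \<kappa>: "0 < \<kappa>" "\<kappa> \<le> 1/8" "\<epsilon> = 8 * \<kappa>" using \<epsilon> by (auto simp: \<kappa>_def)
  have "\<kappa>\<^sup>2 * \<eta> \<le> 1 * 1" using \<kappa> \<eta> by (intro mult_mono power_le_one) auto
  then have \<delta>: "0 < \<delta>" "\<delta> < 1" using \<kappa> \<eta> by (auto simp: \<delta>_def)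
  have "iter N sgreen a \<le> (1 - \<delta>) * sgreen a" if a: "a \<in> carrier G" for a
  proof (rule ccontr)
    assume neg: "\<not> ?thesis"
    have s0: "0 \<le> sgreen a" using sgreen_nonneg a .
    have pos: "0 < sgreen a"
    proof (rule ccontr)
      assume "\<not> 0 < sgreen a"
      then have "sgreen a = 0" using s0 by simp
      then show False using neg iter_sgreen_antimono[OF a, of 0 N] by simp
    qed
    have near: "\<bar>sgreen x - sgreen a\<bar> \<le> \<kappa> * sgreen a" if j: "j \<le> N" and x: "\<eta> \<le> pn j a x" for j x
    proof (rule power2_le_imp_le)
      have "\<eta> * (sgreen x - sgreen a)\<^sup>2 \<le> pn j a x * (sgreen x - sgreen a)\<^sup>2" using x by (intro mult_right_mono) auto
      also have "\<dots> \<le> 2 * green a - 2 * sgreen a * iter j sgreen a" by (rule iter_variance[OF a])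
      also have "\<dots> \<le> 2 * green a - 2 * sgreen a * ((1 - \<delta>) * sgreen a)"
        using neg iter_sgreen_antimono[OF a j] s0 by (intro diff_left_mono mult_left_mono) auto
      also have "\<dots> = 2 * \<delta> * green a" unfolding sgreen_sq[OF a, symmetric] by (simp add: power2_eq_square algebra_simps)
      also have "\<dots> = \<eta> * (\<kappa> * sgreen a)\<^sup>2" using sgreen_sq[OF a] by (simp add: \<delta>_def power_mult_distrib)
      finally show "\<bar>sgreen x - sgreen a\<bar>\<^sup>2 \<le> (\<kappa> * sgreen a)\<^sup>2" using \<eta> by simp
    qed (use \<kappa> s0 in auto)
    obtain v k where v: "v \<in> reps (length (word a))" "k \<in> HH" "a = v \<diamond> k" "ltype v = ltype a"
      using coset_cases[OF a] by blast
    have vc: "v \<in> carrier G" and kc: "k \<in> carrier G" using v by (auto simp: reps_def HH_carrier)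
    obtain g where g: "g \<in> FF" "0 < stepw g" "0 < esc g" "ltype g \<noteq> ltype v" using ex_escape_type by blast
    have gS: "g \<in> gens" and gc: "g \<in> carrier G" using g by (auto simp: gens_eq FF_carrier)
    \<comment> \<open>\<open>A\<close> is the cone below the coset of \<open>a\<close>, and
      \<open>D\<close> adds this coset but keeps only points reachable from \<open>a\<close>. Thus
      the boundary \<open>D - A\<close> consists of reachable points \<open>a h\<close>, to which
      \<open>near\<close> applies.\<close>
    define A where "A = (\<lambda>b. v \<diamond> b) ` cone (ltype v)"
    define D where "D = {x. (\<exists>b\<in>cone (ltype v) \<union> HH. x = v \<diamond> b) \<and> (\<exists>n. 0 < pn n a x)}"
    have inA: "v \<diamond> b \<in> A \<longleftrightarrow> b \<in> cone (ltype v)" if "b \<in> carrier G" for b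
      using that vc cone_carrier by (auto simp: A_def)
    have kg: "k \<diamond> g \<in> cone (ltype v)"
      using gens_cone[OF HH_mult_gens[OF v(2) gS]] HH_mult_ltype[OF v(2) gS] HH_mult_FacX[OF ltype_FF[OF g(1)] v(2), of g]
        FacX_ltype[OF ltype_FF[OF g(1)]] g by auto
    have ag: "a \<diamond> g = v \<diamond> (k \<diamond> g)" using v vc kc gc by (simp add: GG.m_assoc)
    have ac: "a \<diamond> g \<in> carrier G" using a gc by simp
    define Mx where "Mx = ((1 + \<kappa>) * sgreen a)\<^sup>2"
    have bound: "gr n (a \<diamond> g) \<le> Mx * (1 - \<epsilon>)" for n
    proof -
      have "gr n (a \<diamond> g) \<le> Mx * (1 - stay A n (a \<diamond> g))"
      proof (rule gr_max_principle[where D = D])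
        fix x g' assume x: "x \<in> D" "x \<in> A" and g': "0 < stepw g'"
        then obtain b where b: "b \<in> cone (ltype v)" "x = v \<diamond> b" by (auto simp: A_def)
        have g'S: "g' \<in> gens" using g' stepw_outside[of g'] by auto
        have xc: "x \<in> carrier G" using b vc cone_carrier by auto
        have "x \<diamond> g' = v \<diamond> (b \<diamond> g')" using b vc cone_carrier[OF b(1)] gens_carrier[OF g'S] by (simp add: GG.m_assoc)
        moreover obtain n where "0 < pn n a x" using x by (auto simp: D_def)
        then have "\<exists>n. 0 < pn n a (x \<diamond> g')" using pn_step_pos[OF _ g' a xc] by blast
        ultimately show "x \<diamond> g' \<in> D" unfolding D_def using cone_step[OF b(1) g'S] by blast
      next
        show "ee \<notin> A"
        proof
          assume "ee \<in> A"
          then obtain b where "b \<in> cone (ltype v)" "ee = v \<diamond> b" by (auto simp: A_def)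
          then have "length (word ee) = length (word a) + length (word b)" "word b \<noteq> []"
            using length_V_mult[OF v(1), of b] by (auto simp: cone_def)
          then show False by (simp add: word_one)
        qed
      next
        fix x n assume x: "x \<in> D" "x \<notin> A"
        then obtain h' where h': "h' \<in> HH" "x = v \<diamond> h'" by (auto simp: D_def A_def)
        define h where "h = inv\<^bsub>G\<^esub> k \<diamond> h'"
        have hH: "h \<in> HH" unfolding h_def
          by (rule subgroup.m_closed[OF HH_subgroup subgroup.m_inv_closed[OF HH_subgroup v(2)] h'(1)])
        have hc: "h \<in> carrier G" "h' \<in> carrier G" using hH h' HH_carrier by auto
        have xe: "x = a \<diamond> h"
        \<comment> \<open>The boundary point differs from \<open>a\<close> by a right factor in
          \<open>HH\<close>. By left invariance the probabilities of reaching it are those of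
          reaching \<open>h\<close> from the identity, so one choice of \<open>N\<close> and
          \<open>\<eta>\<close> serves all \<open>a\<close>.\<close>
        proof -
          have "k \<diamond> h = h'" using kc hc by (simp add: h_def GG.m_assoc[symmetric])
          then show ?thesis using h' v(3) vc kc hc by (simp add: GG.m_assoc)
        qed
        have tr: "pn n a x = pn n ee h" for n using pn_translate[OF a GG.one_closed hc(1), of n] a by (simp add: xe)
        have "h \<in> RH" using x hH tr by (auto simp: D_def RH_def)
        then have "\<bar>sgreen x - sgreen a\<bar> \<le> \<kappa> * sgreen a" using near[OF NJ] \<eta>(3) tr by simp
        then have "sgreen x \<le> (1 + \<kappa>) * sgreen a" by (simp add: algebra_simps)
        moreover have xc: "x \<in> carrier G" using xe a hc by simp
        ultimately have "(sgreen x)\<^sup>2 \<le> Mx" unfolding Mx_def using sgreen_nonneg by (intro power_mono) auto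
        then show "gr n x \<le> Mx" using gr_le_green[OF xc, of n] sgreen_sq[OF xc] by simp
      next
        show "0 \<le> Mx" by (simp add: Mx_def)
        show "a \<diamond> g \<in> D" unfolding D_def using kg ag pn_one_ge[OF gS a] g(2)
          by (auto intro: exI[of _ 1] less_le_trans)
      qed
      also have "stay A n (a \<diamond> g) = stay (cone 0) n g"
      proof -
        have "stay A n (v \<diamond> (k \<diamond> g)) = stay (cone 0) n (k \<diamond> g)"
        proof (rule stay_translate[where D = "cone (ltype v) \<union> HH"])
          fix b assume b: "b \<in> cone (ltype v) \<union> HH"
          then have "b \<in> carrier G" using cone_HH_carrier by blast
          then show "(b \<in> cone 0) = (v \<diamond> b \<in> A)" using inA[of b] cone_HH_iff[OF b] by simp
        next
          fix b g' assume b: "b \<in> cone (ltype v) \<union> HH" "b \<in> cone 0" "g' \<in> gens"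
          then have "b \<in> cone (ltype v)" using cone_HH_iff by blast
          then show "b \<diamond> g' \<in> cone (ltype v) \<union> HH" using cone_step b(3) by blast
        qed (use vc kg cone_HH_carrier in simp_all)
        then show ?thesis unfolding ag using stay_HH_mult[OF v(2) gc] by simp
      qed
      also have "Mx * (1 - stay (cone 0) n g) \<le> Mx * (1 - \<epsilon>)"
        using \<epsilon>(3)[OF g(1,3)] esc_le[of g n] by (intro mult_left_mono) (auto simp: Mx_def)
      finally show ?thesis .
    qed
    \<comment> \<open>The contradiction: near constancy bounds \<open>green\<close> at
      \<open>a g\<close> from below, while the walk from there comes back to the coset of
      \<open>a\<close> with probability at most \<open>1 - \<epsilon>\<close>, which bounds it from
      above.\<close>
    have "sgreen (a \<diamond> g) \<ge> (1 - \<kappa>) * sgreen a"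
      using near[OF N1, of "a \<diamond> g"] pn_one_ge[OF gS a] \<eta>(4)[OF g(2)] by (simp add: algebra_simps abs_le_iff)
    then have "((1 - \<kappa>) * sgreen a)\<^sup>2 \<le> green (a \<diamond> g)"
      unfolding sgreen_sq[OF ac, symmetric] using \<kappa> s0 by (intro power_mono) auto
    also have "\<dots> \<le> Mx * (1 - \<epsilon>)" by (rule green_le[OF ac bound])
    finally have "(1 - \<kappa>)\<^sup>2 * (sgreen a)\<^sup>2 \<le> ((1 + \<kappa>)\<^sup>2 * (1 - \<epsilon>)) * (sgreen a)\<^sup>2"
      unfolding Mx_def power_mult_distrib by (simp only: mult_ac)
    then have le: "(1 - \<kappa>)\<^sup>2 \<le> (1 + \<kappa>)\<^sup>2 * (1 - \<epsilon>)" using pos by simp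
    have "(1 + \<kappa>)\<^sup>2 * (1 - \<epsilon>) \<le> (1 + 3 * \<kappa>) * (1 - \<epsilon>)"
    proof (rule mult_right_mono)
      have "\<kappa> * \<kappa> \<le> \<kappa> * 1" using \<kappa> by (intro mult_left_mono) auto
      then show "(1 + \<kappa>)\<^sup>2 \<le> 1 + 3 * \<kappa>" by (simp add: power2_eq_square algebra_simps)
    qed (use \<epsilon> in simp)
    also have "\<dots> < (1 - \<kappa>)\<^sup>2" using \<kappa>(1) mult_pos_pos[OF \<kappa>(1) \<kappa>(1)]
      by (simp add: \<kappa>(3) power2_eq_square algebra_simps add_pos_pos)
    finally show False using le by simp
  qed
  then show ?thesis using that[OF N1 \<delta>] by blast
qed

text \<open>\<open>green ee \<ge> 1\<close> puts the indicator of the identity below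
  \<open>sgreen\<close>, and each block of \<open>N\<close> steps multiplies \<open>sgreen\<close>
  by at most \<open>1 - \<delta>\<close>, the \<open>N\<close>-th power of \<open>\<rho>\<close>.
  The division by that power pays for the incomplete last block; \<open>sqrt C\<close> bounds
  \<open>sgreen\<close>, and left invariance handles other targets.\<close>

lemma exp_decay:
  obtains C \<rho> where "0 \<le> C" "0 < \<rho>" "\<rho> < 1" "\<And>n a b. a \<in> carrier G \<Longrightarrow> b \<in> carrier G
      \<Longrightarrow> pn n a b \<le> C * \<rho> ^ n"
proof -
  obtain N \<delta> where N: "1 \<le> N" and \<delta>: "0 < \<delta>" "\<delta> < 1"
    and gap: "\<And>a. a \<in> carrier G \<Longrightarrow> iter N sgreen a \<le> (1 - \<delta>) * sgreen a" using sgreen_gap by blast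
  obtain C where C: "0 \<le> C" "\<And>N a. a \<in> carrier G \<Longrightarrow> gr N a \<le> C" using gr_bounded by blast
  have sC: "sgreen a \<le> sqrt C" if "a \<in> carrier G" for a
    unfolding sgreen_def using green_le[OF that C(2)[OF that]] by simp
  define \<rho> where "\<rho> = root N (1 - \<delta>)"
  have \<rho>: "0 < \<rho>" "\<rho> < 1" "\<rho> ^ N = 1 - \<delta>" using N \<delta> by (auto simp: \<rho>_def)
  have Tadd: "iter (m + n) f a = iter m (iter n f) a" for m n f a
    by (induction m arbitrary: a) auto
  have iter: "iter (N * k) sgreen a \<le> \<rho> ^ (N * k) * sgreen a" if "a \<in> carrier G" for k a
    using that
  proof (induction k arbitrary: a)
    case (Suc k)
    have "iter (N * Suc k) sgreen a = iter (N * k) (iter N sgreen) a" by (simp add: Tadd[symmetric] add.commute)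
    also have "\<dots> \<le> iter (N * k) (\<lambda>x. (1 - \<delta>) * sgreen x) a" by (rule iter_mono[OF gap Suc.prems])
    also have "\<dots> \<le> (1 - \<delta>) * (\<rho> ^ (N * k) * sgreen a)"
      unfolding iter_cmult using Suc \<delta> by (intro mult_left_mono) auto
    also have "\<dots> = \<rho> ^ (N * Suc k) * sgreen a" by (simp add: power_add \<rho>(3))
    finally show ?case .
  qed simp
  have main: "pn n a ee \<le> (sqrt C / \<rho> ^ N) * \<rho> ^ n" if a: "a \<in> carrier G" for n a
  proof -
    have "pn n a ee = iter n (\<lambda>x. of_bool (x = ee)) a" by (simp add: iter_pn)
    also have "\<dots> \<le> iter n sgreen a"
    proof (rule iter_mono[OF _ a])
      fix x assume "x \<in> carrier G"
      then show "of_bool (x = ee) \<le> sgreen x" using green_one sgreen_nonneg by (auto simp: sgreen_def)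
    qed
    also have "\<dots> \<le> iter (N * (n div N)) sgreen a" by (rule iter_sgreen_antimono[OF a]) simp
    also have "\<dots> \<le> \<rho> ^ (N * (n div N)) * sqrt C"
      by (rule order_trans[OF iter[OF a] mult_left_mono[OF sC[OF a]]]) (use \<rho> in simp)
    also have "\<dots> \<le> (\<rho> ^ n / \<rho> ^ N) * sqrt C"
    proof (rule mult_right_mono)
      have "n mod N < N" using N by simp
      then have "n \<ge> N * (n div N) + 0" "n \<le> N * (n div N) + N"
        using mult_div_mod_eq[of N n] by linarith+
      have "\<rho> ^ (N * (n div N)) * \<rho> ^ N = \<rho> ^ (N * (n div N) + N)" by (simp add: power_add)
      also have "\<dots> \<le> \<rho> ^ n" using \<rho> \<open>n \<le> N * (n div N) + N\<close> by (intro power_decreasing) auto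
      finally show "\<rho> ^ (N * (n div N)) \<le> \<rho> ^ n / \<rho> ^ N" using \<rho> \<delta> by (simp add: pos_le_divide_eq)
    qed (use C in simp)
    finally show ?thesis by (simp add: mult.commute)
  qed
  show ?thesis
  proof
    show "0 \<le> sqrt C / \<rho> ^ N" using C \<rho>(1) by (intro divide_nonneg_nonneg) auto
    show "0 < \<rho>" "\<rho> < 1" using \<rho> by auto
    fix n a b assume ab: "a \<in> carrier G" "b \<in> carrier G"
    then show "pn n a b \<le> sqrt C / \<rho> ^ N * \<rho> ^ n"
      unfolding pn_to_one[OF ab, of n] by (intro main) simp
  qed
qed

section \<open>Last exits\<close>

lemma wlen_cone: "w \<in> carrier G \<Longrightarrow> 1 \<le> wlen w \<longleftrightarrow> w \<in> cone 0"
  by (auto simp: wlen_eq cone_0 HH_eq Suc_le_eq)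

lemma prob_Gbar:
  assumes a: "a \<in> cone 0"
  shows "\<P>(\<omega> in P a. X n \<omega> = b \<and> (\<forall>m\<le>n. 1 \<le> wlen (X m \<omega>))) = taboo (cone 0) n a b"
proof -
  have ac: "a \<in> carrier G" using a cone_carrier by blast
  have "\<P>(\<omega> in P a. X n \<omega> = b \<and> (\<forall>m\<le>n. 1 \<le> wlen (X m \<omega>))) =
    \<P>(\<omega> in P a. (\<forall>j\<in>{1..n}. X j \<omega> \<in> cone 0) \<and> X n \<omega> = b)"
  proof (rule measure_eq_AE)
    show "AE \<omega> in P a. (\<omega> \<in> {\<omega> \<in> space (P a). X n \<omega> = b \<and> (\<forall>m\<le>n. 1 \<le> wlen (X m \<omega>))}) =
      (\<omega> \<in> {\<omega> \<in> space (P a). (\<forall>j\<in>{1..n}. X j \<omega> \<in> cone 0) \<and> X n \<omega> = b})"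
      using AE_X0[OF ac] AE_space
    proof eventually_elim
      case (elim \<omega>)
      have "(\<forall>m\<le>n. 1 \<le> wlen (X m \<omega>)) \<longleftrightarrow> (\<forall>m\<le>n. X m \<omega> \<in> cone 0)"
        using wlen_cone X_carrier[OF ac elim(2)] by blast
      also have "\<dots> \<longleftrightarrow> (\<forall>j\<in>{1..n}. X j \<omega> \<in> cone 0)"
      proof
        assume *: "\<forall>j\<in>{1..n}. X j \<omega> \<in> cone 0"
        show "\<forall>m\<le>n. X m \<omega> \<in> cone 0"
        proof (intro allI impI)
          fix m assume "m \<le> n"
          then show "X m \<omega> \<in> cone 0" using * elim(1) a by (cases m) auto
        qed
      qed auto
      finally show ?case by auto
    qed
  qed (use ac in measurable)
  then show ?thesis using prob_taboo[OF ac] by simp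
qed

lemma Gbar_eq: "a \<in> cone 0 \<Longrightarrow> Gbar a b z = (\<Sum>n. taboo (cone 0) n a b * z ^ n)"
  unfolding Gbar_def using prob_Gbar by simp

text \<open>Hitting \<open>HH\<close> for the first time at time \<open>n + 1\<close> has
  probability \<open>stay (cone 0) n g - stay (cone 0) (Suc n) g\<close>, so the series
  telescopes.\<close>

lemma esc_Hgen:
  assumes g: "g \<in> cone 0"
  shows "1 - (\<Sum>h\<in>HH. Hgen g h 1) = esc g"
proof -
  have gc: "g \<in> carrier G" using g cone_carrier by blast
  interpret P: prob_space "P g" using prob_P gc .
  define q where "q h n = \<P>(\<omega> in P g. X (Suc n) \<omega> = h \<and> (\<forall>m<Suc n. 1 \<le> wlen (X m \<omega>)))" for h n
  have step: "(\<Sum>h\<in>HH. q h n) = stay (cone 0) n g - stay (cone 0) (Suc n) g" for n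
  proof -
    have ev: "{\<omega> \<in> space (P g). X (Suc n) \<omega> = h \<and> (\<forall>m<Suc n. 1 \<le> wlen (X m \<omega>))} \<in> P.events" for h
      using gc by measurable
    have "(\<Sum>h\<in>HH. q h n) = P.prob (\<Union>h\<in>HH. {\<omega> \<in> space (P g). X (Suc n) \<omega> = h \<and>
        (\<forall>m<Suc n. 1 \<le> wlen (X m \<omega>))})"
      unfolding q_def by (rule P.finite_measure_finite_Union[symmetric])
        (use finite_HH ev in \<open>auto simp: disjoint_family_on_def\<close>)
    also have "(\<Union>h\<in>HH. {\<omega> \<in> space (P g). X (Suc n) \<omega> = h \<and> (\<forall>m<Suc n. 1 \<le> wlen (X m \<omega>))}) =
      {\<omega> \<in> space (P g). \<forall>j\<le>n. X j \<omega> \<in> cone 0} - {\<omega> \<in> space (P g). \<forall>j\<le>Suc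
          n. X j \<omega> \<in> cone 0}"
    proof -
      have "(\<exists>h\<in>HH. X (Suc n) \<omega> = h \<and> (\<forall>m<Suc n. 1 \<le> wlen (X m \<omega>))) \<longleftrightarrow>
        (\<forall>j\<le>n. X j \<omega> \<in> cone 0) \<and> \<not> (\<forall>j\<le>Suc n. X j \<omega> \<in> cone 0)" if "\<omega>
            \<in> space (P g)" for \<omega>
      proof -
        have c: "X j \<omega> \<in> carrier G" for j using X_carrier[OF gc that] .
        have "(\<forall>m<Suc n. 1 \<le> wlen (X m \<omega>)) \<longleftrightarrow> (\<forall>j\<le>n. X j \<omega> \<in> cone 0)"
          using wlen_cone[OF c] by (simp add: less_Suc_eq_le)
        moreover have "X (Suc n) \<omega> \<in> HH \<longleftrightarrow> X (Suc n) \<omega> \<notin> cone 0" using c[of "Suc n"] by (simp add: cone_0)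
        ultimately show ?thesis by (auto simp: le_Suc_eq)
      qed
      then show ?thesis by blast
    qed
    also have "P.prob \<dots> = stay (cone 0) n g - stay (cone 0) (Suc n) g"
      unfolding prob_stay[OF gc, symmetric] by (rule P.finite_measure_Diff) (use gc in measurable, auto)
    finally show ?thesis .
  qed
  have "(\<lambda>n. stay (cone 0) n g - stay (cone 0) (Suc n) g) sums (stay (cone 0) 0 g - esc g)"
    by (rule telescope_sums'[OF esc_lim])
  then have sums: "(\<lambda>n. \<Sum>h\<in>HH. q h n) sums (1 - esc g)" using g by (simp only: step) simp
  have qn: "0 \<le> q h n" for h n by (simp add: q_def)
  have sm: "summable (q h)" if "h \<in> HH" for h
  proof (rule summable_comparison_test'[OF sums_summable[OF sums], of 0])
    show "norm (q h n) \<le> (\<Sum>h\<in>HH. q h n)" for n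
      using member_le_sum[OF that, of "\<lambda>h. q h n"] qn finite_HH by simp
  qed
  have "(\<Sum>h\<in>HH. Hgen g h 1) = (\<Sum>h\<in>HH. \<Sum>n. q h n)" by (simp add: Hgen_def q_def)
  also have "\<dots> = (\<Sum>n. \<Sum>h\<in>HH. q h n)" using sm by (rule suminf_sum[symmetric])
  also have "\<dots> = 1 - esc g" using sums by (rule sums_unique[symmetric])
  finally show ?thesis by simp
qed

text \<open>In this form \<open>\<xi> i\<close> is the probability of a first step of type other
  than \<open>i\<close> after which \<open>HH\<close> is never visited. Below a word of type
  \<open>i\<close> this is a departure for good into deeper levels, see
  \<open>tail_lim\<close>.\<close>

lemma \<xi>_eq: "\<xi> i = (\<Sum>g\<in>{g \<in> FF. ltype g \<noteq> i}. stepw g * esc g)"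
proof -
  have "(\<Union>j\<in>{1..r} - {i}. FacX j) = {g \<in> FF. ltype g \<noteq> i}" using FacX_ltype ltype_FF by auto
  moreover have "1 - (\<Sum>h\<in>HH. Hgen g h 1) = esc g" if "g \<in> FF" for g
    by (rule esc_Hgen) (use that in \<open>auto simp: cone_0 FF_eq HH_eq\<close>)
  ultimately show ?thesis unfolding \<xi>_def by (auto intro!: sum.cong)
qed

text \<open>A step of the same type as the last letter merely alters or deletes that letter, and a
  step in \<open>HH\<close> leaves the word as it is.\<close>

lemma V_step:
  assumes v: "v \<in> reps k" and g: "g \<in> gens"
  shows "k < length (word (v \<diamond> g)) \<longleftrightarrow> g \<in> cone (ltype v)"
proof
  assume "g \<in> cone (ltype v)"
  then show "k < length (word (v \<diamond> g))" using length_V_mult[OF v, of g] by (auto simp: cone_def)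
next
  assume l: "k < length (word (v \<diamond> g))"
  have vc: "v \<in> carrier G" "length (word v) = k" using v by (auto simp: reps_def)
  show "g \<in> cone (ltype v)"
  proof (rule ccontr)
    assume n: "g \<notin> cone (ltype v)"
    show False
    proof (cases "g \<in> HH")
      case True
      then show False using V_mult_HH(3)[OF v True] l vc by simp
    next
      case False
      then have gF: "g \<in> FF" "ltype g = ltype v" using n g gens_cone[OF g] by (auto simp: gens_eq)
      then have i: "ltype v \<in> {1..r}" and gf: "g \<in> FacX (ltype v)" using ltype_FF[OF gF(1)] FacX_ltype by auto
      then obtain a where a: "a \<in> carrier (\<Gamma> (ltype v))" "g = \<iota> (ltype v) a" by (auto simp: FacX_def Fac_def)
      have ne: "word v \<noteq> []" "fst (last (word v)) = ltype v" using i by (auto simp: ltype_def split: if_splits)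
      obtain xs where "xs = word v \<and> (word v = [] \<or> fst (last (word v)) \<noteq> ltype v) \<or> (\<exists>t. word v = xs @ [(ltype v, t)])"
        "word (v \<diamond> \<iota> (ltype v) a) = xs \<or> (\<exists>t. word (v \<diamond> \<iota> (ltype v) a) = xs @ [(ltype v, t)])"
        using word_step[OF vc(1) i a(1)] by metis
      then have "length (word (v \<diamond> g)) \<le> length (word v)" using ne unfolding a(2) by auto
      then show False using l vc by simp
    qed
  qed
qed

text \<open>
  \<open>cross h t n\<close> is the weight of the paths from \<open>v h\<close> to \<open>v t\<close> in \<open>n + 1\<close> steps whose
  positions after time \<open>0\<close> lie in the cone below \<open>v\<close>; it does not depend on \<open>v\<close>.
\<close>

definition cross :: "'a amalg \<Rightarrow> 'a amalg \<Rightarrow> nat \<Rightarrow> real" where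
  "cross h t n = (\<Sum>g\<in>FacX (ltype t). stepw g * taboo (cone 0) n (h \<diamond> g) t)"

lemma cross_nonneg: "0 \<le> cross h t n"
  unfolding cross_def by (intro sum_nonneg mult_nonneg_nonneg stepw_nonneg taboo_nonneg)

text \<open>The type of the first letter cannot change while \<open>HH\<close> is avoided, so only
  first steps in the factor of \<open>t\<close> contribute. Prescribing \<open>A'\<close> only on
  the cone and the generators lets the same statement serve the translated cone in
  \<open>last_exit\<close> and the set \<open>beyond k\<close>.\<close>

lemma taboo_cone:
  assumes v: "v \<in> reps k" and t: "t \<in> FF" "ltype t \<noteq> ltype v" and h: "h \<in> HH"
    and A': "\<And>b. b \<in> cone (ltype v) \<union> gens \<Longrightarrow> v \<diamond> b \<in> A' \<longleftrightarrow> b \<in> cone (ltype v)"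
  shows "taboo A' (Suc n) (v \<diamond> h) (v \<diamond> t) = cross h t n"
proof -
  have vc: "v \<in> carrier G" and hc: "h \<in> carrier G" and tc: "t \<in> carrier G"
    using v h t by (auto simp: reps_def HH_carrier FF_carrier)
  have summand: "stepw g * (of_bool (v \<diamond> h \<diamond> g \<in> A') * taboo A' n (v \<diamond> h \<diamond> g) (v \<diamond> t)) =
    (if g \<in> FacX (ltype t) then stepw g * taboo (cone 0) n (h \<diamond> g) t else 0)" if g: "g \<in> gens" for g
  proof -
    have gc: "g \<in> carrier G" using g gens_carrier by blast
    have hg: "h \<diamond> g \<in> gens" using HH_mult_gens h g by blast
    have as: "v \<diamond> h \<diamond> g = v \<diamond> (h \<diamond> g)" using vc hc gc by (simp add: GG.m_assoc)
    have inA: "v \<diamond> h \<diamond> g \<in> A' \<longleftrightarrow> h \<diamond> g \<in> cone (ltype v)" unfolding as using A' hg by blast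
    have gA: "h \<diamond> g \<in> cone i \<longleftrightarrow> g \<in> FF \<and> ltype g \<noteq> i" for i
    proof -
      have "h \<diamond> g \<in> FF \<longleftrightarrow> g \<in> FF"
        using hg g HH_mult_HH_iff[OF h gc] unfolding gens_eq by (auto simp: FF_eq HH_eq)
      then show ?thesis using gens_cone[OF hg] HH_mult_ltype[OF h g] by simp
    qed
    show ?thesis
    proof (cases "h \<diamond> g \<in> cone (ltype v)")
      case True
      have "taboo A' n (v \<diamond> (h \<diamond> g)) (v \<diamond> t) = taboo (cone 0) n (h \<diamond> g) t"
      proof (rule taboo_translate[where D = "cone (ltype v) \<union> HH"])
        fix b assume b: "b \<in> cone (ltype v) \<union> HH"
        then show "(b \<in> cone 0) = (v \<diamond> b \<in> A')" using A'[of b] cone_HH_iff[OF b] by (auto simp: gens_eq)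
      next
        fix b g' assume b: "b \<in> cone (ltype v) \<union> HH" "b \<in> cone 0" "g' \<in> gens"
        then have "b \<in> cone (ltype v)" using cone_HH_iff by blast
        then show "b \<diamond> g' \<in> cone (ltype v) \<union> HH" using cone_step b(3) by blast
      next
        show "h \<diamond> g \<in> cone 0" using True cone_HH_iff by blast
      qed (use vc tc True cone_HH_carrier in auto)
      moreover have "taboo (cone 0) n (h \<diamond> g) t = 0" if "g \<notin> FacX (ltype t)"
      proof (rule taboo_confined[where D = "cone (ltype t)"])
        have "g \<in> FF" "ltype g \<noteq> ltype t" using True gA[of "ltype v"] that FacX_ltype[OF ltype_FF[OF t(1)]] by auto
        then show "h \<diamond> g \<in> cone (ltype t)" using gA by blast
        show "t \<notin> cone (ltype t)" using t gens_cone[of t "ltype t"] by (auto simp: gens_eq)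
      next
        fix a g' assume a: "a \<in> cone (ltype t)" "g' \<in> gens" "a \<diamond> g' \<in> cone 0"
        then show "a \<diamond> g' \<in> cone (ltype t)" using cone_step[OF a(1,2)] cone_HH_iff by blast
      qed
      ultimately show ?thesis using True inA by (simp add: as)
    next
      case False
      then have "g \<notin> FacX (ltype t)" using gA FacX_ltype[OF ltype_FF[OF t(1)]] t by auto
      then show ?thesis using False inA by simp
    qed
  qed
  have sub: "FacX (ltype t) \<subseteq> gens" using FacX_ltype[OF ltype_FF[OF t(1)]] by (auto simp: gens_eq)
  have "taboo A' (Suc n) (v \<diamond> h) (v \<diamond> t) = (\<Sum>g\<in>gens. if g \<in> FacX (ltype t) then stepw g * taboo
      (cone 0) n (h \<diamond> g) t else 0)"
    unfolding taboo.simps by (rule sum.cong[OF HOL.refl summand])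
  also have "\<dots> = cross h t n" unfolding cross_def using sub finite_gens by (simp add: sum.If_cases Int_absorb1)
  finally show ?thesis .
qed

lemma sum_of_bool_eq:
  assumes "finite B"
  shows "(\<Sum>b\<in>B. of_bool (c = b) * F b) = of_bool (c \<in> B) * (F c :: real)"
proof -
  have "(\<Sum>b\<in>B. of_bool (c = b) * F b) = (\<Sum>b\<in>B. if b = c then F b else 0)" by (rule sum.cong) auto
  then show ?thesis using assms by simp
qed

text \<open>Since \<open>A\<close> can be entered only from \<open>A\<close> or \<open>B\<close>, a
  path ending in \<open>A\<close> stays in \<open>A\<close> after its last visit to
  \<open>B\<close>. The first term collects the paths that avoid \<open>B\<close> at times
  \<open>1, ..., m\<close>; summand \<open>j\<close> has its last visit at time
  \<open>j + 1\<close>.\<close>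

lemma last_exit_general:
  assumes pre: "\<And>a g. a \<in> carrier G \<Longrightarrow> a \<notin> A \<union> B \<Longrightarrow> g \<in> gens
      \<Longrightarrow> a \<diamond> g \<notin> A"
    and B: "finite B" "A \<inter> B = {}" and w: "w \<in> A"
  shows "a \<in> carrier G \<Longrightarrow> pn m a w = taboo A m a w + (\<Sum>j<m. \<Sum>b\<in>B. pn (Suc j) a b * taboo A (m - Suc j) b w)"
proof (induction m arbitrary: a)
  case (Suc m)
  have z: "taboo A n c w = 0" if c: "c \<in> carrier G" "c \<notin> A \<union> B" for n c
  proof (cases n)
    case 0
    then show ?thesis using c w by auto
  next
    case (Suc n')
    then show ?thesis using pre[OF c] by (auto intro!: sum.neutral)
  qed
  have agc: "a \<diamond> g \<in> carrier G" if "g \<in> gens" for g using that Suc.prems gens_carrier by simp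
  have split: "taboo A m (a \<diamond> g) w = of_bool (a \<diamond> g \<in> A) * taboo A m (a \<diamond> g) w +
    (\<Sum>b\<in>B. of_bool (a \<diamond> g = b) * taboo A m b w)" if "g \<in> gens" for g
  proof -
    have "(\<Sum>b\<in>B. of_bool (a \<diamond> g = b) * taboo A m b w) = of_bool (a \<diamond> g \<in> B) * taboo A m (a \<diamond> g) w"
      by (rule sum_of_bool_eq[OF B(1)])
    then show ?thesis using z[OF agc[OF that], of m] B(2) by (auto simp: of_bool_def)
  qed
  have "pn (Suc m) a w = (\<Sum>g\<in>gens. stepw g * pn m (a \<diamond> g) w)" by simp
  also have "\<dots> = (\<Sum>g\<in>gens. stepw g * (of_bool (a \<diamond> g \<in> A) * taboo A m (a \<diamond> g) w)) +
    ((\<Sum>g\<in>gens. stepw g * (\<Sum>b\<in>B. of_bool (a \<diamond> g = b) * taboo A m b w)) +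
    (\<Sum>g\<in>gens. stepw g * (\<Sum>j<m. \<Sum>b\<in>B. pn (Suc j) (a \<diamond> g) b * taboo A (m - Suc j) b w)))"
    unfolding sum.distrib[symmetric] distrib_left[symmetric]
  proof (rule sum.cong[OF HOL.refl])
    fix g assume g: "g \<in> gens"
    show "stepw g * pn m (a \<diamond> g) w = stepw g * (of_bool (a \<diamond> g \<in> A) * taboo A m (a \<diamond> g) w +
      ((\<Sum>b\<in>B. of_bool (a \<diamond> g = b) * taboo A m b w) +
      (\<Sum>j<m. \<Sum>b\<in>B. pn (Suc j) (a \<diamond> g) b * taboo A (m - Suc j) b w)))"
      using Suc.IH[OF agc[OF g]] split[OF g] by simp
  qed
  also have "(\<Sum>g\<in>gens. stepw g * (of_bool (a \<diamond> g \<in> A) * taboo A m (a \<diamond> g) w)) = taboo A (Suc m) a w" by simp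
  also have "(\<Sum>g\<in>gens. stepw g * (\<Sum>b\<in>B. of_bool (a \<diamond> g = b) * taboo A m b w)) = (\<Sum>b\<in>B. pn (Suc
      0) a b * taboo A m b w)"
    by (simp add: sum_distrib_left sum_distrib_right mult.assoc sum.swap[of _ gens])
  also have "(\<Sum>g\<in>gens. stepw g * (\<Sum>j<m. \<Sum>b\<in>B. pn (Suc j) (a \<diamond> g) b * taboo A (m - Suc j) b w)) =
    (\<Sum>j<m. \<Sum>b\<in>B. pn (Suc (Suc j)) a b * taboo A (m - Suc j) b w)"
  proof -
    have "(\<Sum>g\<in>gens. stepw g * (\<Sum>j<m. \<Sum>b\<in>B. pn (Suc j) (a \<diamond> g) b * taboo A (m - Suc j) b w)) =
      (\<Sum>g\<in>gens. \<Sum>j<m. \<Sum>b\<in>B. stepw g * pn (Suc j) (a \<diamond> g) b * taboo A (m - Suc j) b w)"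
      by (simp only: sum_distrib_left mult.assoc)
    also have "\<dots> = (\<Sum>j<m. \<Sum>b\<in>B. \<Sum>g\<in>gens. stepw g * pn (Suc j) (a \<diamond> g) b * taboo A (m - Suc j) b w)"
      by (subst sum.swap, rule sum.cong[OF HOL.refl], rule sum.swap)
    also have "\<dots> = (\<Sum>j<m. \<Sum>b\<in>B. pn (Suc (Suc j)) a b * taboo A (m - Suc j) b w)"
      unfolding sum_distrib_right[symmetric] taboo.simps(2)[of UNIV "Suc _" a] by simp
    finally show ?thesis .
  qed
  finally show ?case unfolding sum.lessThan_Suc_shift by (simp del: taboo.simps sum.lessThan_Suc)
qed simp

text \<open>Applied to the cone below \<open>v\<close> as \<open>A\<close> and the coset
  \<open>v HH\<close> as \<open>B\<close>. The identity is not in that cone, so the path must pass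
  the coset, and translation turns the part after the last visit into \<open>cross\<close>.\<close>

lemma last_exit:
  assumes v: "v \<in> reps k" and t: "t \<in> FF" "ltype t \<noteq> ltype v"
  shows "pn m \<one>\<^bsub>G\<^esub> (v \<diamond> t) = (\<Sum>j<m. \<Sum>h\<in>HH. pn j \<one>\<^bsub>G\<^esub> (v \<diamond> h)
      * cross h t (m - Suc j))"
proof -
  let ?e = "\<one>\<^bsub>G\<^esub>"
  define A where "A = (\<lambda>b. v \<diamond> b) ` cone (ltype v)"
  define B where "B = (\<lambda>b. v \<diamond> b) ` HH"
  have vc: "v \<in> carrier G" using v by (simp add: reps_def)
  have tA: "t \<in> cone (ltype v)" using t gens_cone[of t] by (simp add: gens_eq)
  have inA: "v \<diamond> b \<in> A \<longleftrightarrow> b \<in> cone (ltype v)" if "b \<in> carrier G" for b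
    using that vc cone_carrier by (auto simp: A_def)
  have fin: "finite B" by (simp add: B_def finite_HH)
  have dj: "A \<inter> B = {}"
  proof (rule equals0I)
    fix x assume x: "x \<in> A \<inter> B"
    then obtain h where h: "h \<in> HH" "x = v \<diamond> h" unfolding B_def by blast
    then have "h \<in> cone (ltype v)" using inA[OF HH_carrier[OF h(1)]] x by simp
    then show False using h(1) by (simp add: cone_def HH_eq)
  qed
  have w: "v \<diamond> t \<in> A" using tA by (simp add: A_def)
  have eA: "?e \<notin> A"
  proof
    assume "?e \<in> A"
    then obtain b where "b \<in> cone (ltype v)" "?e = v \<diamond> b" by (auto simp: A_def)
    then have "length (word ?e) = k + length (word b)" "word b \<noteq> []"
      using length_V_mult[OF v, of b] by (auto simp: cone_def)
    then show False by (simp add: word_one)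
  qed
  \<comment> \<open>Entering the cone is leaving it backwards, and \<open>gens\<close> is closed
    under inverses, so \<open>cone_step\<close> applies to the reversed step.\<close>
  have pre: "a \<diamond> g \<notin> A" if a: "a \<in> carrier G" "a \<notin> A \<union> B" "g \<in> gens" for a g
  proof
    assume "a \<diamond> g \<in> A"
    then obtain b where b: "b \<in> cone (ltype v)" "a \<diamond> g = v \<diamond> b" by (auto simp: A_def)
    have gc: "g \<in> carrier G" "b \<in> carrier G" using a gens_carrier b cone_carrier by auto
    have "a = a \<diamond> g \<diamond> inv\<^bsub>G\<^esub> g" using a gc by (simp add: GG.m_assoc)
    also have "\<dots> = v \<diamond> (b \<diamond> inv\<^bsub>G\<^esub> g)" unfolding b(2) using vc gc by (simp add: GG.m_assoc)
    finally have "a \<in> A \<union> B" using cone_step[OF b(1) inv_gens[OF a(3)]] by (auto simp: A_def B_def)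
    then show False using a by simp
  qed
  have LB: "(\<Sum>b\<in>B. pn j ?e b * taboo A (Suc n) b (v \<diamond> t)) = (\<Sum>h\<in>HH. pn j ?e (v \<diamond> h) * cross h t n)" for j n
  proof -
    have "inj_on (\<lambda>b. v \<diamond> b) HH" using vc HH_carrier by (auto simp: inj_on_def)
    then have "(\<Sum>b\<in>B. pn j ?e b * taboo A (Suc n) b (v \<diamond> t)) =
      (\<Sum>h\<in>HH. pn j ?e (v \<diamond> h) * taboo A (Suc n) (v \<diamond> h) (v \<diamond> t))"
      unfolding B_def by (subst sum.reindex) auto
    also have "\<dots> = (\<Sum>h\<in>HH. pn j ?e (v \<diamond> h) * cross h t n)"
    proof (rule sum.cong[OF HOL.refl])
      fix h assume h: "h \<in> HH"
      have "taboo A (Suc n) (v \<diamond> h) (v \<diamond> t) = cross h t n"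
      proof (rule taboo_cone[OF v t h])
        fix b assume "b \<in> cone (ltype v) \<union> gens"
        then have "b \<in> carrier G" using cone_carrier gens_carrier by blast
        then show "v \<diamond> b \<in> A \<longleftrightarrow> b \<in> cone (ltype v)" by (rule inA)
      qed
      then show "pn j ?e (v \<diamond> h) * taboo A (Suc n) (v \<diamond> h) (v \<diamond> t) = pn j ?e (v \<diamond> h) * cross h t n" by simp
    qed
    finally show ?thesis .
  qed
  show ?thesis
  proof (cases m)
    case 0
    then show ?thesis using eA w by auto
  next
    case (Suc m')
    \<comment> \<open>The term without visits at positive times becomes the summand for time 0,
      which is nonzero only if the identity lies in the coset. The summand for time \<open>m\<close>
      vanishes since the end point is not in \<open>B\<close>; the sum then runs over
      \<open>j < m\<close>.\<close>
    have base: "taboo A (Suc m') ?e (v \<diamond> t) = (\<Sum>b\<in>B. pn 0 ?e b * taboo A (Suc m') b (v \<diamond> t))"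
    proof (cases "?e \<in> B")
      case True
      then show ?thesis using sum_of_bool_eq[OF fin, of ?e "\<lambda>b. taboo A (Suc m') b (v \<diamond> t)"] by (simp del: taboo.simps(2))
    next
      case False
      then have "taboo A (Suc m') ?e (v \<diamond> t) = 0" using pre[of ?e] eA by (auto intro!: sum.neutral)
      moreover have "pn 0 ?e b = 0" if "b \<in> B" for b using that False by auto
      ultimately show ?thesis by simp
    qed
    have last: "(\<Sum>b\<in>B. pn (Suc m') ?e b * taboo A (Suc m' - Suc m') b (v \<diamond> t)) = 0"
      using dj w by (intro sum.neutral) auto
    have "pn (Suc m') ?e (v \<diamond> t) = taboo A (Suc m') ?e (v \<diamond> t) +
      (\<Sum>j<Suc m'. \<Sum>b\<in>B. pn (Suc j) ?e b * taboo A (Suc m' - Suc j) b (v \<diamond> t))"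
      by (rule last_exit_general[OF pre fin dj w GG.one_closed])
    also have "\<dots> = (\<Sum>j<Suc m'. \<Sum>b\<in>B. pn j ?e b * taboo A (Suc m' - j) b (v \<diamond> t))"
      unfolding base sum.lessThan_Suc[of _ m'] last using sum.lessThan_Suc_shift[of "\<lambda>j. \<Sum>b\<in>B. pn j ?e b * taboo A
          (Suc m' - j) b (v \<diamond> t)" m']
      by (simp only: diff_zero add_0_right sum.lessThan_Suc)
    also have "\<dots> = (\<Sum>j<Suc m'. \<Sum>h\<in>HH. pn j ?e (v \<diamond> h) * cross h t (Suc m' - Suc j))"
    proof (rule sum.cong[OF HOL.refl])
      fix j assume "j \<in> {..<Suc m'}"
      then have "Suc m' - j = Suc (Suc m' - Suc j)" by auto
      then show "(\<Sum>b\<in>B. pn j ?e b * taboo A (Suc m' - j) b (v \<diamond> t)) = (\<Sum>h\<in>HH. pn j ?e (v \<diamond> h) *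
          cross h t (Suc m' - Suc j))"
        using LB by simp
    qed
    finally show ?thesis using Suc by simp
  qed
qed

section \<open>Exponential moments\<close>

definition Hpart :: "'a amalg \<Rightarrow> 'a amalg" where
  "Hpart t = embh (tail t)"

lemma Hpart_HH: "t \<in> carrier G \<Longrightarrow> Hpart t \<in> HH"
  unfolding Hpart_def by (rule HH_embh)

lemma Hpart_bracket_V:
  assumes "v \<in> reps k" "1 \<le> k" "h \<in> HH"
  shows "Hpart (bracket (v \<diamond> h)) = h" "ltype (bracket (v \<diamond> h)) = ltype v" "bracket (v \<diamond> h) \<in> FF"
    "word (v \<diamond> h) \<noteq> []"
proof -
  note m = V_mult_HH[OF assms(1,3)]
  show ne: "word (v \<diamond> h) \<noteq> []" using m assms by (auto simp: reps_def)
  show "bracket (v \<diamond> h) \<in> FF" by (rule bracket_FF[OF m(1) ne])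
  show "ltype (bracket (v \<diamond> h)) = ltype v" using ltype_bracket[OF m(1) ne] m(3) by (simp add: ltype_def)
  have "tail (bracket (v \<diamond> h)) = tail h" using bracket_nfc(2)[OF m(1) ne] m(2) by (simp add: tail_def)
  moreover have hc: "h \<in> carrier G" "word h = []" using assms by (auto simp: HH_eq)
  ultimately show "Hpart (bracket (v \<diamond> h)) = h"
    unfolding Hpart_def using HH_embh[OF hc(1)] HH_carrier by (intro nfc_inject) (auto simp: word_def tail_def prod_eq_iff)
qed

text \<open>The entries of the matrix \<open>K(z)\<close>. Of the starting state only the
  \<open>H\<close>-part enters; the condition that the types differ is imposed where the entries are
  summed.\<close>

definition crossz :: "'a amalg \<Rightarrow> 'a amalg \<Rightarrow> real \<Rightarrow> real" where
  "crossz h t z = (\<Sum>n. cross h t n * z ^ Suc n)"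

text \<open>The state space described by transition probabilities alone; \<open>S_eq\<close>
  identifies it with \<open>S\<close>. The recursion over spheres needs its inequality only at these
  states, which is all that the exit chain provides.\<close>

definition visited :: "'a amalg set" where
  "visited = {s \<in> FF. \<exists>m. \<exists>w\<in>carrier G. word w \<noteq> [] \<and> bracket w = s \<and> 0 < pn m ee w}"

definition sphere :: "nat \<Rightarrow> 'a amalg set" where
  "sphere k = {w \<in> carrier G. length (word w) = k}"

section \<open>Step structure of the paths and sums over spheres\<close>

lemma pathE_steps: "pathE n a (\<lambda>ws. of_bool (\<forall>m<n. \<exists>g\<in>gens. ws ! Suc m = ws ! m \<diamond> g)) = 1"
proof (induction n arbitrary: a)
  case (Suc n)
  have "pathE n (a \<diamond> g) (\<lambda>ws. of_bool (\<forall>m<Suc n. \<exists>g\<in>gens. (a # ws) ! Suc m = (a # ws) ! m \<diamond> g)) =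
    pathE n (a \<diamond> g) (\<lambda>ws. of_bool (\<forall>m<n. \<exists>g\<in>gens. ws ! Suc m = ws ! m \<diamond> g))" if "g \<in> gens" for g
    by (rule pathE_cong) (use that in \<open>auto simp: All_less_Suc2\<close>)
  then show ?case using Suc.IH by (simp add: stepw_sum)
qed simp

lemma AE_steps:
  assumes w: "w \<in> carrier G"
  shows "AE \<omega> in P w. \<forall>m. \<exists>g\<in>gens. X (Suc m) \<omega> = X m \<omega> \<diamond> g"
proof -
  interpret P: prob_space "P w" using prob_P w .
  have "AE \<omega> in P w. \<forall>m<n. \<exists>g\<in>gens. path n \<omega> ! Suc m = path n \<omega> ! m \<diamond> g" for n
  proof -
    have "\<P>(\<omega> in P w. \<forall>m<n. \<exists>g\<in>gens. path n \<omega> ! Suc m = path n \<omega> ! m \<diamond> g) = 1"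
      using prob_pathE[OF w, of "\<lambda>ws. \<forall>m<n. \<exists>g\<in>gens. ws ! Suc m = ws ! m \<diamond> g" n] pathE_steps by simp
    then show ?thesis
      using P.prob_Collect_eq_1[OF measurable_path[OF w, of "\<lambda>ws. \<forall>m<n. \<exists>g\<in>gens. ws ! Suc m = ws ! m
          \<diamond> g" n, unfolded pred_def]]
      by (rule iffD1[rotated])
  qed
  then have "AE \<omega> in P w. \<forall>n. \<forall>m<n. \<exists>g\<in>gens. path n \<omega> ! Suc m = path n \<omega> ! m \<diamond> g"
    by (subst AE_all_countable) simp
  then show ?thesis
  proof eventually_elim
    case (elim \<omega>)
    show ?case
    proof
      fix m show "\<exists>g\<in>gens. X (Suc m) \<omega> = X m \<omega> \<diamond> g" using elim[rule_format, of m "Suc m"] by simp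
    qed
  qed
qed

lemma AE_length_le: "AE \<omega> in P ee. \<forall>m. length (word (X m \<omega>)) \<le> m"
  using AE_steps[OF GG.one_closed] AE_X0[OF GG.one_closed] AE_space
proof eventually_elim
  case (elim \<omega>)
  show ?case
  proof
    fix m show "length (word (X m \<omega>)) \<le> m"
    proof (induction m)
      case 0
      then show ?case using elim by (simp add: word_one)
    next
      case (Suc m)
      obtain g where "g \<in> gens" "X (Suc m) \<omega> = X m \<omega> \<diamond> g" using elim by blast
      then show ?case using length_step(1)[OF X_carrier[OF GG.one_closed elim(3)], of g m] Suc by simp
    qed
  qed
qed

lemma prob_finite:
  assumes B: "finite B" and a: "a \<in> carrier G"
  shows "\<P>(\<omega> in P a. X n \<omega> \<in> B) = (\<Sum>w\<in>B. pn n a w)"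
proof -
  interpret P: prob_space "P a" using prob_P a .
  have ev: "{\<omega> \<in> space (P a). X n \<omega> = w} \<in> P.events" for w using a by measurable
  have "{\<omega> \<in> space (P a). X n \<omega> \<in> B} = (\<Union>w\<in>B. {\<omega> \<in> space (P a). X n \<omega> = w})" by auto
  also have "P.prob \<dots> = (\<Sum>w\<in>B. P.prob {\<omega> \<in> space (P a). X n \<omega> = w})"
    by (rule P.finite_measure_finite_Union[OF B]) (use ev in \<open>auto simp: disjoint_family_on_def\<close>)
  finally show ?thesis using prob_pn[OF a] by simp
qed

lemma sum_sphere_HH: "(\<Sum>w\<in>sphere k. F w) = (\<Sum>v\<in>reps k. \<Sum>h\<in>HH. F (v \<diamond> h))"
proof -
  have "(\<Sum>w\<in>sphere k. F w) = (\<Sum>(v, h)\<in>reps k \<times> HH. F (v \<diamond> h))"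
    unfolding sphere_def using sum.reindex_bij_betw[OF sphere_decomp_HH[of k], of F]
    by (simp add: case_prod_unfold)
  then show ?thesis by (simp add: sum.cartesian_product)
qed

lemma sum_sphere_Suc: "(\<Sum>w\<in>sphere (Suc k). F w) = (\<Sum>v\<in>reps k. \<Sum>t\<in>{t \<in> FF. ltype t \<noteq> ltype v}.
    F (v \<diamond> t))"
proof -
  have "(\<Sum>w\<in>sphere (Suc k). F w) = (\<Sum>(v, t)\<in>(SIGMA v:reps k. {t \<in> FF. ltype t \<noteq> ltype v}). F (v \<diamond> t))"
    unfolding sphere_def using sum.reindex_bij_betw[OF sphere_decomp[of k], of F]
    by (simp add: case_prod_unfold)
  then show ?thesis using finite_reps finite_FF by (simp add: sum.Sigma)
qed

abbreviation ll :: "'a amalg \<Rightarrow> real" where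
  "ll \<equiv> lext l"

lemma ll_V_FF:
  assumes "v \<in> reps k" "t \<in> FF" "ltype t \<noteq> ltype v"
  shows "ll (v \<diamond> t) = ll v + ll t"
proof -
  have "word (v \<diamond> t) = word v @ word t" using V_mult_FF(2)[OF assms] by (simp add: word_def)
  then show ?thesis using V_mult_FF(1)[OF assms] assms by (simp add: lext_eq reps_def FF_carrier)
qed

lemma ll_V_HH: "v \<in> reps k \<Longrightarrow> h \<in> HH \<Longrightarrow> ll (v \<diamond> h) = ll v"
  using V_mult_HH[of v k h] by (simp add: lext_eq reps_def)

text \<open>A Cauchy product truncated in one factor only. It holds without summability of
  \<open>a\<close>, whose partial sums are what has to be estimated.\<close>

lemma convolution_bound:
  fixes a b :: "nat \<Rightarrow> real"
  assumes a: "\<And>n. 0 \<le> a n" and b: "\<And>n. 0 \<le> b n" and s: "summable (\<lambda>n. b n * z ^ Suc n)" and z: "0 < z"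
  shows "(\<Sum>m\<le>M. (\<Sum>j<m. a j * b (m - Suc j)) * z ^ m) \<le> (\<Sum>j\<le>M. a j * z ^ j) * (\<Sum>n. b n * z ^ Suc n)"
proof -
  have "(\<Sum>m\<le>M. (\<Sum>j<m. a j * b (m - Suc j)) * z ^ m) =
    (\<Sum>m\<le>M. \<Sum>j\<le>M. if j < m then a j * z ^ j * (b (m - Suc j) * z ^ (m - j)) else 0)"
  proof (rule sum.cong[OF HOL.refl])
    fix m assume m: "m \<in> {..M}"
    have "(\<Sum>j<m. a j * b (m - Suc j)) * z ^ m = (\<Sum>j<m. a j * z ^ j * (b (m - Suc j) * z ^ (m - j)))"
      unfolding sum_distrib_right
    proof (rule sum.cong[OF HOL.refl])
      fix j assume "j \<in> {..<m}"
      then have "z ^ m = z ^ j * z ^ (m - j)" by (simp flip: power_add)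
      then show "a j * b (m - Suc j) * z ^ m = a j * z ^ j * (b (m - Suc j) * z ^ (m - j))" by simp
    qed
    also have "\<dots> = (\<Sum>j\<le>M. if j < m then a j * z ^ j * (b (m - Suc j) * z ^ (m - j)) else 0)"
      using m by (intro sum.mono_neutral_cong_left) auto
    finally show "(\<Sum>j<m. a j * b (m - Suc j)) * z ^ m =
      (\<Sum>j\<le>M. if j < m then a j * z ^ j * (b (m - Suc j) * z ^ (m - j)) else 0)" .
  qed
  also have "\<dots> = (\<Sum>j\<le>M. \<Sum>m\<le>M. if j < m then a j * z ^ j * (b (m - Suc j) * z ^ (m - j)) else 0)"
    by (rule sum.swap)
  also have "\<dots> \<le> (\<Sum>j\<le>M. a j * z ^ j * (\<Sum>n. b n * z ^ Suc n))"
  proof (rule sum_mono)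
    fix j
    have "(\<Sum>m\<le>M. if j < m then a j * z ^ j * (b (m - Suc j) * z ^ (m - j)) else 0) =
      (\<Sum>m\<in>{Suc j..M}. a j * z ^ j * (b (m - Suc j) * z ^ (m - j)))"
      by (rule sum.mono_neutral_cong_right) auto
    also have "\<dots> = (\<Sum>n<M - j. a j * z ^ j * (b n * z ^ Suc n))"
      by (rule sum.reindex_bij_witness[of _ "\<lambda>n. n + Suc j" "\<lambda>m. m - Suc j"]) (auto simp: Suc_diff_Suc)
    also have "\<dots> = a j * z ^ j * (\<Sum>n<M - j. b n * z ^ Suc n)" by (simp add: sum_distrib_left)
    also have "\<dots> \<le> a j * z ^ j * (\<Sum>n. b n * z ^ Suc n)"
      using a b z s by (intro mult_left_mono sum_le_suminf) auto
    finally show "(\<Sum>m\<le>M. if j < m then a j * z ^ j * (b (m - Suc j) * z ^ (m - j)) else 0) \<le>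
      a j * z ^ j * (\<Sum>n. b n * z ^ Suc n)" .
  qed
  finally show ?thesis by (simp add: sum_distrib_right)
qed

text \<open>The last exit formula expresses the mass at \<open>v t\<close> through the masses at
  \<open>v h\<close>. Since \<open>bracket (v h)\<close> has type \<open>ltype v\<close> and
  \<open>H\<close>-part \<open>h\<close>, regrouping by \<open>v h\<close> produces the row sum of
  the twisted matrix at that state. Points whose bracket is not in \<open>visited\<close> carry no
  mass.\<close>

lemma sphere_recursion:
  fixes \<gamma> :: "'a amalg \<Rightarrow> real"
  assumes z: "0 < z" and sm: "\<And>h t. h \<in> HH \<Longrightarrow> t \<in> FF \<Longrightarrow> summable (\<lambda>n. cross h t n * z ^ Suc n)"
    and \<gamma>: "\<And>t. t \<in> FF \<Longrightarrow> 0 < \<gamma> t" and \<rho>: "0 \<le> \<rho>"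
    and eig: "\<And>s. s \<in> visited \<Longrightarrow> (\<Sum>t\<in>{t \<in> FF. ltype t \<noteq> ltype s}. crossz (Hpart s) t z
        * exp (c * ll t) * \<gamma> t) \<le> \<rho> * \<gamma> s"
    and k: "1 \<le> k"
  shows "(\<Sum>w\<in>sphere (Suc k). \<gamma> (bracket w) * exp (c * ll w) * (\<Sum>m\<le>M. pn m ee w * z ^ m)) \<le>
    \<rho> * (\<Sum>w\<in>sphere k. \<gamma> (bracket w) * exp (c * ll w) * (\<Sum>m\<le>M. pn m ee w * z ^ m))"
proof -
  have "(\<Sum>w\<in>sphere (Suc k). \<gamma> (bracket w) * exp (c * ll w) * (\<Sum>m\<le>M. pn m ee w * z ^ m)) =
    (\<Sum>v\<in>reps k. \<Sum>t\<in>{t \<in> FF. ltype t \<noteq> ltype v}. \<gamma> (bracket (v \<diamond> t)) * exp (c * ll (v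
        \<diamond> t)) * (\<Sum>m\<le>M. pn m ee (v \<diamond> t) * z ^ m))"
    by (rule sum_sphere_Suc)
  also have "\<dots> \<le> (\<Sum>v\<in>reps k. \<Sum>t\<in>{t \<in> FF. ltype t \<noteq> ltype v}. \<gamma> t * exp (c * (ll v + ll t)) *
      (\<Sum>h\<in>HH. (\<Sum>m\<le>M. pn m ee (v \<diamond> h) * z ^ m) * crossz h t z))"
  proof (intro sum_mono)
    fix v t assume v: "v \<in> reps k" and t: "t \<in> {t \<in> FF. ltype t \<noteq> ltype v}"
    then have t': "t \<in> FF" "ltype t \<noteq> ltype v" by auto
    have "(\<Sum>m\<le>M. pn m ee (v \<diamond> t) * z ^ m) =
      (\<Sum>h\<in>HH. \<Sum>m\<le>M. (\<Sum>j<m. pn j ee (v \<diamond> h) * cross h t (m - Suc j)) * z ^ m)"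
      unfolding last_exit[OF v t'] by (subst sum.swap) (simp add: sum_distrib_right sum.swap[of _ HH])
    also have "\<dots> \<le> (\<Sum>h\<in>HH. (\<Sum>m\<le>M. pn m ee (v \<diamond> h) * z ^ m) * crossz h t z)"
      unfolding crossz_def by (intro sum_mono convolution_bound taboo_nonneg cross_nonneg sm z t')
    finally show "\<gamma> (bracket (v \<diamond> t)) * exp (c * ll (v \<diamond> t)) * (\<Sum>m\<le>M. pn m ee (v \<diamond> t) * z ^ m) \<le>
      \<gamma> t * exp (c * (ll v + ll t)) * (\<Sum>h\<in>HH. (\<Sum>m\<le>M. pn m ee (v \<diamond> h) * z ^ m) * crossz h t z)"
      unfolding V_mult_FF(3)[OF v t'] ll_V_FF[OF v t'] using \<gamma>[OF t'(1)] by (intro mult_left_mono) auto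
  qed
  also have "\<dots> = (\<Sum>v\<in>reps k. \<Sum>h\<in>HH. exp (c * ll v) * (\<Sum>m\<le>M. pn m ee (v \<diamond> h) * z ^ m) *
      (\<Sum>t\<in>{t \<in> FF. ltype t \<noteq> ltype v}. crossz h t z * exp (c * ll t) * \<gamma> t))"
  proof (rule sum.cong[OF HOL.refl])
    fix v
    have rearrange: "(\<Sum>t\<in>A. \<gamma> t * exp (c * (x + ll t)) * (\<Sum>h\<in>HH. F h * crossz h t z)) =
      (\<Sum>t\<in>A. \<Sum>h\<in>HH. exp (c * x) * F h * (crossz h t z * exp (c * ll t) * \<gamma> t))" for A F x
      unfolding sum_distrib_left by (intro sum.cong HOL.refl) (simp add: exp_add distrib_left mult_ac)
    have "(\<Sum>t\<in>{t \<in> FF. ltype t \<noteq> ltype v}. \<gamma> t * exp (c * (ll v + ll t)) *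
      (\<Sum>h\<in>HH. (\<Sum>m\<le>M. pn m ee (v \<diamond> h) * z ^ m) * crossz h t z)) =
      (\<Sum>t\<in>{t \<in> FF. ltype t \<noteq> ltype v}. \<Sum>h\<in>HH. exp (c * ll v) * (\<Sum>m\<le>M. pn m ee (v \<diamond>
          h) * z ^ m) * (crossz h t z * exp (c * ll t) * \<gamma> t))"
      by (rule rearrange)
    also have "\<dots> = (\<Sum>h\<in>HH. \<Sum>t\<in>{t \<in> FF. ltype t \<noteq> ltype v}. exp (c * ll v) * (\<Sum>m\<le>M. pn m
        ee (v \<diamond> h) * z ^ m) * (crossz h t z * exp (c * ll t) * \<gamma> t))"
      by (rule sum.swap)
    finally show "(\<Sum>t\<in>{t \<in> FF. ltype t \<noteq> ltype v}. \<gamma> t * exp (c * (ll v + ll t)) *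
      (\<Sum>h\<in>HH. (\<Sum>m\<le>M. pn m ee (v \<diamond> h) * z ^ m) * crossz h t z)) =
      (\<Sum>h\<in>HH. exp (c * ll v) * (\<Sum>m\<le>M. pn m ee (v \<diamond> h) * z ^ m) *
      (\<Sum>t\<in>{t \<in> FF. ltype t \<noteq> ltype v}. crossz h t z * exp (c * ll t) * \<gamma> t))"
      by (simp only: sum_distrib_left)
  qed
  also have "\<dots> \<le> (\<Sum>v\<in>reps k. \<Sum>h\<in>HH. \<rho> * (\<gamma> (bracket (v \<diamond> h)) * exp (c * ll (v
      \<diamond> h)) * (\<Sum>m\<le>M. pn m ee (v \<diamond> h) * z ^ m)))"
  proof (intro sum_mono)
    fix v h assume v: "v \<in> reps k" and h: "h \<in> HH"
    note b = Hpart_bracket_V[OF v k h]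
    let ?g = "\<Sum>m\<le>M. pn m ee (v \<diamond> h) * z ^ m"
    have g0: "0 \<le> ?g" using z by (intro sum_nonneg mult_nonneg_nonneg taboo_nonneg) auto
    show "exp (c * ll v) * ?g * (\<Sum>t\<in>{t \<in> FF. ltype t \<noteq> ltype v}. crossz h t z * exp (c * ll t) * \<gamma> t) \<le>
      \<rho> * (\<gamma> (bracket (v \<diamond> h)) * exp (c * ll (v \<diamond> h)) * ?g)"
    proof (cases "bracket (v \<diamond> h) \<in> visited")
      case True
      have "exp (c * ll v) * ?g * (\<Sum>t\<in>{t \<in> FF. ltype t \<noteq> ltype v}. crossz h t z * exp (c * ll t) * \<gamma> t) \<le>
        exp (c * ll v) * ?g * (\<rho> * \<gamma> (bracket (v \<diamond> h)))"
        using eig[OF True] b g0 by (intro mult_left_mono) auto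
      then show ?thesis unfolding ll_V_HH[OF v h] by (simp only: mult_ac)
    next
      case False
      then have "\<not> 0 < pn m ee (v \<diamond> h)" for m
        using b V_mult_HH(1)[OF v h] unfolding visited_def by blast
      then have "pn m ee (v \<diamond> h) = 0" for m
        using taboo_nonneg[of UNIV m ee "v \<diamond> h"] by (simp add: less_eq_real_def)
      then show ?thesis by simp
    qed
  qed
  also have "\<dots> = \<rho> * (\<Sum>w\<in>sphere k. \<gamma> (bracket w) * exp (c * ll w) * (\<Sum>m\<le>M. pn m ee w * z ^ m))"
    by (simp only: sum_sphere_HH sum_distrib_left)
  finally show ?thesis .
qed

lemma finite_sphere': "finite (sphere k)"
  unfolding sphere_def by (rule finite_sphere)

text \<open>Masses of successive spheres decay geometrically, so the exponential moments with
  weights \<open>z ^ m\<close> are summable over time. Markov's inequality and Borel-Cantelli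
  conclude.\<close>

lemma chernoff_AE:
  fixes \<gamma> :: "'a amalg \<Rightarrow> real"
  assumes z: "0 < z" and sm: "\<And>h t. h \<in> HH \<Longrightarrow> t \<in> FF \<Longrightarrow> summable (\<lambda>n. cross h t n * z ^ Suc n)"
    and \<gamma>: "\<And>t. t \<in> FF \<Longrightarrow> 0 < \<gamma> t" and \<rho>: "0 \<le> \<rho>" "\<rho> < 1"
    and eig: "\<And>s. s \<in> visited \<Longrightarrow> (\<Sum>t\<in>{t \<in> FF. ltype t \<noteq> ltype s}. crossz (Hpart s) t z
        * exp (c * ll t) * \<gamma> t) \<le> \<rho> * \<gamma> s"
    and bd: "\<And>M w. w \<in> carrier G \<Longrightarrow> (\<Sum>m\<le>M. pn m ee w * z ^ m) \<le> \<beta>"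
  shows "AE \<omega> in P ee. \<forall>\<^sub>F m in sequentially. z ^ m * exp (c * ll (X m \<omega>)) < 1"
proof -
  interpret P: prob_space "P ee" using prob_P GG.one_closed .
  define gM where "gM M w = (\<Sum>m\<le>M. pn m ee w * z ^ m)" for M w
  have gM0: "0 \<le> gM M w" for M w unfolding gM_def using z by (intro sum_nonneg mult_nonneg_nonneg taboo_nonneg) auto
  define A where "A k M = (\<Sum>w\<in>sphere k. \<gamma> (bracket w) * exp (c * ll w) * gM M w)" for k M
  \<comment> \<open>The recursion starts at level 1, because \<open>bracket\<close> is meaningful
    only for nonempty words. Levels 0 and 1 are finite sets and are bounded directly through
    \<open>\<beta>\<close>.\<close>
  define a1 where "a1 = (\<Sum>w\<in>sphere 1. \<gamma> (bracket w) * exp (c * ll w) * \<beta>)"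
  have sp: "w \<in> carrier G" "1 \<le> k \<Longrightarrow> bracket w \<in> FF" if "w \<in> sphere k" for w k
    using that bracket_FF[of w] by (auto simp: sphere_def Suc_le_eq)
  have A_geo: "A (Suc j) M \<le> \<rho> ^ j * a1" for j M
  proof (induction j)
    case 0
    have "\<gamma> (bracket w) * exp (c * ll w) * gM M w \<le> \<gamma> (bracket w) * exp (c * ll w) * \<beta>" if w: "w \<in> sphere 1" for w
    proof (rule mult_left_mono)
      show "gM M w \<le> \<beta>" unfolding gM_def by (rule bd[OF sp(1)[OF w]])
      show "0 \<le> \<gamma> (bracket w) * exp (c * ll w)" using \<gamma>[OF sp(2)[OF w]] by simp
    qed
    then show ?case unfolding A_def a1_def power_0 mult_1 One_nat_def by (rule sum_mono)
  next
    case (Suc j)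
    have "A (Suc (Suc j)) M \<le> \<rho> * A (Suc j) M"
      unfolding A_def gM_def by (rule sphere_recursion[OF z sm \<gamma> \<rho>(1) eig]) auto
    also have "\<dots> \<le> \<rho> * (\<rho> ^ j * a1)" using Suc \<rho> by (intro mult_left_mono) auto
    finally show ?case by simp
  qed
  obtain \<gamma>0 where \<gamma>0: "0 < \<gamma>0" "\<And>t. t \<in> FF \<Longrightarrow> \<gamma>0 \<le> \<gamma> t"
    using finite_positive_lower_bound[of "\<gamma> ` FF"] finite_FF \<gamma> by (metis (no_types, lifting) finite_imageI imageE imageI)
  define U where "U k M = (\<Sum>w\<in>sphere k. exp (c * ll w) * gM M w)" for k M
  define u0 where "u0 = (\<Sum>w\<in>sphere 0. exp (c * ll w) * \<beta>)"
  have U0: "U 0 M \<le> u0" for M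
    unfolding U_def u0_def gM_def using bd sp(1) by (intro sum_mono mult_left_mono) auto
  have USuc: "U (Suc j) M \<le> \<rho> ^ j * (a1 / \<gamma>0)" for j M
  proof -
    have "\<gamma>0 * U (Suc j) M \<le> A (Suc j) M"
      unfolding U_def A_def sum_distrib_left
    proof (rule sum_mono)
      fix w assume "w \<in> sphere (Suc j)"
      then have "\<gamma>0 \<le> \<gamma> (bracket w)" using sp(2)[of w "Suc j"] \<gamma>0(2) by simp
      then show "\<gamma>0 * (exp (c * ll w) * gM M w) \<le> \<gamma> (bracket w) * exp (c * ll w) * gM M w"
        unfolding mult.assoc using gM0 by (intro mult_right_mono) auto
    qed
    also have "\<dots> \<le> \<rho> ^ j * a1" by (rule A_geo)
    finally show ?thesis using \<gamma>0(1) by (simp add: field_simps)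
  qed
  have a10: "0 \<le> a1 / \<gamma>0"
  proof -
    have "0 \<le> U 1 0" unfolding U_def using gM0 by (intro sum_nonneg) auto
    then show ?thesis using USuc[of 0 0] by simp
  qed
  define K where "K = u0 + (a1 / \<gamma>0) / (1 - \<rho>)"
  have UK: "(\<Sum>k\<le>M. U k M) \<le> K" for M
  proof -
    have "(\<Sum>k\<le>M. U k M) \<le> (\<Sum>k\<le>Suc M. U k M)"
      unfolding U_def using gM0 by (intro sum_mono2 sum_nonneg) auto
    also have "\<dots> = U 0 M + (\<Sum>j\<le>M. U (Suc j) M)" by (rule sum.atMost_Suc_shift)
    also have "\<dots> \<le> u0 + (\<Sum>j\<le>M. \<rho> ^ j * (a1 / \<gamma>0))" by (intro add_mono U0 sum_mono USuc)
    also have "(\<Sum>j\<le>M. \<rho> ^ j * (a1 / \<gamma>0)) = (\<Sum>j\<le>M. \<rho> ^ j) * (a1 / \<gamma>0)" by (rule sum_distrib_right[symmetric])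
    also have "\<dots> \<le> 1 / (1 - \<rho>) * (a1 / \<gamma>0)"
    proof (rule mult_right_mono[OF _ a10])
      have "(\<Sum>j\<le>M. \<rho> ^ j) \<le> (\<Sum>j. \<rho> ^ j)" using \<rho> by (intro sum_le_suminf) (auto intro!: summable_geometric)
      then show "(\<Sum>j\<le>M. \<rho> ^ j) \<le> 1 / (1 - \<rho>)" using \<rho> by (simp add: suminf_geometric)
    qed
    finally show ?thesis by (simp add: K_def mult.commute)
  qed
  \<comment> \<open>This is \<open>z ^ m\<close> times the mean of
    \<open>exp (c * ll (X m))\<close>: at time \<open>m\<close> the word length is at most
    \<open>m\<close> almost surely. For \<open>m \<le> M\<close> only levels up to \<open>M\<close>
    occur, so the sum over \<open>m\<close> is at most the sum of the \<open>U k M\<close>.\<close>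
  define E where "E m = (\<Sum>k\<le>m. \<Sum>w\<in>sphere k. exp (c * ll w) * (pn m ee w * z ^ m))" for m
  have E0: "0 \<le> exp (c * ll w) * (pn m ee w * z ^ m)" for m w
    using z by (intro mult_nonneg_nonneg taboo_nonneg) auto
  have EK: "(\<Sum>m\<le>M. E m) \<le> K" for M
  proof -
    have "(\<Sum>m\<le>M. E m) \<le> (\<Sum>m\<le>M. \<Sum>k\<le>M. \<Sum>w\<in>sphere k. exp (c * ll w) * (pn m ee w * z ^ m))"
      unfolding E_def using E0 by (intro sum_mono sum_mono2 sum_nonneg) auto
    also have "\<dots> = (\<Sum>k\<le>M. \<Sum>w\<in>sphere k. \<Sum>m\<le>M. exp (c * ll w) * (pn m ee w * z ^ m))"
      by (subst sum.swap, rule sum.cong[OF HOL.refl], rule sum.swap)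
    also have "\<dots> = (\<Sum>k\<le>M. U k M)" by (simp only: U_def gM_def sum_distrib_left)
    finally show ?thesis using UK[of M] by simp
  qed
  define B where "B m = {w \<in> (\<Union>k\<le>m. sphere k). 1 \<le> z ^ m * exp (c * ll w)}" for m
  have finB: "finite (B m)" for m by (auto simp: B_def finite_sphere')
  have ev: "{\<omega> \<in> space (P ee). X m \<omega> \<in> B m} \<in> P.events" for m by measurable
  have PB: "\<P>(\<omega> in P ee. X m \<omega> \<in> B m) \<le> E m" for m
  proof -
    have "\<P>(\<omega> in P ee. X m \<omega> \<in> B m) = (\<Sum>w\<in>B m. pn m ee w)" by (rule prob_finite[OF finB GG.one_closed])
    also have "\<dots> \<le> (\<Sum>w\<in>B m. exp (c * ll w) * (pn m ee w * z ^ m))"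
    proof (rule sum_mono)
      fix w assume "w \<in> B m"
      then have "pn m ee w * 1 \<le> pn m ee w * (z ^ m * exp (c * ll w))"
        by (intro mult_left_mono taboo_nonneg) (simp add: B_def)
      then show "pn m ee w \<le> exp (c * ll w) * (pn m ee w * z ^ m)" by (simp only: mult_ac mult_1_right mult_1)
    qed
    also have "\<dots> \<le> (\<Sum>w\<in>(\<Union>k\<le>m. sphere k). exp (c * ll w) * (pn m ee w * z ^ m))"
      using E0 finite_sphere' by (intro sum_mono2) (auto simp: B_def)
    also have "\<dots> = E m" unfolding E_def
      by (rule sum.UNION_disjoint) (auto simp: finite_sphere sphere_def)
    finally show ?thesis .
  qed
  have "summable (\<lambda>m. \<P>(\<omega> in P ee. X m \<omega> \<in> B m))"
  proof (rule summableI_nonneg_bounded)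
    fix n
    have "(\<Sum>m<n. \<P>(\<omega> in P ee. X m \<omega> \<in> B m)) \<le> (\<Sum>m\<le>n. \<P>(\<omega> in P ee. X m \<omega> \<in> B m))"
      by (rule sum_mono2) auto
    also have "\<dots> \<le> (\<Sum>m\<le>n. E m)" by (intro sum_mono PB)
    also have "\<dots> \<le> K" by (rule EK)
    finally show "(\<Sum>m<n. \<P>(\<omega> in P ee. X m \<omega> \<in> B m)) \<le> K" .
  qed simp
  then have "AE \<omega> in P ee. \<forall>\<^sub>F m in sequentially. \<omega> \<in> space (P ee) - {\<omega> \<in> space (P ee).
      X m \<omega> \<in> B m}"
    using ev by (intro borel_cantelli_AE1) (auto simp: P.emeasure_eq_measure)
  then show ?thesis using AE_length_le AE_space
  proof eventually_elim
    case (elim \<omega>)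
    show ?case using elim(1)
    proof eventually_elim
      case (elim m)
      have "X m \<omega> \<in> carrier G" by (rule X_carrier[OF GG.one_closed \<open>\<omega> \<in> space (P ee)\<close>])
      then have "X m \<omega> \<in> (\<Union>k\<le>m. sphere k)"
        using \<open>\<forall>m. length (word (X m \<omega>)) \<le> m\<close> by (auto simp: sphere_def)
      then show ?case using elim by (auto simp: B_def not_le)
    qed
  qed
qed

section \<open>Exit times\<close>

definition beyond :: "nat \<Rightarrow> 'a amalg set" where
  "beyond k = {w \<in> carrier G. k < length (word w)}"

lemma \<xi>_pos: "0 < \<xi> i"
proof -
  obtain g where g: "g \<in> FF" "0 < stepw g" "0 < esc g" "ltype g \<noteq> i" using ex_escape_type by blast
  have "0 < stepw g * esc g" using g by simp
  also have "\<dots> \<le> \<xi> i" unfolding \<xi>_eq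
    by (rule member_le_sum) (use g finite_FF stepw_nonneg esc_nonneg in auto)
  finally show ?thesis .
qed

lemma HH_mult_cone:
  assumes "h \<in> HH" "g \<in> gens"
  shows "h \<diamond> g \<in> cone i \<longleftrightarrow> g \<in> FF \<and> ltype g \<noteq> i"
proof -
  have "h \<diamond> g \<in> FF \<longleftrightarrow> g \<in> FF"
    using HH_mult_gens[OF assms] assms(2) HH_mult_HH_iff[OF assms(1) gens_carrier[OF assms(2)]]
    unfolding gens_eq by (auto simp: FF_eq HH_eq)
  then show ?thesis using gens_cone[OF HH_mult_gens[OF assms]] HH_mult_ltype[OF assms] by simp
qed

lemma V_beyond:
  assumes v: "v \<in> reps k" and b: "b \<in> cone (ltype v) \<union> gens"
  shows "v \<diamond> b \<in> beyond k \<longleftrightarrow> b \<in> cone (ltype v)"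
proof (cases "b \<in> cone (ltype v)")
  case True
  then show ?thesis using length_V_mult[OF v, of b] v by (auto simp: beyond_def cone_def reps_def)
next
  case False
  then have "b \<in> gens" using b by blast
  then show ?thesis using V_step[OF v] False v gens_carrier by (auto simp: beyond_def reps_def)
qed

text \<open>From \<open>v h\<close> only steps \<open>g\<close> of a type other than that of
  \<open>v\<close> lead beyond level \<open>k\<close>, and staying there means avoiding
  \<open>HH\<close> after translation. The limit does not depend on \<open>h\<close>, as left
  multiplication by \<open>HH\<close> preserves the escape probabilities.\<close>

lemma tail_lim:
  assumes v: "v \<in> reps k" and h: "h \<in> HH"
  shows "(\<lambda>n. \<Sum>g\<in>gens. stepw g * stay (beyond k) n (v \<diamond> h \<diamond> g)) \<longlonglongrightarrow> \<xi> (ltype v)"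
proof -
  have vc: "v \<in> carrier G" and hc: "h \<in> carrier G" using v h by (auto simp: reps_def HH_carrier)
  have e: "stay (beyond k) n (v \<diamond> h \<diamond> g) = (if g \<in> FF \<and> ltype g \<noteq> ltype v then stay (cone 0) n g
      else 0)" if g: "g \<in> gens" for g n
  proof -
    have gc: "g \<in> carrier G" using gens_carrier g .
    have hg: "h \<diamond> g \<in> gens" by (rule HH_mult_gens[OF h g])
    have as: "v \<diamond> h \<diamond> g = v \<diamond> (h \<diamond> g)" using vc hc gc by (simp add: GG.m_assoc)
    show ?thesis
    proof (cases "g \<in> FF \<and> ltype g \<noteq> ltype v")
      case True
      then have A: "h \<diamond> g \<in> cone (ltype v)" using HH_mult_cone[OF h g] by simp
      have "stay (beyond k) n (v \<diamond> (h \<diamond> g)) = stay (cone 0) n (h \<diamond> g)"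
      proof (rule stay_translate[where D = "cone (ltype v) \<union> HH"])
        fix b assume b: "b \<in> cone (ltype v) \<union> HH"
        then show "(b \<in> cone 0) = (v \<diamond> b \<in> beyond k)" using V_beyond[OF v, of b] cone_HH_iff[OF b] by (auto simp: gens_eq)
      next
        fix b g' assume b: "b \<in> cone (ltype v) \<union> HH" "b \<in> cone 0" "g' \<in> gens"
        then have "b \<in> cone (ltype v)" using cone_HH_iff by blast
        then show "b \<diamond> g' \<in> cone (ltype v) \<union> HH" using cone_step b(3) by blast
      qed (use vc A cone_HH_carrier in simp_all)
      then show ?thesis unfolding as using True stay_HH_mult[OF h gc] by simp
    next
      case False
      then have "v \<diamond> (h \<diamond> g) \<notin> beyond k" using HH_mult_cone[OF h g] V_beyond[OF v, of "h \<diamond> g"] hg by blast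
      then show ?thesis unfolding as using False by (auto simp: stay_notin)
    qed
  qed
  have "(\<Sum>g\<in>gens. stepw g * stay (beyond k) n (v \<diamond> h \<diamond> g)) = (\<Sum>g\<in>{g \<in> FF. ltype g \<noteq>
      ltype v}. stepw g * stay (cone 0) n g)" for n
  proof -
    have "(\<Sum>g\<in>gens. stepw g * stay (beyond k) n (v \<diamond> h \<diamond> g)) =
      (\<Sum>g\<in>gens. if g \<in> FF \<and> ltype g \<noteq> ltype v then stepw g * stay (cone 0) n g else 0)"
      by (rule sum.cong[OF HOL.refl]) (simp add: e)
    also have "\<dots> = (\<Sum>g\<in>{g \<in> FF. ltype g \<noteq> ltype v}. stepw g * stay (cone 0) n g)"
      by (rule sum.mono_neutral_cong_right) (auto simp: finite_HH finite_FF gens_eq)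
    finally show ?thesis .
  qed
  then show ?thesis unfolding \<xi>_eq by (auto intro!: tendsto_sum tendsto_mult_left esc_lim)
qed

text \<open>The event is the decreasing intersection of events with finite horizon. Each of these
  factors by the Markov property at times \<open>m\<close> and \<open>m + n\<close>, and
  \<open>\<sigma>\<close> is the limit of the last factor.\<close>

lemma two_phase:
  assumes \<sigma>: "(\<lambda>n. \<Sum>g\<in>gens. stepw g * stay A' n (b \<diamond> g)) \<longlonglongrightarrow> \<sigma>"
  shows "\<P>(\<omega> in P ee. X m \<omega> = a \<and> (\<forall>j\<in>{1..n}. X (m + j) \<omega> \<in> A) \<and> X (m + n)
      \<omega> = b \<and> (\<forall>j\<ge>1. X (m + n + j) \<omega> \<in> A'))
    = pn m ee a * (taboo A n a b * \<sigma>)"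
proof -
  interpret P: prob_space "P ee" using prob_P GG.one_closed .
  define N' where "N' N = m + (n + Suc N)" for N
  define \<psi> where "\<psi> N ws \<longleftrightarrow> ws ! m = a \<and> (\<forall>j\<in>{1..n}. ws ! (m + j) \<in> A) \<and> ws
      ! (m + n) = b \<and>
    (\<forall>j\<in>{1..Suc N}. ws ! (m + n + j) \<in> A')" for N and ws :: "'a amalg list"
  define E where "E N = {\<omega> \<in> space (P ee). \<psi> N (path (N' N) \<omega>)}" for N
  have E: "E N = {\<omega> \<in> space (P ee). X m \<omega> = a \<and> (\<forall>j\<in>{1..n}. X (m + j) \<omega> \<in> A) \<and> X
      (m + n) \<omega> = b \<and>
    (\<forall>j\<in>{1..Suc N}. X (m + n + j) \<omega> \<in> A')}" for N
    unfolding E_def \<psi>_def by (intro Collect_cong) (auto simp: N'_def)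
  have pathE: "P.prob (E N) = pn m ee a * (taboo A n a b * (\<Sum>g\<in>gens. stepw g * stay A' N (b \<diamond> g)))" for N
  proof -
    have "P.prob (E N) = pathE (N' N) ee (\<lambda>ws. of_bool (\<psi> N ws))"
      unfolding E_def by (rule prob_pathE) simp
    also have "\<dots> = pathE (m + (n + Suc N)) ee (\<lambda>ws. of_bool (\<forall>j\<in>{1..m}. ws ! j \<in> UNIV) * (of_bool (ws ! m = a) *
      (\<lambda>us. of_bool (\<forall>j\<in>{1..n}. us ! j \<in> A) * (of_bool (us ! n = b) *
        (\<lambda>vs. of_bool (\<forall>j\<in>{1..Suc N}. vs ! j \<in> A')) (drop n us))) (drop m ws)))"
      unfolding N'_def
    proof (rule pathE_cong)
      fix ws :: "'a amalg list" assume len: "length ws = Suc (m + (n + Suc N))"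
      have 1: "drop m ws ! j = ws ! (m + j)" "drop n (drop m ws) ! j = ws ! (m + n + j)" for j
        using len by (simp_all add: add_ac)
      show "of_bool (\<psi> N ws) = (of_bool (\<forall>j\<in>{1..m}. ws ! j \<in> UNIV) * (of_bool (ws ! m = a) *
        (\<lambda>us. of_bool (\<forall>j\<in>{1..n}. us ! j \<in> A) * (of_bool (us ! n = b) *
        (\<lambda>vs. of_bool (\<forall>j\<in>{1..Suc N}. vs ! j \<in> A')) (drop n us))) (drop m ws)) :: real)"
        unfolding \<psi>_def 1 by (simp only: of_bool_conj) simp
    qed
    also have "\<dots> = pn m ee a * (taboo A n a b * (\<Sum>g\<in>gens. stepw g * stay A' N (b \<diamond> g)))"
      unfolding pathE_Markov[of m "n + Suc N" ee UNIV a "\<lambda>us. of_bool (\<forall>j\<in>{1..n}. us ! j \<in> A) * (of_bool (us ! n = b) *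
        of_bool (\<forall>j\<in>{1..Suc N}. drop n us ! j \<in> A'))"]
        pathE_Markov[of n "Suc N" a A b "\<lambda>vs. of_bool (\<forall>j\<in>{1..Suc N}. vs ! j \<in> A')"] pathE_stay_pos
      by (rule HOL.refl)
    finally show ?thesis .
  qed
  have lim: "(\<lambda>N. P.prob (E N)) \<longlonglongrightarrow> P.prob (\<Inter>N. E N)"
  proof (rule P.finite_Lim_measure_decseq)
    show "range E \<subseteq> P.events"
    proof (rule image_subsetI)
      fix N show "E N \<in> P.events" unfolding E_def using measurable_path[OF GG.one_closed, of "\<psi> N" "N' N"] by simp
    qed
    show "decseq E" unfolding E decseq_def by fastforce
  qed
  have Int: "(\<Inter>N. E N) = {\<omega> \<in> space (P ee). X m \<omega> = a \<and> (\<forall>j\<in>{1..n}. X (m + j) \<omega>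
      \<in> A) \<and> X (m + n) \<omega> = b \<and>
    (\<forall>j\<ge>1. X (m + n + j) \<omega> \<in> A')}"
  proof -
    have all: "(\<forall>N. \<forall>j\<in>{1..Suc N}. C j) \<longleftrightarrow> (\<forall>j\<ge>1. C j)" for C :: "nat \<Rightarrow> bool"
      by (meson atLeastAtMost_iff le_SucI order_refl)
    have pull: "(\<forall>N\<in>(UNIV::nat set). C1 \<and> C2 \<and> C3 \<and> C4 \<and> C5 N) \<longleftrightarrow> C1 \<and> C2
        \<and> C3 \<and> C4 \<and> (\<forall>N. C5 N)"
      for C1 C2 C3 C4 C5 by blast
    show ?thesis
    proof (rule Set.set_eqI)
      fix \<omega>
      show "\<omega> \<in> (\<Inter>N. E N) \<longleftrightarrow> \<omega> \<in> {\<omega> \<in> space (P ee). X m \<omega> = a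
          \<and> (\<forall>j\<in>{1..n}. X (m + j) \<omega> \<in> A) \<and> X (m + n) \<omega> = b \<and>
        (\<forall>j\<ge>1. X (m + n + j) \<omega> \<in> A')}"
        unfolding E INT_iff mem_Collect_eq all[of "\<lambda>j. X (m + n + j) \<omega> \<in> A'", symmetric] by (rule pull)
    qed
  qed
  have lim': "(\<lambda>N. P.prob (E N)) \<longlonglongrightarrow> pn m ee a * (taboo A n a b * \<sigma>)"
    unfolding pathE by (intro tendsto_mult_left \<sigma>)
  show ?thesis using LIMSEQ_unique[OF lim lim'] unfolding Int .
qed

text \<open>By exponential decay and Borel-Cantelli each finite sphere is visited finitely often, so
  \<open>exit_seq\<close> applies to the word length along almost every path.\<close>

lemma AE_exit: "AE \<omega> in P ee. \<forall>k m. exit_time k \<omega> = m \<longleftrightarrow> X m \<omega> \<in> sphere k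
    \<and> (\<forall>j\<ge>1. X (m + j) \<omega> \<in> beyond k)"
proof -
  interpret P: prob_space "P ee" using prob_P GG.one_closed .
  obtain C \<rho> where C: "0 \<le> C" "0 < \<rho>" "\<rho> < 1" "\<And>n a b. a \<in> carrier G \<Longrightarrow> b \<in> carrier
      G \<Longrightarrow> pn n a b \<le> C * \<rho> ^ n"
    using exp_decay by blast
  have "AE \<omega> in P ee. \<forall>\<^sub>F m in sequentially. \<omega> \<in> space (P ee) - {\<omega> \<in> space (P ee). X m
      \<omega> \<in> sphere k}" for k
  proof (rule borel_cantelli_AE1)
    show "{\<omega> \<in> space (P ee). X m \<omega> \<in> sphere k} \<in> P.events" for m by measurable
    show "emeasure (P ee) {\<omega> \<in> space (P ee). X m \<omega> \<in> sphere k} < \<infinity>" for m by (simp add: P.emeasure_eq_measure)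
    show "summable (\<lambda>m. P.prob {\<omega> \<in> space (P ee). X m \<omega> \<in> sphere k})"
      unfolding prob_finite[OF finite_sphere' GG.one_closed]
    proof (rule summable_sum)
      fix w assume "w \<in> sphere k"
      then have w: "w \<in> carrier G" by (simp add: sphere_def)
      show "summable (\<lambda>n. pn n ee w)"
        by (rule summable_comparison_test'[of "\<lambda>n. C * \<rho> ^ n" 0])
          (use C w taboo_nonneg in \<open>auto intro!: summable_mult summable_geometric\<close>)
    qed
  qed
  then have "AE \<omega> in P ee. \<forall>k. \<forall>\<^sub>F m in sequentially. \<omega> \<in> space (P ee) - {\<omega> \<in>
      space (P ee). X m \<omega> \<in> sphere k}"
    by (subst AE_all_countable) simp
  then show ?thesis using AE_steps[OF GG.one_closed] AE_X0[OF GG.one_closed] AE_space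
  proof eventually_elim
    case (elim \<omega>)
    have c: "X m \<omega> \<in> carrier G" for m by (rule X_carrier[OF GG.one_closed elim(4)])
    define L where "L m = length (word (X m \<omega>))" for m
    have fin: "finite {m. L m = k}" for k
    proof -
      obtain N where "\<forall>m\<ge>N. X m \<omega> \<notin> sphere k" using elim(1) elim(4) by (auto simp: eventually_sequentially)
      then have "{m. L m = k} \<subseteq> {..<N}" 
        using c by (fastforce simp: L_def sphere_def not_le[symmetric])
      then show ?thesis using finite_subset by blast
    qed
    have st: "L (Suc m) \<le> Suc (L m)" for m
    proof -
      obtain g where "g \<in> gens" "X (Suc m) \<omega> = X m \<omega> \<diamond> g" using elim by blast
      then show ?thesis using length_step(1)[OF c] by (simp add: L_def)
    qed
    have L0: "L 0 = 0" using elim by (simp add: L_def word_one)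
    show ?case
    proof (intro allI)
      fix k m
      have "exit_time k \<omega> = Sup {m. L m = k}" unfolding exit_time_def using c by (simp add: wlen_eq L_def)
      then have "exit_time k \<omega> = m \<longleftrightarrow> L m = k \<and> (\<forall>j>m. k < L j)" using exit_seq[OF L0 st fin] by simp
      also have "(\<forall>j>m. k < L j) \<longleftrightarrow> (\<forall>j\<ge>1. k < L (m + j))"
        by (metis One_nat_def Suc_leI less_add_same_cancel1 less_eq_Suc_le less_imp_add_positive)
      finally show "exit_time k \<omega> = m \<longleftrightarrow> X m \<omega> \<in> sphere k \<and> (\<forall>j\<ge>1. X (m + j)
          \<omega> \<in> beyond k)"
        using c by (simp add: sphere_def beyond_def L_def)
    qed
  qed
qed

section \<open>Joint laws of the exit points\<close>

lemma measurable_exit [measurable]: "exit_time k \<in> measurable (P ee) (count_space UNIV)"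
proof -
  have [measurable]: "ee \<in> carrier G" by simp
  show ?thesis unfolding exit_time_def by measurable
qed

lemma measurable_W [measurable]: "(\<lambda>\<omega>. f (W k \<omega>)) \<in> measurable (P ee) (count_space UNIV)"
  unfolding W_def
  by (rule measurable_compose_countable[where g = "exit_time k" and f = "\<lambda>m \<omega>. f (X m \<omega>)"])
    (auto intro: measurable_exit measurable_X')

text \<open>Splits according to the value of the exit time and the position at that time. The extra
  event \<open>C\<close> allows the same splitting for the joint law of two successive exit
  points.\<close>

lemma exit_decomp:
  assumes C: "Measurable.pred (P ee) C"
  shows "(\<lambda>m. \<Sum>w\<in>{w \<in> sphere k. bracket w = s}. \<P>(\<omega> in P ee. C \<omega> \<and> X m \<omega> = w
      \<and> (\<forall>j\<ge>1. X (m + j) \<omega> \<in> beyond k)))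
    sums \<P>(\<omega> in P ee. C \<omega> \<and> bracket (W k \<omega>) = s)"
proof -
  interpret P: prob_space "P ee" using prob_P GG.one_closed .
  have e: "ee \<in> carrier G" by simp
  note [measurable] = C
  let ?S = "{w \<in> sphere k. bracket w = s}"
  define E where "E m w = {\<omega> \<in> space (P ee). C \<omega> \<and> X m \<omega> = w \<and> (\<forall>j\<ge>1. X (m + j)
      \<omega> \<in> beyond k)}" for m w
  define F where "F m = {\<omega> \<in> space (P ee). exit_time k \<omega> = m \<and> C \<omega> \<and> bracket (W k \<omega>) = s}" for m
  have Em: "E m w \<in> P.events" for m w unfolding E_def using e by measurable
  have Fm: "F m \<in> P.events" for m unfolding F_def by measurable
  have fS: "finite ?S" using finite_sphere' by simp
  have "(\<lambda>m. P.prob (F m)) sums P.prob (\<Union>m. F m)"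
    by (rule P.finite_measure_UNION) (use Fm in \<open>auto simp: disjoint_family_on_def F_def\<close>)
  also have "(\<Union>m. F m) = {\<omega> \<in> space (P ee). C \<omega> \<and> bracket (W k \<omega>) = s}" by (auto simp: F_def)
  also have "(\<lambda>m. P.prob (F m)) = (\<lambda>m. \<Sum>w\<in>?S. P.prob (E m w))"
  proof
    fix m
    have "P.prob (F m) = P.prob (\<Union>w\<in>?S. E m w)"
    proof (rule measure_eq_AE)
      show "AE \<omega> in P ee. (\<omega> \<in> F m) = (\<omega> \<in> (\<Union>w\<in>?S. E m w))"
        using AE_exit
      proof eventually_elim
        case (elim \<omega>)
        have ex: "exit_time k \<omega> = m \<longleftrightarrow> X m \<omega> \<in> sphere k \<and> (\<forall>j\<ge>1. X (m + j)
            \<omega> \<in> beyond k)" using elim by blast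
        have "\<omega> \<in> F m \<longleftrightarrow> \<omega> \<in> space (P ee) \<and> exit_time k \<omega> = m \<and> C
            \<omega> \<and> bracket (X m \<omega>) = s"
          by (auto simp: F_def W_def)
        also have "\<dots> \<longleftrightarrow> \<omega> \<in> (\<Union>w\<in>?S. E m w)" unfolding ex E_def by auto
        finally show ?case .
      qed
    qed (use Em Fm fS in auto)
    also have "\<dots> = (\<Sum>w\<in>?S. P.prob (E m w))"
      by (rule P.finite_measure_finite_Union[OF fS]) (use Em in \<open>auto simp: disjoint_family_on_def E_def\<close>)
    finally show "P.prob (F m) = (\<Sum>w\<in>?S. P.prob (E m w))" .
  qed
  finally show ?thesis unfolding E_def .
qed

lemma hit_prob:
  assumes w: "w \<in> sphere k"
  shows "\<P>(\<omega> in P ee. X m \<omega> = w \<and> (\<forall>j\<ge>1. X (m + j) \<omega> \<in> beyond k)) = pn m ee w * \<xi> (ltype w)"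
proof -
  have wc: "w \<in> carrier G" "length (word w) = k" using w by (auto simp: sphere_def)
  obtain v h where v: "v \<in> reps k" "h \<in> HH" "w = v \<diamond> h" "ltype v = ltype w"
    using coset_cases[OF wc(1)] wc(2) by metis
  show ?thesis using two_phase[OF tail_lim[OF v(1,2)], of m "v \<diamond> h" 0 UNIV] v(3,4) by simp
qed

lemma sphere_bracket:
  assumes "w \<in> sphere k" "1 \<le> k"
  shows "bracket w \<in> FF" "ltype (bracket w) = ltype w" "w \<in> carrier G" "word w \<noteq> []"
proof -
  show w: "w \<in> carrier G" "word w \<noteq> []" using assms by (auto simp: sphere_def)
  show "bracket w \<in> FF" "ltype (bracket w) = ltype w" by (rule bracket_FF[OF w], rule ltype_bracket[OF w])
qed

lemma law_bracket:
  "(\<lambda>m. \<Sum>w\<in>{w \<in> sphere k. bracket w = s}. pn m ee w * \<xi> (ltype w)) sums \<P>(\<omega> in P ee. bracket (W k \<omega>) = s)"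
proof -
  have "(\<lambda>m. \<Sum>w\<in>{w \<in> sphere k. bracket w = s}. \<P>(\<omega> in P ee. True \<and> X m \<omega> = w \<and>
      (\<forall>j\<ge>1. X (m + j) \<omega> \<in> beyond k)))
    sums \<P>(\<omega> in P ee. True \<and> bracket (W k \<omega>) = s)"
    by (rule exit_decomp) simp
  moreover have "(\<Sum>w\<in>{w \<in> sphere k. bracket w = s}. \<P>(\<omega> in P ee. True \<and> X m \<omega> = w \<and>
      (\<forall>j\<ge>1. X (m + j) \<omega> \<in> beyond k))) =
    (\<Sum>w\<in>{w \<in> sphere k. bracket w = s}. pn m ee w * \<xi> (ltype w))" for m
    unfolding simp_thms by (rule sum.cong[OF HOL.refl]) (rule hit_prob, simp)
  ultimately show ?thesis by (simp only: simp_thms)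
qed

text \<open>A path from \<open>v h\<close> that stays beyond level \<open>k\<close> stays in the
  cone below \<open>v\<close>, where \<open>v t\<close> is the only candidate of length
  \<open>k + 1\<close> with bracket \<open>t\<close>. The set \<open>D\<close> includes
  \<open>v HH\<close> because the starting point is not constrained.\<close>

lemma taboo_beyond_sum:
  assumes v: "v \<in> reps k" and h: "h \<in> HH" and t: "t \<in> FF"
  shows "(\<Sum>w\<in>{w \<in> sphere (Suc k). bracket w = t}. taboo (beyond k) (Suc n) (v \<diamond> h) w * \<xi> (ltype w)) =
    (if ltype t \<noteq> ltype v then cross h t n * \<xi> (ltype t) else 0)"
proof -
  let ?S = "{w \<in> sphere (Suc k). bracket w = t}"
  have vc: "v \<in> carrier G" using v by (simp add: reps_def)
  define D where "D = (\<lambda>b. v \<diamond> b) ` (cone (ltype v) \<union> HH)"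
  have closed: "a \<diamond> g \<in> D" if a: "a \<in> D" "g \<in> gens" "a \<diamond> g \<in> beyond k" for a g
  proof -
    obtain b where b: "b \<in> cone (ltype v) \<union> HH" "a = v \<diamond> b" using a by (auto simp: D_def)
    have bc: "b \<in> carrier G" using b cone_HH_carrier by blast
    have e: "a \<diamond> g = v \<diamond> (b \<diamond> g)" using b(2) vc bc gens_carrier[OF a(2)] by (simp add: GG.m_assoc)
    have "b \<diamond> g \<in> cone (ltype v) \<union> HH"
    proof (cases "b \<in> HH")
      case True
      then have "b \<diamond> g \<in> gens" by (rule HH_mult_gens[OF _ a(2)])
      then show ?thesis using V_beyond[OF v, of "b \<diamond> g"] a(3) e by auto
    next
      case False
      then show ?thesis using b cone_step[OF _ a(2)] by blast
    qed
    then show ?thesis unfolding e D_def by blast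
  qed
  have start: "v \<diamond> h \<in> D" using h by (auto simp: D_def)
  have zero: "taboo (beyond k) (Suc n) (v \<diamond> h) w = 0" if w: "w \<in> ?S" "\<not> (w = v \<diamond> t \<and> ltype t \<noteq> ltype v)" for w
  proof (rule taboo_confined[OF closed start])
    show "w \<notin> D"
    proof
      assume "w \<in> D"
      then obtain b where b: "b \<in> cone (ltype v) \<union> HH" "w = v \<diamond> b" by (auto simp: D_def)
      have "length (word b) = 1" using length_V_mult[OF v b(1)] w(1) b(2) by (simp add: sphere_def)
      then have bF: "b \<in> FF" "b \<in> cone (ltype v)" using b by (auto simp: FF_eq HH_eq cone_def)
      then have lt: "ltype b \<noteq> ltype v" using gens_cone[of b "ltype v"] by (simp add: gens_eq)
      then have "bracket w = b" unfolding b(2) by (rule V_mult_FF(3)[OF v bF(1)])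
      then show False using w b lt by auto
    qed
  qed
  show ?thesis
  proof (cases "ltype t \<noteq> ltype v")
    case True
    note m = V_mult_FF[OF v t True]
    have tS: "v \<diamond> t \<in> ?S" using m by (simp add: sphere_def)
    have "(\<Sum>w\<in>?S. taboo (beyond k) (Suc n) (v \<diamond> h) w * \<xi> (ltype w)) =
      (\<Sum>w\<in>{v \<diamond> t}. taboo (beyond k) (Suc n) (v \<diamond> h) w * \<xi> (ltype w))"
    proof (rule sum.mono_neutral_right)
      show "finite ?S" using finite_sphere' by simp
      show "{v \<diamond> t} \<subseteq> ?S" using tS by blast
      show "\<forall>w\<in>?S - {v \<diamond> t}. taboo (beyond k) (Suc n) (v \<diamond> h) w * \<xi> (ltype w) = 0"
      proof
        fix w assume w: "w \<in> ?S - {v \<diamond> t}"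
        have "taboo (beyond k) (Suc n) (v \<diamond> h) w = 0" by (rule zero) (use w in auto)
        then show "taboo (beyond k) (Suc n) (v \<diamond> h) w * \<xi> (ltype w) = 0" by (simp only: mult_zero_left)
      qed
    qed
    also have "\<dots> = cross h t n * \<xi> (ltype t)"
    proof -
      have "ltype (v \<diamond> t) = ltype t" using sphere_bracket(2)[of "v \<diamond> t" "Suc k"] tS by simp
      then show ?thesis using taboo_cone[OF v t True h V_beyond[OF v], of n] by (simp del: taboo.simps)
    qed
    finally show ?thesis using True by simp
  next
    case False
    have "(\<Sum>w\<in>?S. taboo (beyond k) (Suc n) (v \<diamond> h) w * \<xi> (ltype w)) = 0"
    proof (rule sum.neutral, rule)
      fix w assume w: "w \<in> ?S"
      have "taboo (beyond k) (Suc n) (v \<diamond> h) w = 0" by (rule zero[OF w]) (use False in auto)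
      then show "taboo (beyond k) (Suc n) (v \<diamond> h) w * \<xi> (ltype w) = 0" by (simp only: mult_zero_left)
    qed
    then show ?thesis using False by simp
  qed
qed

lemma cross_sums:
  assumes h: "h \<in> HH" and t: "t \<in> FF" and z: "0 \<le> z" "z * \<rho> < 1" "0 \<le> \<rho>"
    and decay: "\<And>n a b. a \<in> carrier G \<Longrightarrow> b \<in> carrier G \<Longrightarrow> pn n a b \<le> C * \<rho> ^ n"
  shows "summable (\<lambda>n. cross h t n * z ^ Suc n)"
proof -
  have le: "taboo A n a b \<le> pn n a b" for A n a b
    by (induction n arbitrary: a) (auto intro!: sum_mono mult_left_mono stepw_nonneg simp: taboo_nonneg)
  have "summable (\<lambda>n. stepw g * (taboo (cone 0) n (h \<diamond> g) t * z ^ n) * z)" if g: "g \<in> FacX (ltype t)" for g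
  proof (intro summable_mult summable_mult2)
    have gc: "g \<in> carrier G" using g FacX_ltype[OF ltype_FF[OF t]] FF_carrier by auto
    show "summable (\<lambda>n. taboo (cone 0) n (h \<diamond> g) t * z ^ n)"
    proof (rule summable_comparison_test'[of "\<lambda>n. C * (z * \<rho>) ^ n" 0])
      show "summable (\<lambda>n. C * (z * \<rho>) ^ n)" using z by (intro summable_mult summable_geometric) auto
      fix n
      have "taboo (cone 0) n (h \<diamond> g) t * z ^ n \<le> C * \<rho> ^ n * z ^ n"
        using order_trans[OF le decay[of "h \<diamond> g" t n]] h HH_carrier gc t FF_carrier z
        by (intro mult_right_mono) auto
      then show "norm (taboo (cone 0) n (h \<diamond> g) t * z ^ n) \<le> C * (z * \<rho>) ^ n"
        using z taboo_nonneg[of "cone 0" n "h \<diamond> g" t] by (simp add: power_mult_distrib mult_ac)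
    qed
  qed
  then have "summable (\<lambda>n. \<Sum>g\<in>FacX (ltype t). stepw g * (taboo (cone 0) n (h \<diamond> g) t * z ^ n) * z)"
    by (rule summable_sum)
  moreover have "(\<Sum>g\<in>FacX (ltype t). stepw g * (taboo (cone 0) n (h \<diamond> g) t * z ^ n) * z) = cross h t n * z ^ Suc n" for n
    unfolding cross_def sum_distrib_right by (rule sum.cong) simp_all
  ultimately show ?thesis by (simp only:)
qed

lemma cross_summable: "h \<in> HH \<Longrightarrow> t \<in> FF \<Longrightarrow> summable (cross h t)"
proof -
  assume h: "h \<in> HH" and t: "t \<in> FF"
  obtain C \<rho> where C: "0 \<le> C" "0 < \<rho>" "\<rho> < 1" "\<And>n a b. a \<in> carrier G \<Longrightarrow> b \<in> carrier
      G \<Longrightarrow> pn n a b \<le> C * \<rho> ^ n"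
    using exp_decay by blast
  show ?thesis using cross_sums[OF h t, of 1 \<rho> C] C by simp
qed

lemma crossz_one: "crossz h t 1 = suminf (cross h t)"
  by (simp add: crossz_def)

text \<open>The exit from level \<open>k + 1\<close> comes after that from level \<open>k\<close>,
  so the terms up to time \<open>m\<close> vanish. For exit at \<open>m + n + 1\<close>, being
  beyond level \<open>k + 1\<close> afterwards implies being beyond \<open>k\<close>; the infinite
  condition on level \<open>k\<close> thus shrinks to the \<open>n + 1\<close> steps in between and
  \<open>two_phase\<close> applies.\<close>

lemma joint_law:
  assumes w: "w \<in> sphere k" and k: "1 \<le> k" and t: "t \<in> FF"
  shows "\<P>(\<omega> in P ee. (X m \<omega> = w \<and> (\<forall>j\<ge>1. X (m + j) \<omega> \<in> beyond k)) \<and> bracket (W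
      (Suc k) \<omega>) = t) =
    pn m ee w * (if ltype t \<noteq> ltype w then crossz (Hpart (bracket w)) t 1 * \<xi> (ltype t) else 0)" (is "?L = ?R")
proof -
  have e: "ee \<in> carrier G" by simp
  have wc: "w \<in> carrier G" "length (word w) = k" using w by (auto simp: sphere_def)
  obtain v h where v: "v \<in> reps k" "h \<in> HH" "w = v \<diamond> h" "ltype v = ltype w"
    using coset_cases[OF wc(1)] wc(2) by metis
  have hb: "Hpart (bracket w) = h" using Hpart_bracket_V(1)[OF v(1) k v(2)] v(3) by simp
  let ?S = "{w' \<in> sphere (Suc k). bracket w' = t}"
  define f where "f m' = (\<Sum>w'\<in>?S. \<P>(\<omega> in P ee. (X m \<omega> = w \<and> (\<forall>j\<ge>1. X (m + j) \<omega>
      \<in> beyond k)) \<and> X m' \<omega> = w' \<and>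
    (\<forall>j\<ge>1. X (m' + j) \<omega> \<in> beyond (Suc k))))" for m'
  have fs: "f sums ?L" unfolding f_def by (rule exit_decomp) (use e in measurable)
  have f0: "f m' = 0" if m': "m' < Suc m" for m'
    unfolding f_def
  proof (rule sum.neutral, rule)
    fix w' assume w': "w' \<in> ?S"
    have "{\<omega> \<in> space (P ee). (X m \<omega> = w \<and> (\<forall>j\<ge>1. X (m + j) \<omega> \<in> beyond k)) \<and> X m'
        \<omega> = w' \<and>
      (\<forall>j\<ge>1. X (m' + j) \<omega> \<in> beyond (Suc k))} = {}"
    proof (rule equals0I)
      fix \<omega> assume "\<omega> \<in> {\<omega> \<in> space (P ee). (X m \<omega> = w \<and> (\<forall>j\<ge>1. X (m + j)
          \<omega> \<in> beyond k)) \<and> X m' \<omega> = w' \<and>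
        (\<forall>j\<ge>1. X (m' + j) \<omega> \<in> beyond (Suc k))}"
      then have *: "X m \<omega> = w" "X m' \<omega> = w'" "\<And>j. 1 \<le> j \<Longrightarrow> X (m' + j) \<omega> \<in> beyond (Suc k)" by auto
      show False
      proof (cases "m' = m")
        case True
        then show False using * w w' by (auto simp: sphere_def)
      next
        case False
        then have "X (m' + (m - m')) \<omega> \<in> beyond (Suc k)" using m' by (intro *(3)) simp
        then show False using m' * w by (simp add: beyond_def sphere_def)
      qed
    qed
    then show "\<P>(\<omega> in P ee. (X m \<omega> = w \<and> (\<forall>j\<ge>1. X (m + j) \<omega> \<in> beyond k)) \<and> X m' \<omega> = w' \<and>
      (\<forall>j\<ge>1. X (m' + j) \<omega> \<in> beyond (Suc k))) = 0" by (simp only: measure_empty)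
  qed
  have fn: "f (n + Suc m) = pn m ee w * (if ltype t \<noteq> ltype w then cross h t n * \<xi> (ltype t) else 0)" for n
  proof -
    have "f (n + Suc m) = (\<Sum>w'\<in>?S. pn m ee w * (taboo (beyond k) (Suc n) w w' * \<xi> (ltype w')))"
      unfolding f_def
    proof (rule sum.cong[OF HOL.refl])
      fix w' assume w': "w' \<in> ?S"
      have w'c: "w' \<in> carrier G" "length (word w') = Suc k" using w' by (auto simp: sphere_def)
      obtain v' h' where v': "v' \<in> reps (Suc k)" "h' \<in> HH" "w' = v' \<diamond> h'" "ltype v' = ltype w'"
        using coset_cases[OF w'c(1)] w'c(2) by metis
      have idx: "n + Suc m = m + Suc n" by simp
      have "(X m \<omega> = w \<and> (\<forall>j\<ge>1. X (m + j) \<omega> \<in> beyond k)) \<and> X (n + Suc m) \<omega> = w'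
          \<and> (\<forall>j\<ge>1. X (n + Suc m + j) \<omega> \<in> beyond (Suc k)) \<longleftrightarrow>
        X m \<omega> = w \<and> (\<forall>j\<in>{1..Suc n}. X (m + j) \<omega> \<in> beyond k) \<and> X (m + Suc n) \<omega> = w'
            \<and> (\<forall>j\<ge>1. X (m + Suc n + j) \<omega> \<in> beyond (Suc k))" for \<omega>
        unfolding idx
      proof safe
        fix j :: nat assume A: "\<forall>j\<in>{1..Suc n}. X (m + j) \<omega> \<in> beyond k" and B: "\<forall>j\<ge>1. X (m + Suc
            n + j) \<omega> \<in> beyond (Suc k)" and j: "1 \<le> j"
        show "X (m + j) \<omega> \<in> beyond k"
        proof (cases "j \<le> Suc n")
          case True
          then show ?thesis using A j by simp
        next
          case False
          then have "X (m + Suc n + (j - Suc n)) \<omega> \<in> beyond (Suc k)" using B[rule_format, of "j - Suc n"] by simp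
          then show ?thesis using False by (simp add: beyond_def)
        qed
      qed auto
      then have "\<P>(\<omega> in P ee. (X m \<omega> = w \<and> (\<forall>j\<ge>1. X (m + j) \<omega> \<in> beyond k)) \<and> X (n
          + Suc m) \<omega> = w' \<and> (\<forall>j\<ge>1. X (n + Suc m + j) \<omega> \<in> beyond (Suc k))) =
        \<P>(\<omega> in P ee. X m \<omega> = w \<and> (\<forall>j\<in>{1..Suc n}. X (m + j) \<omega> \<in> beyond k) \<and> X (m +
            Suc n) \<omega> = w' \<and> (\<forall>j\<ge>1. X (m + Suc n + j) \<omega> \<in> beyond (Suc k)))"
        by (simp only:)
      also have "\<dots> = pn m ee w * (taboo (beyond k) (Suc n) w w' * \<xi> (ltype w'))"
        using two_phase[OF tail_lim[OF v'(1,2)]] unfolding v'(3)[symmetric] v'(4) .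
      finally show "\<P>(\<omega> in P ee. (X m \<omega> = w \<and> (\<forall>j\<ge>1. X (m + j) \<omega> \<in> beyond k)) \<and> X
          (n + Suc m) \<omega> = w' \<and> (\<forall>j\<ge>1. X (n + Suc m + j) \<omega> \<in> beyond (Suc k))) =
        pn m ee w * (taboo (beyond k) (Suc n) w w' * \<xi> (ltype w'))" .
    qed
    also have "\<dots> = pn m ee w * (\<Sum>w'\<in>?S. taboo (beyond k) (Suc n) w w' * \<xi> (ltype w'))" by (rule sum_distrib_left[symmetric])
    also have "(\<Sum>w'\<in>?S. taboo (beyond k) (Suc n) w w' * \<xi> (ltype w')) = (if ltype t \<noteq> ltype w then cross h t n
        * \<xi> (ltype t) else 0)"
      using taboo_beyond_sum[OF v(1,2) t, of n] unfolding v(3)[symmetric] v(4) .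
    finally show ?thesis .
  qed
  have "(\<lambda>n. f (n + Suc m)) sums ?L" using sums_zero_iff_shift[of "Suc m" f, OF f0] fs by blast
  moreover have "(\<lambda>n. f (n + Suc m)) sums ?R"
  proof (cases "ltype t \<noteq> ltype w")
    case True
    have "(\<lambda>n. pn m ee w * (cross h t n * \<xi> (ltype t))) sums (pn m ee w * (crossz h t 1 * \<xi> (ltype t)))"
      unfolding crossz_one by (intro sums_mult sums_mult2 summable_sums cross_summable v t)
    then show ?thesis using True fn hb by simp
  next
    case False
    then show ?thesis using fn by simp
  qed
  ultimately show ?thesis by (rule sums_unique2)
qed

text \<open>The Doob transform of \<open>K(1)\<close> by \<open>\<xi>\<close>, restricted to
  transitions between different types.\<close>

definition chainp :: "'a amalg \<Rightarrow> 'a amalg \<Rightarrow> real" where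
  "chainp s t = (if ltype t \<noteq> ltype s then crossz (Hpart s) t 1 * \<xi> (ltype t) / \<xi> (ltype s) else 0)"

text \<open>The Markov property of the exit chain: in \<open>joint_law\<close> the factor after
  \<open>pn m ee w\<close> depends on \<open>w\<close> only through its bracket, so it can be taken
  out of the sum over positions and times.\<close>

lemma two_step_law:
  assumes k: "1 \<le> k" and t: "t \<in> FF"
  shows "\<P>(\<omega> in P ee. bracket (W (Suc k) \<omega>) = t \<and> bracket (W k \<omega>) = s) = \<P>(\<omega> in P ee.
      bracket (W k \<omega>) = s) * chainp s t"
proof -
  let ?S = "{w \<in> sphere k. bracket w = s}"
  have "(\<lambda>m. \<Sum>w\<in>?S. \<P>(\<omega> in P ee. bracket (W (Suc k) \<omega>) = t \<and> X m \<omega> = w \<and>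
      (\<forall>j\<ge>1. X (m + j) \<omega> \<in> beyond k)))
    sums \<P>(\<omega> in P ee. bracket (W (Suc k) \<omega>) = t \<and> bracket (W k \<omega>) = s)"
    by (rule exit_decomp) (use measurable_W[of "\<lambda>w. bracket w = t" "Suc k"] in simp)
  moreover have "(\<lambda>m. \<Sum>w\<in>?S. \<P>(\<omega> in P ee. bracket (W (Suc k) \<omega>) = t \<and> X m \<omega> = w
      \<and> (\<forall>j\<ge>1. X (m + j) \<omega> \<in> beyond k)))
    = (\<lambda>m. (\<Sum>w\<in>?S. pn m ee w * \<xi> (ltype w)) * chainp s t)"
  proof
    fix m
    show "(\<Sum>w\<in>?S. \<P>(\<omega> in P ee. bracket (W (Suc k) \<omega>) = t \<and> X m \<omega> = w \<and>
        (\<forall>j\<ge>1. X (m + j) \<omega> \<in> beyond k))) =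
      (\<Sum>w\<in>?S. pn m ee w * \<xi> (ltype w)) * chainp s t"
      unfolding sum_distrib_right
    proof (rule sum.cong[OF HOL.refl])
      fix w assume w: "w \<in> ?S"
      then have b: "ltype s = ltype w" "bracket w = s" using sphere_bracket(2)[of w k] k by auto
      have "\<P>(\<omega> in P ee. bracket (W (Suc k) \<omega>) = t \<and> X m \<omega> = w \<and> (\<forall>j\<ge>1. X (m + j)
          \<omega> \<in> beyond k)) =
        \<P>(\<omega> in P ee. (X m \<omega> = w \<and> (\<forall>j\<ge>1. X (m + j) \<omega> \<in> beyond k)) \<and> bracket (W
            (Suc k) \<omega>) = t)"
        by (intro arg_cong[where f = "measure (P ee)"] Collect_cong) auto
      also have "\<dots> = pn m ee w * (if ltype t \<noteq> ltype w then crossz (Hpart (bracket w)) t 1 * \<xi> (ltype t) else 0)"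
        by (rule joint_law[OF _ k t]) (use w in simp)
      also have "\<dots> = pn m ee w * \<xi> (ltype w) * chainp s t" using b \<xi>_pos[of "ltype w"] by (simp add: chainp_def)
      finally show "\<P>(\<omega> in P ee. bracket (W (Suc k) \<omega>) = t \<and> X m \<omega> = w \<and> (\<forall>j\<ge>1. X (m
          + j) \<omega> \<in> beyond k)) =
        pn m ee w * \<xi> (ltype w) * chainp s t" .
    qed
  qed
  ultimately show ?thesis using sums_mult2[OF law_bracket[of k s], of "chainp s t"] sums_unique2 by (simp only:) blast
qed

text \<open>As \<open>\<xi>\<close> is positive, a point has positive probability of being an exit
  point if and only if the walk reaches it.\<close>

lemma S_eq: "S = visited"
proof (intro equalityI subsetI)
  fix s assume "s \<in> S"
  then obtain k where k: "1 \<le> k" "0 < \<P>(\<omega> in P ee. bracket (W k \<omega>) = s)" by (auto simp: S_def)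
  have "\<exists>m. \<exists>w\<in>{w \<in> sphere k. bracket w = s}. 0 < pn m ee w"
  proof (rule ccontr)
    assume "\<not> ?thesis"
    then have "pn m ee w = 0" if "w \<in> {w \<in> sphere k. bracket w = s}" for m w
      using that taboo_nonneg[of UNIV m ee w] by (auto simp: less_eq_real_def)
    then have "(\<Sum>w\<in>{w \<in> sphere k. bracket w = s}. pn m ee w * \<xi> (ltype w)) = 0" for m by simp
    then have "(\<lambda>m. 0) sums \<P>(\<omega> in P ee. bracket (W k \<omega>) = s)" using law_bracket[of k s] by (simp only:)
    then have "\<P>(\<omega> in P ee. bracket (W k \<omega>) = s) = 0" by (rule sums_unique2[OF _ sums_zero])
    then show False using k(2) by simp
  qed
  then obtain m w where w: "w \<in> sphere k" "bracket w = s" "0 < pn m ee w" by blast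
  then show "s \<in> visited" using sphere_bracket[OF w(1) k(1)] unfolding visited_def by blast
next
  fix s assume "s \<in> visited"
  then obtain m w where w: "w \<in> carrier G" "word w \<noteq> []" "bracket w = s" "0 < pn m ee w" by (auto simp: visited_def)
  define k where "k = length (word w)"
  let ?S = "{w \<in> sphere k. bracket w = s}"
  have wS: "w \<in> ?S" using w by (simp add: sphere_def k_def)
  have nn: "0 \<le> pn m ee w * \<xi> (ltype w)" for m w using taboo_nonneg \<xi>_pos by (intro mult_nonneg_nonneg less_imp_le[OF \<xi>_pos]) auto
  have "0 < pn m ee w * \<xi> (ltype w)" using w \<xi>_pos by simp
  also have "\<dots> \<le> (\<Sum>w\<in>?S. pn m ee w * \<xi> (ltype w))"
    by (rule member_le_sum[OF wS]) (use nn finite_sphere' in auto)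
  also have "\<dots> = (\<Sum>m\<in>{m}. \<Sum>w\<in>?S. pn m ee w * \<xi> (ltype w))" by simp
  also have "\<dots> \<le> suminf (\<lambda>m. \<Sum>w\<in>?S. pn m ee w * \<xi> (ltype w))"
    by (rule sum_le_suminf[OF sums_summable[OF law_bracket]]) (use nn in \<open>auto intro: sum_nonneg\<close>)
  also have "\<dots> = \<P>(\<omega> in P ee. bracket (W k \<omega>) = s)" by (rule sums_unique[OF law_bracket, symmetric])
  finally have "0 < \<P>(\<omega> in P ee. bracket (W k \<omega>) = s)" .
  moreover have "1 \<le> k" using w by (simp add: k_def Suc_le_eq)
  ultimately show "s \<in> S" unfolding S_def by blast
qed

lemma S_FF: "S \<subseteq> FF"
  unfolding S_eq visited_def by blast

lemma finite_S: "finite S"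
  using finite_subset[OF S_FF finite_FF] .

lemma S_index:
  assumes "s \<in> S"
  obtains k where "1 \<le> k" "0 < \<P>(\<omega> in P ee. bracket (W k \<omega>) = s)"
    "\<And>t. Q s t = \<P>(\<omega> in P ee. bracket (W (Suc k) \<omega>) = t \<and> bracket (W k \<omega>) = s) / \<P>(\<omega> in
        P ee. bracket (W k \<omega>) = s)"
proof -
  define k where "k = (LEAST k. 1 \<le> k \<and> 0 < \<P>(\<omega> in P ee. bracket (W k \<omega>) = s))"
  have "\<exists>k. 1 \<le> k \<and> 0 < \<P>(\<omega> in P ee. bracket (W k \<omega>) = s)" using assms by (auto simp: S_def)
  then have "1 \<le> k \<and> 0 < \<P>(\<omega> in P ee. bracket (W k \<omega>) = s)" unfolding k_def by (rule LeastI_ex)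
  moreover have "Q s t = \<P>(\<omega> in P ee. bracket (W (Suc k) \<omega>) = t \<and> bracket (W k \<omega>) = s) / \<P>(\<omega>
      in P ee. bracket (W k \<omega>) = s)" for t
    unfolding Q_def Let_def k_def[symmetric] cond_prob_def ..
  ultimately show ?thesis using that by blast
qed

text \<open>Time homogeneity: the particular index selected by \<open>LEAST\<close> in
  \<open>Q\<close> drops out.\<close>

lemma Q_eq: "s \<in> S \<Longrightarrow> t \<in> FF \<Longrightarrow> Q s t = chainp s t"
  by (erule S_index) (simp add: two_step_law)

lemma Q_nonneg: "s \<in> S \<Longrightarrow> 0 \<le> Q s t"
  by (erule S_index) simp

lemma Q_outside:
  assumes s: "s \<in> S" and t: "t \<notin> S"
  shows "Q s t = 0"
proof -
  interpret P: prob_space "P ee" using prob_P GG.one_closed .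
  obtain k where k: "1 \<le> k" "0 < \<P>(\<omega> in P ee. bracket (W k \<omega>) = s)"
    "\<And>t. Q s t = \<P>(\<omega> in P ee. bracket (W (Suc k) \<omega>) = t \<and> bracket (W k \<omega>) = s) / \<P>(\<omega> in
        P ee. bracket (W k \<omega>) = s)"
    by (rule S_index[OF s]) blast
  have "\<P>(\<omega> in P ee. bracket (W (Suc k) \<omega>) = t \<and> bracket (W k \<omega>) = s) \<le> \<P>(\<omega> in P ee.
      bracket (W (Suc k) \<omega>) = t)"
    by (rule P.finite_measure_mono) (use measurable_W[of "\<lambda>w. bracket w = t" "Suc k"] in auto)
  also have "\<dots> = 0"
  proof -
    have "\<not> 0 < \<P>(\<omega> in P ee. bracket (W (Suc k) \<omega>) = t)"
    proof
      assume *: "0 < \<P>(\<omega> in P ee. bracket (W (Suc k) \<omega>) = t)"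
      have "1 \<le> Suc k" by simp
      with * have "t \<in> S" unfolding S_def by blast
      then show False using t by simp
    qed
    then show ?thesis using measure_nonneg[of "P ee" "{\<omega> \<in> space (P ee). bracket (W (Suc k) \<omega>) = t}"] by linarith
  qed
  finally have "\<P>(\<omega> in P ee. bracket (W (Suc k) \<omega>) = t \<and> bracket (W k \<omega>) = s) = 0"
    using measure_nonneg[of "P ee" "{\<omega> \<in> space (P ee). bracket (W (Suc k) \<omega>) = t \<and> bracket (W k \<omega>) = s}"] by linarith
  then show ?thesis using k(3)[of t] by simp
qed

lemma AE_W_sphere: "AE \<omega> in P ee. W k \<omega> \<in> sphere k"
  using AE_exit
proof eventually_elim
  case (elim \<omega>)
  then have "X (exit_time k \<omega>) \<omega> \<in> sphere k" by blast
  then show ?case by (simp add: W_def)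
qed

text \<open>The chain does not die: almost surely the next exit point lies on its sphere and has a
  bracket in \<open>FF\<close>, and states outside \<open>S\<close> receive no mass.\<close>

lemma Q_sum:
  assumes s: "s \<in> S"
  shows "(\<Sum>t\<in>S. Q s t) = 1"
proof -
  interpret P: prob_space "P ee" using prob_P GG.one_closed .
  obtain k where k: "1 \<le> k" "0 < \<P>(\<omega> in P ee. bracket (W k \<omega>) = s)"
    "\<And>t. Q s t = \<P>(\<omega> in P ee. bracket (W (Suc k) \<omega>) = t \<and> bracket (W k \<omega>) = s) / \<P>(\<omega> in
        P ee. bracket (W k \<omega>) = s)"
    by (rule S_index[OF s]) blast
  define E where "E t = {\<omega> \<in> space (P ee). bracket (W (Suc k) \<omega>) = t \<and> bracket (W k \<omega>) = s}" for t
  have E: "E t \<in> P.events" for t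
    unfolding E_def using measurable_W[of "\<lambda>w. bracket w = t" "Suc k"] measurable_W[of "\<lambda>w. bracket w = s" k] by measurable
  have "(\<Sum>t\<in>S. Q s t) = (\<Sum>t\<in>FF. Q s t)"
    by (rule sum.mono_neutral_left) (use finite_FF S_FF Q_outside[OF s] in auto)
  also have "\<dots> = (\<Sum>t\<in>FF. P.prob (E t)) / \<P>(\<omega> in P ee. bracket (W k \<omega>) = s)"
    by (simp add: k(3) E_def sum_divide_distrib)
  also have "(\<Sum>t\<in>FF. P.prob (E t)) = P.prob (\<Union>t\<in>FF. E t)"
    by (rule P.finite_measure_finite_Union[symmetric, OF finite_FF]) (use E in \<open>auto simp: disjoint_family_on_def E_def\<close>)
  also have "\<dots> = \<P>(\<omega> in P ee. bracket (W k \<omega>) = s)"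
  proof (rule measure_eq_AE)
    show "AE \<omega> in P ee. (\<omega> \<in> (\<Union>t\<in>FF. E t)) = (\<omega> \<in> {\<omega> \<in> space (P ee). bracket (W k \<omega>) = s})"
      using AE_W_sphere[of "Suc k"]
    proof eventually_elim
      case (elim \<omega>)
      then have "bracket (W (Suc k) \<omega>) \<in> FF" by (rule sphere_bracket(1)) simp
      then show ?case by (auto simp: E_def)
    qed
    show "(\<Union>t\<in>FF. E t) \<in> P.events" using E finite_FF by auto
    show "{\<omega> \<in> space (P ee). bracket (W k \<omega>) = s} \<in> P.events"
      using measurable_W[of "\<lambda>w. bracket w = s" k] by simp
  qed
  finally show ?thesis using k(2) by simp
qed

section \<open>Generating functions of the exit chain\<close>

definition crossd :: "'a amalg \<Rightarrow> 'a amalg \<Rightarrow> real" where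
  "crossd h t = deriv (crossz h t) 1"

text \<open>The series converges beyond 1 by exponential decay. The inequality says that a crossing
  takes at least one step: each term has exponent at least 1, so differentiation at 1 does not
  decrease it.\<close>

lemma crossz_deriv:
  assumes h: "h \<in> HH" and t: "t \<in> FF"
  shows "(crossz h t has_field_derivative crossd h t) (at 1)" "crossz h t 1 \<le> crossd h t"
proof -
  obtain C \<rho> where C: "0 \<le> C" "0 < \<rho>" "\<rho> < 1" "\<And>n a b. a \<in> carrier G \<Longrightarrow> b \<in> carrier
      G \<Longrightarrow> pn n a b \<le> C * \<rho> ^ n"
    using exp_decay by blast
  \<comment> \<open>A point strictly between 1 and \<open>1 / \<rho>\<close>.\<close>
  define k where "k = 2 / (1 + \<rho>)"
  have k: "1 < k" "k * \<rho> < 1" using C by (auto simp: k_def field_simps)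
  have "summable (\<lambda>n. cross h t n * k ^ Suc n)" by (rule cross_sums[OF h t _ _ _ C(4)]) (use k C in auto)
  then have "summable (\<lambda>n. cross h t n * k ^ Suc n * inverse k)" by (rule summable_mult2)
  then have sm: "summable (\<lambda>n. cross h t n * k ^ n)" using k by (simp add: field_simps)
  define f where "f z = (\<Sum>n. cross h t n * z ^ n)" for z :: real
  have df: "(f has_field_derivative (\<Sum>n. diffs (cross h t) n * 1 ^ n)) (at 1)"
    unfolding f_def by (rule termdiffs_strong[OF sm]) (use k in simp)
  have Kf: "crossz h t z = z * f z" if "z \<in> {0<..<k}" for z
  proof -
    have "summable (\<lambda>n. cross h t n * z ^ n)"
      by (rule powser_inside[OF sm]) (use that in auto)
    then have "(\<Sum>n. z * (cross h t n * z ^ n)) = z * f z" unfolding f_def by (rule suminf_mult)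
    then show ?thesis by (simp add: crossz_def mult_ac)
  qed
  have d0: "((\<lambda>z. z * f z) has_field_derivative f 1 + (\<Sum>n. diffs (cross h t) n * 1 ^ n)) (at 1)"
    using DERIV_mult[OF DERIV_ident df] by simp
  have d: "(crossz h t has_field_derivative f 1 + (\<Sum>n. diffs (cross h t) n * 1 ^ n)) (at 1)"
    by (rule has_field_derivative_transform_within_open[OF d0, of "{0<..<k}"]) (use k Kf in auto)
  then have e: "crossd h t = f 1 + (\<Sum>n. diffs (cross h t) n * 1 ^ n)" unfolding crossd_def by (rule DERIV_imp_deriv)
  show "(crossz h t has_field_derivative crossd h t) (at 1)" using d e by simp
  have "summable (\<lambda>n. diffs (cross h t) n * 1 ^ n)" by (rule termdiff_converges[of 1 k]) (use k powser_inside[OF sm] in auto)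
  then have "0 \<le> (\<Sum>n. diffs (cross h t) n * 1 ^ n)"
    by (rule suminf_nonneg) (simp add: diffs_def cross_nonneg)
  then show "crossz h t 1 \<le> crossd h t" using e Kf[of 1] k by simp
qed

text \<open>Identifies the bracketed sums in the definitions of \<open>\<Lambda>\<close> and
  \<open>\<Delta>\<close> with entries of \<open>K(z)\<close>, for all \<open>z\<close> in the
  interval where exponential decay gives convergence.\<close>

lemma crossz_Gbar:
  assumes h: "h \<in> HH" and t: "t \<in> FF" and z: "0 \<le> z" "z * \<rho> < 1" "0 \<le> \<rho>"
    and decay: "\<And>n a b. a \<in> carrier G \<Longrightarrow> b \<in> carrier G \<Longrightarrow> pn n a b \<le> C * \<rho> ^ n"
  shows "(\<Sum>w\<in>FacX (ltype t). stepw w * z * Gbar (h \<diamond> w) t z) = crossz h t z"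
proof -
  have le: "taboo A n a b \<le> pn n a b" for A n a b
    by (induction n arbitrary: a) (auto intro!: sum_mono mult_left_mono stepw_nonneg simp: taboo_nonneg)
  have sm: "summable (\<lambda>n. taboo (cone 0) n (h \<diamond> w) t * z ^ n)" if w: "w \<in> FacX (ltype t)" for w
  proof (rule summable_comparison_test'[of "\<lambda>n. C * (z * \<rho>) ^ n" 0])
    have gc: "w \<in> carrier G" using w FacX_ltype[OF ltype_FF[OF t]] FF_carrier by auto
    show "summable (\<lambda>n. C * (z * \<rho>) ^ n)" using z by (intro summable_mult summable_geometric) auto
    fix n
    have "taboo (cone 0) n (h \<diamond> w) t * z ^ n \<le> C * \<rho> ^ n * z ^ n"
      using order_trans[OF le decay[of "h \<diamond> w" t n]] h HH_carrier gc t FF_carrier z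
      by (intro mult_right_mono) auto
    then show "norm (taboo (cone 0) n (h \<diamond> w) t * z ^ n) \<le> C * (z * \<rho>) ^ n"
      using z taboo_nonneg[of "cone 0" n "h \<diamond> w" t] by (simp add: power_mult_distrib mult_ac)
  qed
  have hw: "h \<diamond> w \<in> cone 0" if "w \<in> FacX (ltype t)" for w
  proof -
    have "w \<in> FF" "w \<in> gens" "ltype w \<noteq> 0" using that FacX_ltype[OF ltype_FF[OF t]] ltype_FF[OF t] by (auto simp: gens_eq)
    then show ?thesis using HH_mult_cone[OF h] by simp
  qed
  have "(\<Sum>w\<in>FacX (ltype t). stepw w * z * Gbar (h \<diamond> w) t z) =
    (\<Sum>w\<in>FacX (ltype t). \<Sum>n. stepw w * z * (taboo (cone 0) n (h \<diamond> w) t * z ^ n))"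
    by (rule sum.cong) (simp_all add: Gbar_eq[OF hw] suminf_mult[OF sm])
  also have "\<dots> = (\<Sum>n. \<Sum>w\<in>FacX (ltype t). stepw w * z * (taboo (cone 0) n (h \<diamond> w) t * z ^ n))"
    by (rule suminf_sum[symmetric]) (intro summable_mult sm)
  also have "\<dots> = crossz h t z"
    unfolding crossz_def cross_def sum_distrib_right by (intro arg_cong[where f = suminf] ext sum.cong) simp_all
  finally show ?thesis .
qed

section \<open>Rewriting the double sums over quadruples\<close>

lemma RR_reps: "RR = reps 1"
proof (intro equalityI subsetI)
  fix v assume "v \<in> RR"
  then obtain x where "reduced [x]" "v = emb x" by (auto simp: RR_eq)
  then show "v \<in> reps 1" using nfc_emb[of x] by (simp add: reps_def tail_def word_def)
next
  fix v assume "v \<in> reps 1"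
  then obtain x where v: "v \<in> carrier G" "tail v = \<one>\<^bsub>H\<^esub>" "word v = [x]" by (auto simp: reps_def length_Suc_conv)
  then have r: "reduced [x]" using reduced_word by metis
  have "nfc v = nfc (emb x)" using v nfc_emb[OF r] by (simp add: word_def tail_def prod_eq_iff)
  then have "v = emb x" using nfc_inject v nfc_emb[OF r] by blast
  then show "v \<in> RR" using r by (auto simp: RR_eq)
qed

lemma FF_bracket: "t \<in> FF \<Longrightarrow> bracket t = t"
proof -
  assume t: "t \<in> FF"
  then obtain x where x: "t \<in> carrier G" "word t = [x]" by (auto simp: FF_eq length_Suc_conv)
  then show ?thesis using bracket_eq_iff[of t t] t by (simp add: word_def tail_def prod_eq_iff)
qed

lemma RR_HH:
  assumes x: "x \<in> RR" and h: "h \<in> HH"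
  shows "x \<diamond> h \<in> FF" "Hpart (x \<diamond> h) = h" "\<tau> x = ltype (x \<diamond> h)" "l x = ll (x \<diamond> h)"
    "\<tau> (x \<diamond> h) = ltype (x \<diamond> h)"
proof -
  have v: "x \<in> reps 1" using x RR_reps by simp
  obtain x0 where x0: "reduced [x0]" "x = emb x0" using x by (auto simp: RR_eq)
  have xF: "x \<in> FF" using v by (auto simp: reps_def FF_eq)
  show F: "x \<diamond> h \<in> FF" using V_mult_HH[OF v h] v by (simp add: FF_eq reps_def)
  show "Hpart (x \<diamond> h) = h" using Hpart_bracket_V(1)[OF v _ h] FF_bracket[OF F] by simp
  have "ltype (x \<diamond> h) = ltype x" using V_mult_HH(3)[OF v h] by (simp add: ltype_def)
  then show "\<tau> x = ltype (x \<diamond> h)" using \<tau>_ltype[OF xF] by simp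
  have "word x = [x0]" using nfc_emb[OF x0(1)] x0(2) by (simp add: word_def)
  then have "ll x = l x" using x0(2) FF_carrier[OF xF] by (simp add: lext_eq)
  then show "l x = ll (x \<diamond> h)" using ll_V_HH[OF v h] by simp
  show "\<tau> (x \<diamond> h) = ltype (x \<diamond> h)" by (rule \<tau>_ltype[OF F])
qed

lemma RR_HH_bij: "bij_betw (\<lambda>(x, h). x \<diamond> h) (RR \<times> HH) FF"
  using sphere_decomp_HH[of 1] by (simp add: RR_reps FF_eq)

text \<open>The roles are reversed in a quadruple: \<open>y h'\<close> is the state \<open>s\<close>
  from which the chain moves, and \<open>x h\<close> is the next state \<open>t\<close>.\<close>

lemma sum_pairs:
  "(\<Sum>(x, h, y, h')\<in>pairs. F (x \<diamond> h) (y \<diamond> h')) = (\<Sum>s\<in>FF. \<Sum>t\<in>{t \<in> FF. ltype t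
      \<noteq> ltype s}. F t s)"
proof -
  let ?m = "\<lambda>(x, h, y, h'). (y \<diamond> h', x \<diamond> h)"
  have inj: "x = x' \<and> h = h'" if "x \<in> RR" "h \<in> HH" "x' \<in> RR" "h' \<in> HH" "x \<diamond> h = x' \<diamond> h'" for x h x' h'
    using that inj_onD[OF bij_betw_imp_inj_on[OF RR_HH_bij], of "(x, h)" "(x', h')"] by auto
  have surj: "\<exists>x\<in>RR. \<exists>h\<in>HH. t = x \<diamond> h" if "t \<in> FF" for t
  proof -
    have "t \<in> (\<lambda>(x, h). x \<diamond> h) ` (RR \<times> HH)" using that bij_betw_imp_surj_on[OF RR_HH_bij] by simp
    then show ?thesis by auto
  qed
  have "bij_betw ?m pairs (SIGMA s:FF. {t \<in> FF. ltype t \<noteq> ltype s})"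
    unfolding bij_betw_def
  proof
    show "inj_on ?m pairs"
    proof (rule inj_onI)
      fix a b assume a: "a \<in> pairs" and b: "b \<in> pairs" and e: "?m a = ?m b"
      obtain x h y h' where a': "a = (x, h, y, h')" by (cases a)
      obtain x2 h2 y2 h2' where b': "b = (x2, h2, y2, h2')" by (cases b)
      have "x = x2 \<and> h = h2" by (rule inj) (use a b e in \<open>auto simp: a' b' pairs_def\<close>)
      moreover have "y = y2 \<and> h' = h2'" by (rule inj) (use a b e in \<open>auto simp: a' b' pairs_def\<close>)
      ultimately show "a = b" by (simp add: a' b')
    qed
    show "?m ` pairs = (SIGMA s:FF. {t \<in> FF. ltype t \<noteq> ltype s})"
    proof (intro equalityI subsetI)
      fix q assume "q \<in> ?m ` pairs"
      then obtain x h y h' where q: "q = (y \<diamond> h', x \<diamond> h)" "x \<in> RR" "h \<in> HH" "y \<in> RR" "h' \<in> HH"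
        "\<tau> (x \<diamond> h) \<noteq> \<tau> (y \<diamond> h')" by (auto simp: pairs_def)
      then show "q \<in> (SIGMA s:FF. {t \<in> FF. ltype t \<noteq> ltype s})"
        using RR_HH[OF q(2,3)] RR_HH[OF q(4,5)] by simp
    next
      fix q assume q: "q \<in> (SIGMA s:FF. {t \<in> FF. ltype t \<noteq> ltype s})"
      then obtain x h y h' where xy: "q = (y \<diamond> h', x \<diamond> h)" "x \<in> RR" "h \<in> HH" "y \<in> RR" "h' \<in> HH"
        using surj[of "fst q"] surj[of "snd q"] by (metis (no_types, lifting) SigmaE mem_Collect_eq fst_conv snd_conv)
      then have "(x, h, y, h') \<in> pairs" using q RR_HH(5)[OF xy(2,3)] RR_HH(5)[OF xy(4,5)] by (simp add: pairs_def)
      then show "q \<in> ?m ` pairs" using xy(1) by (intro image_eqI[of _ _ "(x, h, y, h')"]) auto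
    qed
  qed
  from sum.reindex_bij_betw[OF this, of "\<lambda>(s, t). F t s"]
  have "(\<Sum>(x, h, y, h')\<in>pairs. F (x \<diamond> h) (y \<diamond> h')) = (\<Sum>(s, t)\<in>(SIGMA s:FF. {t \<in> FF. ltype t
      \<noteq> ltype s}). F t s)"
    by (simp add: case_prod_unfold)
  also have "\<dots> = (\<Sum>s\<in>FF. \<Sum>t\<in>{t \<in> FF. ltype t \<noteq> ltype s}. F t s)" using finite_FF by (subst sum.Sigma) auto
  finally show ?thesis .
qed

lemma \<Delta>_eq: "\<Delta> \<nu> = (\<Sum>s\<in>FF. \<Sum>t\<in>{t \<in> FF. ltype t \<noteq> ltype s}. pmf \<nu> s * (\<xi>
    (ltype t) / \<xi> (ltype s)) * ll t * crossz (Hpart s) t 1)"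
proof -
  obtain C \<rho> where C: "0 \<le> C" "0 < \<rho>" "\<rho> < 1" "\<And>n a b. a \<in> carrier G \<Longrightarrow> b \<in> carrier
      G \<Longrightarrow> pn n a b \<le> C * \<rho> ^ n"
    using exp_decay by blast
  let ?F = "\<lambda>t s. pmf \<nu> s * (\<xi> (ltype t) / \<xi> (ltype s)) * ll t * crossz (Hpart s) t 1"
  have "\<Delta> \<nu> = (\<Sum>(x, h, y, h')\<in>pairs. ?F (x \<diamond> h) (y \<diamond> h'))"
    unfolding \<Delta>_def
  proof (rule sum.cong[OF HOL.refl])
    fix q assume q: "q \<in> pairs"
    obtain x h y h' where q': "q = (x, h, y, h')" by (cases q)
    have m: "x \<in> RR" "h \<in> HH" "y \<in> RR" "h' \<in> HH" using q by (auto simp: pairs_def q')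
    note t = RR_HH[OF m(1,2)] and s = RR_HH[OF m(3,4)]
    have "(\<Sum>w\<in>FacX (ltype (x \<diamond> h)). p \<alpha> \<mu> (y \<diamond> h') (y \<diamond> h' \<diamond> w) * Gbar (h'
        \<diamond> w) (x \<diamond> h) 1) =
      (\<Sum>w\<in>FacX (ltype (x \<diamond> h)). stepw w * 1 * Gbar (h' \<diamond> w) (x \<diamond> h) 1)"
      using FacX_ltype[OF ltype_FF[OF t(1)]] by (intro sum.cong) (auto simp: p_mult FF_carrier[OF s(1)] FF_carrier)
    also have "\<dots> = crossz h' (x \<diamond> h) 1"
      by (rule crossz_Gbar[OF m(4) t(1) _ _ _ C(4)]) (use C in auto)
    finally show "(case q of (x, h, y, h') \<Rightarrow> pmf \<nu> (y \<diamond> h') * (\<xi> (\<tau> (x \<diamond> h)) / \<xi>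
        (\<tau> (y \<diamond> h'))) * l x *
      (\<Sum>w\<in>FacX (\<tau> x). p \<alpha> \<mu> (y \<diamond> h') (y \<diamond> h' \<diamond> w) * Gbar (h' \<diamond> w) (x \<diamond> h) 1)) =
      (case q of (x, h, y, h') \<Rightarrow> ?F (x \<diamond> h) (y \<diamond> h'))"
      using t s by (simp add: q')
  qed
  then show ?thesis unfolding sum_pairs[of ?F] .
qed

lemma \<Lambda>_eq: "\<Lambda> \<nu> = (\<Sum>s\<in>FF. \<Sum>t\<in>{t \<in> FF. ltype t \<noteq> ltype s}. pmf \<nu> s * (\<xi>
    (ltype t) / \<xi> (ltype s)) * crossd (Hpart s) t)"
proof -
  obtain C \<rho> where C: "0 \<le> C" "0 < \<rho>" "\<rho> < 1" "\<And>n a b. a \<in> carrier G \<Longrightarrow> b \<in> carrier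
      G \<Longrightarrow> pn n a b \<le> C * \<rho> ^ n"
    using exp_decay by blast
  let ?F = "\<lambda>t s. pmf \<nu> s * (\<xi> (ltype t) / \<xi> (ltype s)) * crossd (Hpart s) t"
  have "\<Lambda> \<nu> = (\<Sum>(x, h, y, h')\<in>pairs. ?F (x \<diamond> h) (y \<diamond> h'))"
    unfolding \<Lambda>_def
  proof (rule sum.cong[OF HOL.refl])
    fix q assume q: "q \<in> pairs"
    obtain x h y h' where q': "q = (x, h, y, h')" by (cases q)
    have m: "x \<in> RR" "h \<in> HH" "y \<in> RR" "h' \<in> HH" using q by (auto simp: pairs_def q')
    note t = RR_HH[OF m(1,2)] and s = RR_HH[OF m(3,4)]
    have "deriv (\<lambda>z. \<Sum>w\<in>FacX (ltype (x \<diamond> h)). p \<alpha> \<mu> (y \<diamond> h') (y \<diamond> h'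
        \<diamond> w) * z * Gbar (h' \<diamond> w) (x \<diamond> h) z) 1 =
      crossd h' (x \<diamond> h)"
      unfolding crossd_def
    proof (rule deriv_cong_ev)
      \<comment> \<open>A derivative requires agreement near 1 and not just at 1; the open interval
        up to \<open>1 / \<rho>\<close> is such a neighbourhood.\<close>
      have "\<forall>\<^sub>F z in nhds 1. z \<in> {0<..<1 / \<rho>}" by (rule eventually_nhds_in_open) (use C in auto)
      then show "\<forall>\<^sub>F z in nhds 1. (\<Sum>w\<in>FacX (ltype (x \<diamond> h)). p \<alpha> \<mu> (y \<diamond> h') (y
          \<diamond> h' \<diamond> w) * z * Gbar (h' \<diamond> w) (x \<diamond> h) z) =
        crossz h' (x \<diamond> h) z"
      proof eventually_elim
        case (elim z)
        have "(\<Sum>w\<in>FacX (ltype (x \<diamond> h)). p \<alpha> \<mu> (y \<diamond> h') (y \<diamond> h' \<diamond> w) * z *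
            Gbar (h' \<diamond> w) (x \<diamond> h) z) =
          (\<Sum>w\<in>FacX (ltype (x \<diamond> h)). stepw w * z * Gbar (h' \<diamond> w) (x \<diamond> h) z)"
          using FacX_ltype[OF ltype_FF[OF t(1)]] by (intro sum.cong) (auto simp: p_mult FF_carrier[OF s(1)] FF_carrier)
        also have "\<dots> = crossz h' (x \<diamond> h) z"
          by (rule crossz_Gbar[OF m(4) t(1) _ _ _ C(4)]) (use C elim in \<open>auto simp: field_simps\<close>)
        finally show ?case .
      qed
    qed simp
    then show "(case q of (x, h, y, h') \<Rightarrow> pmf \<nu> (y \<diamond> h') * (\<xi> (\<tau> (x \<diamond> h)) / \<xi>
        (\<tau> (y \<diamond> h'))) *
      deriv (\<lambda>z. \<Sum>w\<in>FacX (\<tau> x). p \<alpha> \<mu> (y \<diamond> h') (y \<diamond> h' \<diamond> w) * z * Gbar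
          (h' \<diamond> w) (x \<diamond> h) z) 1) =
      (case q of (x, h, y, h') \<Rightarrow> ?F (x \<diamond> h) (y \<diamond> h'))"
      using t s by (simp add: q')
  qed
  then show ?thesis unfolding sum_pairs[of ?F] .
qed

section \<open>The rate of escape\<close>

text \<open>The condition on types is built into the weight, so that sums over \<open>S\<close> need
  no side condition.\<close>

definition xratio :: "'a amalg \<Rightarrow> 'a amalg \<Rightarrow> real" where
  "xratio s t = (if ltype t \<noteq> ltype s then \<xi> (ltype t) / \<xi> (ltype s) else 0)"

lemma xratio_nonneg: "0 \<le> xratio s t"
  using less_imp_le[OF \<xi>_pos] by (simp add: xratio_def)

lemma Q_xratio: "s \<in> S \<Longrightarrow> t \<in> FF \<Longrightarrow> Q s t = xratio s t * crossz (Hpart s) t 1"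
  by (simp add: Q_eq chainp_def xratio_def)

lemma Hpart_S: "s \<in> S \<Longrightarrow> Hpart s \<in> HH"
  using S_FF FF_carrier by (blast intro: Hpart_HH)

text \<open>A vanishing transition probability is a vanishing series of nonnegative terms, so all
  coefficients vanish and the entry is zero for every \<open>z\<close>. Twisting therefore does not
  lead out of \<open>S\<close>.\<close>

lemma crossz_outside:
  assumes s: "s \<in> S" and t: "t \<in> FF" "t \<notin> S" "ltype t \<noteq> ltype s"
  shows "crossz (Hpart s) t z = 0"
proof -
  have "xratio s t * crossz (Hpart s) t 1 = 0" using Q_outside[OF s t(2)] Q_xratio[OF s t(1)] by simp
  then have "suminf (cross (Hpart s) t) = 0"
    using \<xi>_pos[of "ltype t"] \<xi>_pos[of "ltype s"] t(3) by (simp add: xratio_def crossz_one)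
  then have "cross (Hpart s) t n = 0" for n
    using suminf_eq_zero_iff[OF cross_summable[OF Hpart_S[OF s] t(1)]] cross_nonneg by blast
  then show ?thesis by (simp add: crossz_def)
qed

lemma crossd_outside: "s \<in> S \<Longrightarrow> t \<in> FF \<Longrightarrow> t \<notin> S \<Longrightarrow> ltype t \<noteq>
    ltype s \<Longrightarrow> crossd (Hpart s) t = 0"
  unfolding crossd_def using crossz_outside[of s t] by (simp add: ext[of "crossz (Hpart s) t" "\<lambda>_. 0"])

lemma sum_FF_xratio:
  assumes s: "s \<in> S" and z: "\<And>t. t \<in> FF \<Longrightarrow> t \<notin> S \<Longrightarrow> ltype t \<noteq> ltype s
      \<Longrightarrow> F t = 0"
  shows "(\<Sum>t\<in>{t \<in> FF. ltype t \<noteq> ltype s}. (\<xi> (ltype t) / \<xi> (ltype s)) * F t) = (\<Sum>t\<in>S. xratio s t * F t)"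
proof -
  have "(\<Sum>t\<in>{t \<in> FF. ltype t \<noteq> ltype s}. (\<xi> (ltype t) / \<xi> (ltype s)) * F t) = (\<Sum>t\<in>FF. xratio s t * F t)"
    by (rule sum.mono_neutral_cong_left) (auto simp: finite_FF xratio_def)
  also have "\<dots> = (\<Sum>t\<in>S. xratio s t * F t)"
    by (rule sum.mono_neutral_right) (use finite_FF S_FF z in \<open>auto simp: xratio_def\<close>)
  finally show ?thesis .
qed

lemma sum_nu_FF:
  assumes "set_pmf \<nu> \<subseteq> S"
  shows "(\<Sum>s\<in>FF. pmf \<nu> s * F s) = (\<Sum>s\<in>S. pmf \<nu> s * F s)"
  by (rule sum.mono_neutral_right) (use finite_FF S_FF assms in \<open>auto simp: set_pmf_iff\<close>)

lemma \<Delta>_S: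
  assumes "set_pmf \<nu> \<subseteq> S"
  shows "\<Delta> \<nu> = (\<Sum>s\<in>S. pmf \<nu> s * (\<Sum>t\<in>S. xratio s t * (ll t * crossz (Hpart s) t 1)))"
proof -
  have "\<Delta> \<nu> = (\<Sum>s\<in>FF. pmf \<nu> s * (\<Sum>t\<in>{t \<in> FF. ltype t \<noteq> ltype s}. (\<xi> (ltype t) /
      \<xi> (ltype s)) * (ll t * crossz (Hpart s) t 1)))"
    unfolding \<Delta>_eq sum_distrib_left by (simp only: mult.assoc)
  also have "\<dots> = (\<Sum>s\<in>S. pmf \<nu> s * (\<Sum>t\<in>{t \<in> FF. ltype t \<noteq> ltype s}. (\<xi> (ltype t) / \<xi>
      (ltype s)) * (ll t * crossz (Hpart s) t 1)))"
    by (rule sum_nu_FF[OF assms])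
  also have "\<dots> = (\<Sum>s\<in>S. pmf \<nu> s * (\<Sum>t\<in>S. xratio s t * (ll t * crossz (Hpart s) t 1)))"
    by (intro sum.cong HOL.refl arg_cong2[where f = "(*)"] sum_FF_xratio) (simp_all add: crossz_outside)
  finally show ?thesis .
qed

lemma \<Lambda>_S:
  assumes "set_pmf \<nu> \<subseteq> S"
  shows "\<Lambda> \<nu> = (\<Sum>s\<in>S. pmf \<nu> s * (\<Sum>t\<in>S. xratio s t * crossd (Hpart s) t))"
proof -
  have "\<Lambda> \<nu> = (\<Sum>s\<in>FF. pmf \<nu> s * (\<Sum>t\<in>{t \<in> FF. ltype t \<noteq> ltype s}. (\<xi> (ltype t) /
      \<xi> (ltype s)) * crossd (Hpart s) t))"
    unfolding \<Lambda>_eq sum_distrib_left by (simp only: mult.assoc)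
  also have "\<dots> = (\<Sum>s\<in>S. pmf \<nu> s * (\<Sum>t\<in>{t \<in> FF. ltype t \<noteq> ltype s}. (\<xi> (ltype t) / \<xi>
      (ltype s)) * crossd (Hpart s) t))"
    by (rule sum_nu_FF[OF assms])
  also have "\<dots> = (\<Sum>s\<in>S. pmf \<nu> s * (\<Sum>t\<in>S. xratio s t * crossd (Hpart s) t))"
    by (intro sum.cong HOL.refl arg_cong2[where f = "(*)"] sum_FF_xratio) (simp_all add: crossd_outside)
  finally show ?thesis .
qed

text \<open>\<open>\<Lambda>\<close> is the mean time between successive exits, and a crossing takes
  at least one step. This makes the quotient in the final result meaningful.\<close>

lemma \<Lambda>_ge_1:
  assumes "set_pmf \<nu> \<subseteq> S"
  shows "1 \<le> \<Lambda> \<nu>"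
proof -
  have "1 = (\<Sum>s\<in>S. pmf \<nu> s)" using sum_pmf_eq_1[OF finite_S assms] by simp
  also have "\<dots> = (\<Sum>s\<in>S. pmf \<nu> s * (\<Sum>t\<in>S. xratio s t * crossz (Hpart s) t 1))"
  proof (rule sum.cong[OF HOL.refl])
    fix s assume s: "s \<in> S"
    have "(\<Sum>t\<in>S. xratio s t * crossz (Hpart s) t 1) = (\<Sum>t\<in>S. Q s t)"
      using S_FF by (intro sum.cong) (auto simp: Q_xratio[OF s])
    then show "pmf \<nu> s = pmf \<nu> s * (\<Sum>t\<in>S. xratio s t * crossz (Hpart s) t 1)" using Q_sum[OF s] by simp
  qed
  also have "\<dots> \<le> \<Lambda> \<nu>" unfolding \<Lambda>_S[OF assms]
    using S_FF by (intro sum_mono mult_left_mono crossz_deriv(2) Hpart_S xratio_nonneg) auto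
  finally show ?thesis .
qed

text \<open>The twist is \<open>z = exp (\<theta> * b)\<close> and \<open>c = \<theta> * a\<close>.
  For small positive \<open>\<theta>\<close> the vector \<open>1 + \<theta> * g\<close> is strictly
  decreased by the conjugated twisted matrix, which is the contraction that
  \<open>chernoff_AE\<close> requires.\<close>

lemma AE_exponential_decay:
  assumes irr: irreducible_chain and inv: "invariant \<nu>" and neg: "a * \<Delta> \<nu> + b * \<Lambda> \<nu> < 0"
  obtains \<theta> where "0 < \<theta>" "AE \<omega> in P ee. \<forall>\<^sub>F m in sequentially. exp (\<theta> * b) ^ m * exp
      ((\<theta> * a) * ll (X m \<omega>)) < 1"
proof -
  have sup: "set_pmf \<nu> \<subseteq> S" using inv by (simp add: invariant_def)
  \<comment> \<open>The derivative at \<open>\<theta> = 0\<close> of the row sum at \<open>s\<close>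
    of the conjugated twisted matrix; its mean under \<open>\<nu>\<close> is the assumed negative
    combination.\<close>
  define D where "D s = (\<Sum>t\<in>S. xratio s t * (b * crossd (Hpart s) t + a * ll t * crossz (Hpart s) t 1))" for s
  have Ds: "D s = a * (\<Sum>t\<in>S. xratio s t * (ll t * crossz (Hpart s) t 1)) + b * (\<Sum>t\<in>S. xratio s t * crossd (Hpart s) t)" for s
    unfolding D_def sum_distrib_left sum.distrib[symmetric] by (rule sum.cong) (auto simp: algebra_simps)
  have lin: "(\<Sum>s\<in>S. pmf \<nu> s * (a * U s + b * V s)) = a * (\<Sum>s\<in>S. pmf \<nu> s * U s) + b * (\<Sum>s\<in>S. pmf \<nu> s * V s)"
    for U V by (simp add: sum.distrib sum_distrib_left distrib_left mult.left_commute)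
  have "(\<Sum>s\<in>S. pmf \<nu> s * D s) = a * \<Delta> \<nu> + b * \<Lambda> \<nu>"
    unfolding \<Delta>_S[OF sup] \<Lambda>_S[OF sup] Ds by (rule lin)
  then have nd: "(\<Sum>s\<in>S. pmf \<nu> s * D s) < 0" using neg by simp
  obtain g where g: "\<And>s. s \<in> S \<Longrightarrow> D s + (\<Sum>t\<in>S. Q s t * g t) < g s"
  proof (rule negative_drift[of S Q "pmf \<nu>" D])
    show "finite S" by (rule finite_S)
    show "(\<Sum>s\<in>S. pmf \<nu> s) = 1" by (rule sum_pmf_eq_1[OF finite_S sup])
    show "(\<Sum>s\<in>S. pmf \<nu> s * Q s t) = pmf \<nu> t" if "t \<in> S" for t using inv that by (simp add: invariant_def)
    show "(s, t) \<in> {(a, b). a \<in> S \<and> b \<in> S \<and> 0 < Q a b}\<^sup>*" if "s \<in> S" "t \<in> S" for s t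
      using irr that by (simp add: irreducible_chain_def)
  qed (use Q_nonneg Q_sum nd in auto)
  obtain C \<rho> where C: "0 \<le> C" "0 < \<rho>" "\<rho> < 1" "\<And>n a b. a \<in> carrier G \<Longrightarrow> b \<in> carrier
      G \<Longrightarrow> pn n a b \<le> C * \<rho> ^ n"
    using exp_decay by blast
  \<comment> \<open>The conjugated twisted matrix applied to \<open>1 + \<theta> * g\<close>. At
    \<open>\<theta> = 0\<close> it equals 1 because \<open>Q\<close> is stochastic, so the
    comparison with \<open>1 + \<theta> * g s\<close> starts from equality and is decided by the
    derivative \<open>D s + (Q g) s - g s\<close>, which is negative.\<close>
  define F where "F s \<theta> = (\<Sum>t\<in>S. xratio s t * (crossz (Hpart s) t (exp (\<theta> * b)) * exp (\<theta> * (a * ll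
      t)) * (1 + \<theta> * g t)))" for s \<theta>
  have ev: "\<forall>\<^sub>F \<theta> in at_right 0. F s \<theta> < 1 + \<theta> * g s" if s: "s \<in> S" for s
  proof -
    have dt: "((\<lambda>\<theta>. crossz (Hpart s) t (exp (\<theta> * b)) * exp (\<theta> * (a * ll t)) * (1 + \<theta> * g t))
      has_real_derivative b * crossd (Hpart s) t + a * ll t * crossz (Hpart s) t 1 + crossz (Hpart s) t 1 * g t) (at 0)" if t: "t \<in> S" for t
    proof -
      have "(crossz (Hpart s) t has_field_derivative crossd (Hpart s) t) (at (exp (0 * b)))"
        using crossz_deriv(1)[OF Hpart_S[OF s], of t] t S_FF by auto
      moreover have "((\<lambda>\<theta>. exp (\<theta> * b)) has_real_derivative b) (at 0)" by (auto intro!: derivative_eq_intros)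
      ultimately have "((\<lambda>\<theta>. crossz (Hpart s) t (exp (\<theta> * b))) has_real_derivative crossd (Hpart s) t * b) (at 0)"
        by (rule DERIV_chain2)
      then show ?thesis by (auto intro!: derivative_eq_intros simp: algebra_simps)
    qed
    have "((\<lambda>\<theta>. F s \<theta> - (1 + \<theta> * g s)) has_real_derivative
      (\<Sum>t\<in>S. xratio s t * (b * crossd (Hpart s) t + a * ll t * crossz (Hpart s) t 1 + crossz (Hpart s) t 1 * g t)) - g s) (at 0)"
      unfolding F_def by (intro DERIV_diff DERIV_sum DERIV_cmult dt) (auto intro!: derivative_eq_intros)
    moreover have "(\<Sum>t\<in>S. xratio s t * (b * crossd (Hpart s) t + a * ll t * crossz (Hpart s) t 1 + crossz (Hpart s) t 1 * g t)) - g s =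
      D s + (\<Sum>t\<in>S. Q s t * g t) - g s"
    proof -
      have "(\<Sum>t\<in>S. Q s t * g t) = (\<Sum>t\<in>S. xratio s t * (crossz (Hpart s) t 1 * g t))"
        using S_FF by (intro sum.cong) (auto simp: Q_xratio[OF s])
      then show ?thesis unfolding D_def by (simp add: distrib_left sum.distrib)
    qed
    ultimately have dF: "((\<lambda>\<theta>. F s \<theta> - (1 + \<theta> * g s)) has_real_derivative D s + (\<Sum>t\<in>S. Q s t
        * g t) - g s) (at 0)"
      by (simp only:)
    have "D s + (\<Sum>t\<in>S. Q s t * g t) - g s < 0" using g[OF s] by simp
    from has_real_derivative_neg_dec_right[OF dF this]
    obtain d where d: "0 < d" "\<And>h. 0 < h \<Longrightarrow> h < d \<Longrightarrow> F s h - (1 + h * g s) < F s 0 - 1" by auto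
    have "F s 0 = (\<Sum>t\<in>S. Q s t)" unfolding F_def using S_FF by (intro sum.cong) (auto simp: Q_xratio[OF s])
    then have "F s 0 = 1" using Q_sum[OF s] by simp
    then show ?thesis using d by (auto simp: eventually_at_right_field intro!: exI[of _ d]) 
  qed
  have "\<forall>\<^sub>F \<theta> in at_right 0. \<forall>s\<in>S. F s \<theta> < 1 + \<theta> * g s"
    using ev finite_S by (simp add: eventually_ball_finite_distrib)
  moreover have "\<forall>\<^sub>F \<theta> in at_right 0. \<forall>s\<in>S. 0 < 1 + \<theta> * g s"
  proof -
    have "\<forall>\<^sub>F \<theta> in at_right 0. 0 < 1 + \<theta> * g s" for s
    proof (rule order_tendstoD(1))
      show "((\<lambda>\<theta>. 1 + \<theta> * g s) \<longlongrightarrow> 1 + 0 * g s) (at_right 0)" by (intro tendsto_intros)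
    qed simp
    then show ?thesis using finite_S by (simp add: eventually_ball_finite_distrib)
  qed
  moreover have "\<forall>\<^sub>F \<theta> in at_right 0. exp (\<theta> * b) * \<rho> < 1"
  proof (rule order_tendstoD(2))
    show "((\<lambda>\<theta>. exp (\<theta> * b) * \<rho>) \<longlongrightarrow> exp (0 * b) * \<rho>) (at_right 0)" by (intro tendsto_intros)
  qed (use C in simp)
  moreover have "\<forall>\<^sub>F \<theta> in at_right (0::real). 0 < \<theta>" by (simp add: eventually_at_right_less)
  ultimately have "\<forall>\<^sub>F \<theta> in at_right 0. (\<forall>s\<in>S. F s \<theta> < 1 + \<theta> * g s) \<and>
      (\<forall>s\<in>S. 0 < 1 + \<theta> * g s) \<and>
    exp (\<theta> * b) * \<rho> < 1 \<and> 0 < \<theta>" by eventually_elim blast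
  then obtain \<theta> where \<theta>: "\<And>s. s \<in> S \<Longrightarrow> F s \<theta> < 1 + \<theta> * g s" "\<And>s. s \<in> S
      \<Longrightarrow> 0 < 1 + \<theta> * g s"
    "exp (\<theta> * b) * \<rho> < 1" "0 < \<theta>"
    using eventually_happens'[OF trivial_limit_at_right_real] by blast
  define z where "z = exp (\<theta> * b)"
  have z: "0 < z" "z * \<rho> < 1" using \<theta> by (auto simp: z_def)
  \<comment> \<open>The worst contraction ratio over the finitely many states; inserting 0 keeps
    \<open>q\<close> nonnegative and the set nonempty.\<close>
  define q where "q = Max (insert 0 ((\<lambda>s. F s \<theta> / (1 + \<theta> * g s)) ` S))"
  have q0: "0 \<le> q" unfolding q_def using finite_S by (intro Max_ge) auto
  have q1: "q < 1" unfolding q_def using finite_S \<theta> by (subst Max_less_iff) auto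
  have Fq: "F s \<theta> \<le> q * (1 + \<theta> * g s)" if s: "s \<in> S" for s
  proof -
    have "F s \<theta> / (1 + \<theta> * g s) \<le> q" unfolding q_def using finite_S s by (intro Max_ge) auto
    then show ?thesis using \<theta>(2)[OF s] by (simp add: pos_divide_le_eq)
  qed
  \<comment> \<open>The factor \<open>\<xi>\<close> undoes the conjugation. Outside \<open>S\<close>
    the matrix entries from \<open>S\<close> vanish, so any positive value is admissible
    there.\<close>
  define \<gamma> where "\<gamma> t = \<xi> (ltype t) * (if t \<in> S then 1 + \<theta> * g t else 1)" for t
  have "AE \<omega> in P ee. \<forall>\<^sub>F m in sequentially. z ^ m * exp ((\<theta> * a) * ll (X m \<omega>)) < 1"
  proof (rule chernoff_AE[where \<gamma> = \<gamma> and \<rho> = q and \<beta> = "C / (1 - z * \<rho>)"])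
    show "0 < z" by (rule z)
    show "summable (\<lambda>n. cross h t n * z ^ Suc n)" if "h \<in> HH" "t \<in> FF" for h t
      by (rule cross_sums[OF that _ z(2) _ C(4)]) (use z C in auto)
    show "0 < \<gamma> t" if "t \<in> FF" for t using \<xi>_pos \<theta>(2) by (auto simp: \<gamma>_def)
    show "0 \<le> q" "q < 1" by (rule q0, rule q1)
    show "(\<Sum>t\<in>{t \<in> FF. ltype t \<noteq> ltype s}. crossz (Hpart s) t z * exp (\<theta> * a * ll t) * \<gamma> t) \<le>
        q * \<gamma> s" if "s \<in> visited" for s
    proof -
      have s: "s \<in> S" using that S_eq by simp
      have "(\<Sum>t\<in>{t \<in> FF. ltype t \<noteq> ltype s}. crossz (Hpart s) t z * exp (\<theta> * a * ll t) * \<gamma> t) =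
        \<xi> (ltype s) * (\<Sum>t\<in>{t \<in> FF. ltype t \<noteq> ltype s}. (\<xi> (ltype t) / \<xi> (ltype s)) *
          (crossz (Hpart s) t z * exp (\<theta> * (a * ll t)) * (if t \<in> S then 1 + \<theta> * g t else 1)))"
        unfolding sum_distrib_left using less_imp_neq[OF \<xi>_pos[of "ltype s"]]
        by (intro sum.cong) (auto simp: \<gamma>_def mult_ac)
      also have "\<dots> = \<xi> (ltype s) * (\<Sum>t\<in>S. xratio s t * (crossz (Hpart s) t z * exp (\<theta> * (a * ll t)) * (if
          t \<in> S then 1 + \<theta> * g t else 1)))"
        by (subst sum_FF_xratio[OF s]) (simp_all add: crossz_outside[OF s])
      also have "(\<Sum>t\<in>S. xratio s t * (crossz (Hpart s) t z * exp (\<theta> * (a * ll t)) * (if t \<in> S then 1 + \<theta>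
          * g t else 1))) = F s \<theta>"
        unfolding F_def z_def by (rule sum.cong) auto
      also have "\<xi> (ltype s) * F s \<theta> \<le> \<xi> (ltype s) * (q * (1 + \<theta> * g s))"
        using Fq[OF s] \<xi>_pos[of "ltype s"] by (intro mult_left_mono) auto
      finally show ?thesis using s by (simp add: \<gamma>_def mult_ac)
    qed
    show "(\<Sum>m\<le>M. pn m ee w * z ^ m) \<le> C / (1 - z * \<rho>)" if w: "w \<in> carrier G" for M w
    proof -
      have "(\<Sum>m\<le>M. pn m ee w * z ^ m) \<le> (\<Sum>m\<le>M. C * (z * \<rho>) ^ m)"
      proof (rule sum_mono)
        fix m
        have "pn m ee w * z ^ m \<le> C * \<rho> ^ m * z ^ m" using C(4)[OF GG.one_closed w] z by (intro mult_right_mono) auto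
        then show "pn m ee w * z ^ m \<le> C * (z * \<rho>) ^ m" by (simp add: power_mult_distrib mult_ac)
      qed
      also have "\<dots> \<le> (\<Sum>m. C * (z * \<rho>) ^ m)"
        using z C by (intro sum_le_suminf summable_mult summable_geometric) auto
      also have "\<dots> = C * (\<Sum>m. (z * \<rho>) ^ m)" using z C by (intro suminf_mult summable_geometric) auto
      also have "\<dots> = C / (1 - z * \<rho>)" using z C by (subst suminf_geometric) auto
      finally show ?thesis .
    qed
  qed
  then show ?thesis using that \<theta>(4) unfolding z_def by blast
qed

lemma rate_of_escape:
  assumes irr: irreducible_chain and inv: "invariant \<nu>"
  shows "AE \<omega> in P ee. (\<lambda>n. ll (X n \<omega>) / real n) \<longlonglongrightarrow> \<Delta> \<nu> / \<Lambda> \<nu>"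
proof -
  let ?c = "\<Delta> \<nu> / \<Lambda> \<nu>"
  have sup: "set_pmf \<nu> \<subseteq> S" using inv by (simp add: invariant_def)
  have La: "0 < \<Lambda> \<nu>" using \<Lambda>_ge_1[OF sup] by simp
  have De: "\<Delta> \<nu> = ?c * \<Lambda> \<nu>" using La by simp
  have bound: "AE \<omega> in P ee. \<forall>\<^sub>F n in sequentially. \<bar>ll (X n \<omega>) / real n - ?c\<bar> < \<epsilon>"
      if \<epsilon>: "0 < \<epsilon>" for \<epsilon>
  proof -
    \<comment> \<open>For either choice of coefficients the combination is
      \<open>- \<epsilon> * \<Lambda> \<nu>\<close>, negative because \<open>\<Lambda> \<nu>\<close>
      is positive.\<close>
    have "1 * \<Delta> \<nu> + (- (?c + \<epsilon>)) * \<Lambda> \<nu> < 0" using De La \<epsilon> by (simp add: algebra_simps)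
    then obtain \<theta>1 where t1: "0 < \<theta>1"
      "AE \<omega> in P ee. \<forall>\<^sub>F m in sequentially. exp (\<theta>1 * (- (?c + \<epsilon>))) ^ m * exp ((\<theta>1 * 1)
          * ll (X m \<omega>)) < 1"
      by (rule AE_exponential_decay[OF irr inv])
    have "(-1) * \<Delta> \<nu> + (?c - \<epsilon>) * \<Lambda> \<nu> < 0" using De La \<epsilon> by (simp add: algebra_simps)
    then obtain \<theta>2 where t2: "0 < \<theta>2"
      "AE \<omega> in P ee. \<forall>\<^sub>F m in sequentially. exp (\<theta>2 * (?c - \<epsilon>)) ^ m * exp ((\<theta>2 * (-1))
          * ll (X m \<omega>)) < 1"
      by (rule AE_exponential_decay[OF irr inv])
    show ?thesis using t1(2) t2(2)
    proof eventually_elim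
      case (elim \<omega>)
      show ?case using elim eventually_gt_at_top[of 0]
      proof eventually_elim
        case (elim m)
        have "exp (\<theta>1 * (ll (X m \<omega>) - (?c + \<epsilon>) * real m)) < exp 0"
          using elim(1) by (simp add: exp_of_nat_mult[symmetric] mult_exp_exp algebra_simps)
        then have "ll (X m \<omega>) < (?c + \<epsilon>) * real m" using t1(1) by (simp add: mult_less_0_iff)
        then have 1: "ll (X m \<omega>) / real m < ?c + \<epsilon>" using elim(3) by (simp add: pos_divide_less_eq)
        have "exp (\<theta>2 * ((?c - \<epsilon>) * real m - ll (X m \<omega>))) < exp 0"
          using elim(2) by (simp add: exp_of_nat_mult[symmetric] mult_exp_exp algebra_simps)
        then have "(?c - \<epsilon>) * real m < ll (X m \<omega>)" using t2(1) by (simp add: mult_less_0_iff)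
        then have "?c - \<epsilon> < ll (X m \<omega>) / real m" using elim(3) by (simp add: pos_less_divide_eq)
        with 1 show ?case by linarith
      qed
    qed
  qed
  have "AE \<omega> in P ee. \<forall>k. \<forall>\<^sub>F n in sequentially. \<bar>ll (X n \<omega>) / real n - ?c\<bar> < inverse (real (Suc k))"
    by (subst AE_all_countable) (auto intro: bound)
  then show ?thesis
  proof eventually_elim
    case (elim \<omega>)
    show ?case
    proof (rule tendstoI)
      fix e :: real assume "0 < e"
      then obtain k where k: "inverse (real (Suc k)) < e" using reals_Archimedean by blast
      show "\<forall>\<^sub>F n in sequentially. dist (ll (X n \<omega>) / real n) ?c < e"
        using elim[rule_format, of k] by eventually_elim (use k in \<open>simp add: dist_real_def\<close>)
    qed
  qed
qed

end

theorem corollary3p2: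
  fixes r :: nat
    and \<Gamma> :: "nat \<Rightarrow> 'a monoid"
    and Hs :: "nat \<Rightarrow> 'a set"
    and H :: "'h monoid"
    and \<phi> :: "nat \<Rightarrow> 'h \<Rightarrow> 'a"
    and T :: "nat \<Rightarrow> 'a set"
    and l :: "'a amalg \<Rightarrow> real"
    and \<alpha> :: "nat \<Rightarrow> real"
    and \<mu> :: "nat \<Rightarrow> 'a pmf"
    and P :: "'a amalg \<Rightarrow> 'w measure"
    and X :: "nat \<Rightarrow> 'w \<Rightarrow> 'a amalg"
    and \<nu> :: "'a amalg pmf"
  assumes walk: "amalgam_walk r \<Gamma> Hs H \<phi> T l \<alpha> \<mu> P X"
    and transient: "amalgam_walk.transient r \<Gamma> H \<phi> P X"
    and irreducible: "amalgam_walk.irreducible_chain r \<Gamma> H \<phi> T P X"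
    and invariant: "amalgam_walk.invariant r \<Gamma> H \<phi> T P X \<nu>"
  shows "AE \<omega> in P \<one>\<^bsub>amalgam.G r \<Gamma> H \<phi>\<^esub>.
    (\<lambda>n. amalgam.lext r \<Gamma> H \<phi> T l (X n \<omega>) / real n) \<longlonglongrightarrow>
      amalgam_walk.\<Delta> r \<Gamma> H \<phi> T l \<alpha> \<mu> P X \<nu> / amalgam_walk.\<Lambda> r \<Gamma> H \<phi> T \<alpha> \<mu> P X \<nu>"
proof -
  interpret transient_walk r \<Gamma> Hs H \<phi> T l \<alpha> \<mu> P X
    by (intro transient_walk.intro transient_walk_axioms.intro walk transient)
  show ?thesis by (rule rate_of_escape[OF irreducible invariant])
qed

end
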